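(* Let $\mathcal S(\mathbb P^1)$, $\mathcal S(\mathbb P^2)$ be the spaces of solutions on $\widetilde{\mathbb C^*}$ of $\vartheta^2\Phi_1=4z^2\Phi_1$ and $\vartheta^3\Phi_2=27z^3\Phi_2$ respectively, where $\vartheta=z\frac{d}{dz}$, and let $\mathcal S(\mathbb F_1)$ be the space of solutions on $\widetilde{\mathbb C^*}$ of the quantum differential equation of $\mathbb F_1$ $$(283z-24)\vartheta^4\Phi+(283z^2-590z+24)\vartheta^3\Phi+z(-2264z^2+192z+3)\vartheta^2\Phi-4z^2(2547z^2+350z-104)\vartheta\Phi+z^2(-3113z^3-9924z^2+1476z+192)\Phi=0.$$ Let $\mathcal H\subseteq\mathcal S(\mathbb P^1)\otimes\mathcal S(\mathbb P^2)$ be the $4$-dimensional subspace defined, in the coordinates $A_{0,i}B_{0,j}$ described in the context, by the linear equations $$A_{0,0}B_{0,0}=0,\qquad4A_{0,1}B_{0,0}=3A_{0,0}B_{0,1}.$$ Then $\mathcal H$ is mapped isomorphically onto $\mathcal S(\mathbb F_1)$ by the linear operator $\mathscr P:\mathcal S(\mathbb P^1)\otimes\mathcal S(\mathbb P^2)\to\mathcal O(\widetilde{\mathbb C^*})$ determined by $$\mathscr P[\Phi_1,\Phi_2](z)=e^{-z}\int_0^\infty\Phi_1\big(z^{\frac12}\lambda^{\frac12}\big)\Phi_2\big(z^{\frac23}\lambda^{\frac13}\big)e^{-\lambda}d\lambda.$$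
   Context: $\widetilde{\mathbb C^*}$ is the universal cover of $\mathbb C^*$; powers of $z$ are taken via the logarithm. Every $\Phi_1\in\mathcal S(\mathbb P^1)$ has an expansion $\Phi_1(z)=\sum_{m\ge0}(A_{m,1}+A_{m,0}\log z)\frac{z^{2m}}{(m!)^2}$, determined by arbitrary $A_{0,0},A_{0,1}\in\mathbb C$; every $\Phi_2\in\mathcal S(\mathbb P^2)$ has an expansion $\Phi_2(z)=\sum_{n\ge0}(B_{n,2}+B_{n,1}\log z+B_{n,0}\log^2z)\frac{z^{3n}}{(n!)^3}$, determined by arbitrary $B_{0,0},B_{0,1},B_{0,2}\in\mathbb C$. The products $A_{0,i}B_{0,j}$ ($i=0,1$; $j=0,1,2$), extended linearly from decomposable tensors $\Phi_1\otimes\Phi_2$, are a linear coordinate system on the $6$-dimensional space $\mathcal S(\mathbb P^1)\otimes\mathcal S(\mathbb P^2)$. *)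

theory Defs
  imports "HOL-Analysis.Analysis" "HOL-Library.Function_Algebras"
begin

section \<open>Complex vector spaces of functions\<close>

definition fscale :: "complex \<Rightarrow> ('a \<Rightarrow> complex) \<Rightarrow> 'a \<Rightarrow> complex" where
  "fscale c f = (\<lambda>x. c * f x)"

global_interpretation fvec: vector_space "fscale :: complex \<Rightarrow> ('a \<Rightarrow> complex) \<Rightarrow> 'a \<Rightarrow> complex"
  by unfold_locales (auto simp: fscale_def fun_eq_iff algebra_simps)

definition linear_on ::
  "(complex \<Rightarrow> 'u::ab_group_add \<Rightarrow> 'u) \<Rightarrow> (complex \<Rightarrow> 'v::ab_group_add \<Rightarrow> 'v) \<Rightarrow> 'u set \<Rightarrow> ('u \<Rightarrow> 'v) \<Rightarrow> bool"
where
  "linear_on sU sV U L \<longleftrightarrow>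
     (\<forall>s\<in>U. \<forall>t\<in>U. L (s + t) = L s + L t) \<and> (\<forall>c. \<forall>s\<in>U. L (sU c s) = sV c (L s))"

definition bilinear_on ::
  "(complex \<Rightarrow> 'v::ab_group_add \<Rightarrow> 'v) \<Rightarrow> ('a \<Rightarrow> complex) set \<Rightarrow> ('b \<Rightarrow> complex) set
     \<Rightarrow> (('a \<Rightarrow> complex) \<Rightarrow> ('b \<Rightarrow> complex) \<Rightarrow> 'v) \<Rightarrow> bool"
where
  "bilinear_on sV S1 S2 \<beta> \<longleftrightarrow>
     (\<forall>f\<in>S1. linear_on fscale sV S2 (\<beta> f)) \<and> (\<forall>g\<in>S2. linear_on fscale sV S1 (\<lambda>f. \<beta> f g))"


section \<open>Tensor products of spaces of functions\<close>

text \<open>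
  The tensor product of two spaces of functions is realised inside the functions of two
  variables, with the decomposable tensor of \<open>f\<close> and \<open>g\<close> being \<open>(u, v) \<mapsto> f u * g v\<close>.
  That this is a tensor product of vector spaces (universal property for bilinear maps) is
  shown below in \<open>tensor_lift_linear\<close>, \<open>tensor_lift_tensor\<close> and \<open>tensor_lift_unique\<close>.
\<close>

definition tensor :: "('a \<Rightarrow> complex) \<Rightarrow> ('b \<Rightarrow> complex) \<Rightarrow> 'a \<times> 'b \<Rightarrow> complex" where
  "tensor f g = (\<lambda>(u, v). f u * g v)"

definition tensor_space ::
  "('a \<Rightarrow> complex) set \<Rightarrow> ('b \<Rightarrow> complex) set \<Rightarrow> ('a \<times> 'b \<Rightarrow> complex) set" where
  "tensor_space S1 S2 = fvec.span {tensor f g |f g. f \<in> S1 \<and> g \<in> S2}"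

text \<open>
  Linear extension of a bilinear map from decomposable tensors: the common value of the sums
  \<open>\<Sum>k. \<beta> (f k) (g k)\<close> over all presentations of \<open>t\<close> as \<open>\<Sum>k. f k \<otimes> g k\<close>.
\<close>

definition tensor_lift ::
  "('a \<Rightarrow> complex) set \<Rightarrow> ('b \<Rightarrow> complex) set
     \<Rightarrow> (('a \<Rightarrow> complex) \<Rightarrow> ('b \<Rightarrow> complex) \<Rightarrow> 'v::comm_monoid_add)
     \<Rightarrow> ('a \<times> 'b \<Rightarrow> complex) \<Rightarrow> 'v"
where
  "tensor_lift S1 S2 \<beta> t =
     (THE x. \<exists>ps. set ps \<subseteq> S1 \<times> S2 \<and> t = (\<Sum>(f, g)\<leftarrow>ps. tensor f g) \<and> x = (\<Sum>(f, g)\<leftarrow>ps. \<beta> f g))"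

lemma sum_list_fun_apply: "(\<Sum>p\<leftarrow>ps. (F p :: 'a \<Rightarrow> complex)) x = (\<Sum>p\<leftarrow>ps. F p x)"
  by (induction ps) auto

lemma sum_fun_apply: "(\<Sum>p\<in>A. (F p :: 'a \<Rightarrow> complex)) x = (\<Sum>p\<in>A. F p x)"
  by (induction A rule: infinite_finite_induct) auto

lemma linear_on_zero:
  assumes "linear_on fscale sV U L" "fvec.subspace U" "vector_space sV"
  shows "L 0 = 0"
proof -
  have "(0 :: 'a \<Rightarrow> complex) \<in> U" using assms(2) by (rule fvec.subspace_0)
  then have "L (0 + 0) = L 0 + L 0" using assms(1) unfolding linear_on_def by blast
  then show ?thesis by simp
qed

lemma linear_on_sum:
  assumes L: "linear_on fscale sV U L" and U: "fvec.subspace U" and V: "vector_space sV"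
    and "\<And>i. i \<in> I \<Longrightarrow> h i \<in> U"
  shows "L (\<Sum>i\<in>I. fscale (c i) (h i)) = (\<Sum>i\<in>I. sV (c i) (L (h i)))"
  using assms(4)
proof (induction I rule: infinite_finite_induct)
  case (insert i I)
  have "(\<Sum>i\<in>I. fscale (c i) (h i)) \<in> U"
    using insert.prems by (intro fvec.subspace_sum[OF U] fvec.subspace_scale[OF U]) auto
  moreover have "fscale (c i) (h i) \<in> U" "h i \<in> U"
    using insert.prems by (auto intro: fvec.subspace_scale[OF U])
  ultimately show ?case using insert L unfolding linear_on_def
    by (simp del: plus_fun_apply)
qed (use linear_on_zero[OF L U V] in \<open>auto simp del: zero_fun_apply\<close>)

lemma linear_on_sum_list:
  assumes L: "linear_on fscale sV U L" and U: "fvec.subspace U" and V: "vector_space sV"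
    and "\<And>p. p \<in> set ps \<Longrightarrow> h p \<in> U"
  shows "L (\<Sum>p\<leftarrow>ps. fscale (c p) (h p)) = (\<Sum>p\<leftarrow>ps. sV (c p) (L (h p)))"
    and "(\<Sum>p\<leftarrow>ps. fscale (c p) (h p)) \<in> U"
proof -
  have "L (\<Sum>p\<leftarrow>ps. fscale (c p) (h p)) = (\<Sum>p\<leftarrow>ps. sV (c p) (L (h p))) \<and>
        (\<Sum>p\<leftarrow>ps. fscale (c p) (h p)) \<in> U"
    using assms(4)
  proof (induction ps)
    case Nil
    show ?case using linear_on_zero[OF L U V] fvec.subspace_0[OF U] by (simp del: zero_fun_apply)
  next
    case (Cons p ps)
    have *: "fscale (c p) (h p) \<in> U" "h p \<in> U"
      using Cons.prems by (auto intro: fvec.subspace_scale[OF U])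
    then show ?case using Cons L fvec.subspace_add[OF U] unfolding linear_on_def
      by (simp del: plus_fun_apply)
  qed
  then show "L (\<Sum>p\<leftarrow>ps. fscale (c p) (h p)) = (\<Sum>p\<leftarrow>ps. sV (c p) (L (h p)))"
    and "(\<Sum>p\<leftarrow>ps. fscale (c p) (h p)) \<in> U" by auto
qed

lemma sum_list_sum_swap:
  "(\<Sum>p\<leftarrow>ps. \<Sum>b\<in>B. (F p b :: 'v::comm_monoid_add)) = (\<Sum>b\<in>B. \<Sum>p\<leftarrow>ps. F p b)"
  by (induction ps) (auto simp: sum.distrib)

lemma bilinear_sum_zero:
  fixes \<beta> :: "('a \<Rightarrow> complex) \<Rightarrow> ('b \<Rightarrow> complex) \<Rightarrow> 'v::ab_group_add"
  assumes S1: "fvec.subspace S1" and S2: "fvec.subspace S2"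
    and V: "vector_space sV" and \<beta>: "bilinear_on sV S1 S2 \<beta>"
    and ps: "set ps \<subseteq> S1 \<times> S2" and zero: "(\<Sum>(f, g)\<leftarrow>ps. tensor f g) = 0"
  shows "(\<Sum>(f, g)\<leftarrow>ps. \<beta> f g) = 0"
proof -
  interpret V: vector_space sV by fact
  obtain B where B: "B \<subseteq> fst ` set ps" "fvec.independent B" "fst ` set ps \<subseteq> fvec.span B"
    using fvec.maximal_independent_subset by blast
  have fin: "finite B" using B(1) finite_surj by blast
  have BS: "B \<subseteq> S1" using B(1) ps by force
  define r where "r = fvec.representation B"
  have rep: "f = (\<Sum>b\<in>B. fscale (r f b) b)" if "(f, g) \<in> set ps" for f g
  proof -
    have "f \<in> fvec.span B" using B(3) that by force
    then show ?thesis unfolding r_def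
      using fvec.sum_representation_eq[OF B(2) _ fin order_refl] by metis
  qed
  define G where "G b = (\<Sum>p\<leftarrow>ps. fscale (r (fst p) b) (snd p))" for b
  have G0: "G b = 0" if "b \<in> B" for b
  proof
    fix v
    have "(\<Sum>b\<in>B. fscale (G b v) b) = 0"
    proof
      fix u
      have "(\<Sum>b\<in>B. fscale (G b v) b) u = (\<Sum>p\<leftarrow>ps. \<Sum>b\<in>B. r (fst p) b * b u * snd p v)"
        unfolding sum_list_sum_swap
        by (simp add: sum_fun_apply G_def sum_list_fun_apply fscale_def
              sum_list_const_mult[symmetric] mult_ac)
      also have "\<dots> = (\<Sum>p\<leftarrow>ps. fst p u * snd p v)"
      proof (intro arg_cong[of _ _ sum_list] map_cong refl)
        fix p assume "p \<in> set ps"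
        then have "fst p = (\<Sum>b\<in>B. fscale (r (fst p) b) b)" using rep[of "fst p" "snd p"] by simp
        then have "fst p u = (\<Sum>b\<in>B. fscale (r (fst p) b) b) u" by (rule arg_cong)
        then show "(\<Sum>b\<in>B. r (fst p) b * b u * snd p v) = fst p u * snd p v"
          by (simp add: sum_fun_apply fscale_def sum_distrib_right)
      qed
      also have "\<dots> = (\<Sum>(f, g)\<leftarrow>ps. tensor f g) (u, v)"
        by (simp add: sum_list_fun_apply tensor_def case_prod_beta)
      finally show "(\<Sum>b\<in>B. fscale (G b v) b) u = 0 u" using zero by simp
    qed
    then show "G b v = 0 v"
      using fvec.independentD[OF B(2) fin order_refl _ that, of "\<lambda>b. G b v"] by simp
  qed
  have "(\<Sum>(f, g)\<leftarrow>ps. \<beta> f g) = (\<Sum>p\<leftarrow>ps. \<Sum>b\<in>B. sV (r (fst p) b) (\<beta> b (snd p)))"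
  proof (intro arg_cong[of _ _ sum_list] map_cong refl)
    fix p assume p: "p \<in> set ps"
    then have "fst p = (\<Sum>b\<in>B. fscale (r (fst p) b) b)" using rep[of "fst p" "snd p"] by simp
    then have "\<beta> (fst p) (snd p) = \<beta> (\<Sum>b\<in>B. fscale (r (fst p) b) b) (snd p)" by simp
    also have "\<dots> = (\<Sum>b\<in>B. sV (r (fst p) b) (\<beta> b (snd p)))"
      by (rule linear_on_sum[OF _ S1 V, of "\<lambda>f. \<beta> f (snd p)"])
         (use \<beta> ps p BS in \<open>auto simp: bilinear_on_def\<close>)
    finally show "(case p of (f, g) \<Rightarrow> \<beta> f g) = (\<Sum>b\<in>B. sV (r (fst p) b) (\<beta> b (snd p)))"
      by (simp add: case_prod_beta)
  qed
  also have "\<dots> = (\<Sum>b\<in>B. \<Sum>p\<leftarrow>ps. sV (r (fst p) b) (\<beta> b (snd p)))"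
    by (rule sum_list_sum_swap)
  also have "\<dots> = (\<Sum>b\<in>B. \<beta> b (G b))"
    unfolding G_def
    by (intro sum.cong refl linear_on_sum_list(1)[OF _ S2 V, symmetric])
       (use \<beta> ps BS in \<open>auto simp: bilinear_on_def\<close>)
  also have "\<dots> = 0"
  proof (intro sum.neutral ballI)
    fix b assume "b \<in> B"
    then have "linear_on fscale sV S2 (\<beta> b)" using \<beta> BS by (auto simp: bilinear_on_def)
    then show "\<beta> b (G b) = 0" using G0[OF \<open>b \<in> B\<close>] linear_on_zero[OF _ S2 V] by simp
  qed
  finally show ?thesis .
qed

lemma tensor_fscale_left: "tensor (fscale c f) g = fscale c (tensor f g)"
  by (auto simp: tensor_def fscale_def fun_eq_iff)

lemma sum_list_scale_left:
  fixes c :: complex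
  assumes S1: "fvec.subspace S1" and V: "vector_space sV" and \<beta>: "bilinear_on sV S1 S2 \<beta>"
    and ps: "set ps \<subseteq> S1 \<times> S2"
  defines "qs \<equiv> map (\<lambda>(f, g). (fscale c f, g)) ps"
  shows "set qs \<subseteq> S1 \<times> S2"
    and "(\<Sum>(f, g)\<leftarrow>qs. tensor f g) = fscale c (\<Sum>(f, g)\<leftarrow>ps. tensor f g)"
    and "(\<Sum>(f, g)\<leftarrow>qs. \<beta> f g) = sV c (\<Sum>(f, g)\<leftarrow>ps. \<beta> f g)"
proof -
  interpret V: vector_space sV by fact
  have "set qs \<subseteq> S1 \<times> S2 \<and>
     (\<Sum>(f, g)\<leftarrow>qs. tensor f g) = fscale c (\<Sum>(f, g)\<leftarrow>ps. tensor f g) \<and>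
     (\<Sum>(f, g)\<leftarrow>qs. \<beta> f g) = sV c (\<Sum>(f, g)\<leftarrow>ps. \<beta> f g)"
    using ps unfolding qs_def
  proof (induction ps)
    case (Cons p ps)
    obtain f g where p: "p = (f, g)" by (cases p)
    have "\<beta> (fscale c f) g = sV c (\<beta> f g)" "fscale c f \<in> S1" "g \<in> S2"
      using \<beta> Cons.prems p fvec.subspace_scale[OF S1]
      by (auto simp: bilinear_on_def linear_on_def)
    then show ?case using Cons p
      by (auto simp: tensor_fscale_left fvec.scale_right_distrib V.scale_right_distrib
            simp del: plus_fun_apply)
  qed (auto simp del: zero_fun_apply)
  then show "set qs \<subseteq> S1 \<times> S2"
    and "(\<Sum>(f, g)\<leftarrow>qs. tensor f g) = fscale c (\<Sum>(f, g)\<leftarrow>ps. tensor f g)"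
    and "(\<Sum>(f, g)\<leftarrow>qs. \<beta> f g) = sV c (\<Sum>(f, g)\<leftarrow>ps. \<beta> f g)" by auto
qed

lemma tensor_lift_eq:
  fixes \<beta> :: "('a \<Rightarrow> complex) \<Rightarrow> ('b \<Rightarrow> complex) \<Rightarrow> 'v::ab_group_add"
  assumes S1: "fvec.subspace S1" and S2: "fvec.subspace S2"
    and V: "vector_space sV" and \<beta>: "bilinear_on sV S1 S2 \<beta>"
    and ps: "set ps \<subseteq> S1 \<times> S2"
  shows "tensor_lift S1 S2 \<beta> (\<Sum>(f, g)\<leftarrow>ps. tensor f g) = (\<Sum>(f, g)\<leftarrow>ps. \<beta> f g)"
  unfolding tensor_lift_def
proof (rule the_equality)
  show "\<exists>ps'. set ps' \<subseteq> S1 \<times> S2 \<and>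
      (\<Sum>(f, g)\<leftarrow>ps. tensor f g) = (\<Sum>(f, g)\<leftarrow>ps'. tensor f g) \<and>
      (\<Sum>(f, g)\<leftarrow>ps. \<beta> f g) = (\<Sum>(f, g)\<leftarrow>ps'. \<beta> f g)"
    using ps by blast
next
  fix x assume "\<exists>ps'. set ps' \<subseteq> S1 \<times> S2 \<and>
      (\<Sum>(f, g)\<leftarrow>ps. tensor f g) = (\<Sum>(f, g)\<leftarrow>ps'. tensor f g) \<and> x = (\<Sum>(f, g)\<leftarrow>ps'. \<beta> f g)"
  then obtain ps' where ps': "set ps' \<subseteq> S1 \<times> S2"
    "(\<Sum>(f, g)\<leftarrow>ps. tensor f g) = (\<Sum>(f, g)\<leftarrow>ps'. tensor f g)" "x = (\<Sum>(f, g)\<leftarrow>ps'. \<beta> f g)"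
    by blast
  interpret V: vector_space sV by fact
  define qs where "qs = map (\<lambda>(f, g). (fscale (-1) f, g)) ps'"
  note q = sum_list_scale_left[OF S1 V \<beta> ps'(1), of "-1", folded qs_def]
  have "(\<Sum>(f, g)\<leftarrow>ps @ qs. \<beta> f g) = 0"
    by (rule bilinear_sum_zero[OF S1 S2 V \<beta>])
       (use ps q ps'(2) in \<open>auto simp: fscale_def fun_eq_iff\<close>)
  then show "x = (\<Sum>(f, g)\<leftarrow>ps. \<beta> f g)" using q(3) ps'(3) by simp
qed

lemma bilinear_on_tensor: "bilinear_on fscale S1 S2 tensor"
  by (auto simp: bilinear_on_def linear_on_def tensor_def fscale_def fun_eq_iff algebra_simps)

lemma tensor_space_iff:
  assumes S1: "fvec.subspace S1"
  shows "t \<in> tensor_space S1 S2 \<longleftrightarrow> (\<exists>ps. set ps \<subseteq> S1 \<times> S2 \<and> t = (\<Sum>(f, g)\<leftarrow>ps. tensor f g))"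
proof
  assume "t \<in> tensor_space S1 S2"
  then show "\<exists>ps. set ps \<subseteq> S1 \<times> S2 \<and> t = (\<Sum>(f, g)\<leftarrow>ps. tensor f g)"
    unfolding tensor_space_def
  proof (induction rule: fvec.span_induct_alt)
    case base
    show ?case by (rule exI[of _ "[]"]) simp
  next
    case (step c x y)
    then obtain f g ps where "x = tensor f g" "f \<in> S1" "g \<in> S2" "set ps \<subseteq> S1 \<times> S2"
      "y = (\<Sum>(f, g)\<leftarrow>ps. tensor f g)" by blast
    then show ?case using fvec.subspace_scale[OF S1]
      by (intro exI[of _ "(fscale c f, g) # ps"]) (auto simp: tensor_fscale_left)
  qed
next
  assume "\<exists>ps. set ps \<subseteq> S1 \<times> S2 \<and> t = (\<Sum>(f, g)\<leftarrow>ps. tensor f g)"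
  then obtain ps where "set ps \<subseteq> S1 \<times> S2" "t = (\<Sum>(f, g)\<leftarrow>ps. tensor f g)" by blast
  then show "t \<in> tensor_space S1 S2"
    unfolding tensor_space_def
  proof (induction ps arbitrary: t)
    case Nil
    then show ?case by (simp add: fvec.span_zero del: zero_fun_apply)
  next
    case (Cons p ps)
    then show ?case by (cases p) (auto intro!: fvec.span_add[OF fvec.span_base] simp del: plus_fun_apply)
  qed
qed

theorem tensor_lift_tensor:
  assumes "fvec.subspace S1" "fvec.subspace S2" "vector_space sV" "bilinear_on sV S1 S2 \<beta>"
    and "f \<in> S1" "g \<in> S2"
  shows "tensor_lift S1 S2 \<beta> (tensor f g) = \<beta> f g"
  using tensor_lift_eq[OF assms(1-4), of "[(f, g)]"] assms(5,6) by simp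

theorem tensor_lift_linear:
  assumes S1: "fvec.subspace S1" and S2: "fvec.subspace S2"
    and V: "vector_space sV" and \<beta>: "bilinear_on sV S1 S2 \<beta>"
  shows "linear_on fscale sV (tensor_space S1 S2) (tensor_lift S1 S2 \<beta>)"
  unfolding linear_on_def
proof (intro conjI ballI allI)
  fix s t assume "s \<in> tensor_space S1 S2" "t \<in> tensor_space S1 S2"
  then obtain ps qs where *: "set ps \<subseteq> S1 \<times> S2" "s = (\<Sum>(f, g)\<leftarrow>ps. tensor f g)"
    "set qs \<subseteq> S1 \<times> S2" "t = (\<Sum>(f, g)\<leftarrow>qs. tensor f g)"
    unfolding tensor_space_iff[OF S1] by blast
  have "tensor_lift S1 S2 \<beta> (\<Sum>(f, g)\<leftarrow>ps @ qs. tensor f g) = (\<Sum>(f, g)\<leftarrow>ps @ qs. \<beta> f g)"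
    by (rule tensor_lift_eq[OF assms]) (use * in auto)
  then show "tensor_lift S1 S2 \<beta> (s + t) = tensor_lift S1 S2 \<beta> s + tensor_lift S1 S2 \<beta> t"
    using tensor_lift_eq[OF assms *(1)] tensor_lift_eq[OF assms *(3)] *(2,4) by simp
next
  fix c s assume "s \<in> tensor_space S1 S2"
  then obtain ps where *: "set ps \<subseteq> S1 \<times> S2" "s = (\<Sum>(f, g)\<leftarrow>ps. tensor f g)"
    unfolding tensor_space_iff[OF S1] by blast
  show "tensor_lift S1 S2 \<beta> (fscale c s) = sV c (tensor_lift S1 S2 \<beta> s)"
    using tensor_lift_eq[OF assms *(1)] *(2) sum_list_scale_left[OF S1 V \<beta> *(1), of c]
      tensor_lift_eq[OF assms, of "map (\<lambda>(f, g). (fscale c f, g)) ps"] by metis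
qed

theorem tensor_lift_unique:
  assumes S1: "fvec.subspace S1" and S2: "fvec.subspace S2"
    and V: "vector_space sV" and \<beta>: "bilinear_on sV S1 S2 \<beta>"
    and L: "linear_on fscale sV (tensor_space S1 S2) L"
    and eq: "\<And>f g. f \<in> S1 \<Longrightarrow> g \<in> S2 \<Longrightarrow> L (tensor f g) = \<beta> f g"
    and t: "t \<in> tensor_space S1 S2"
  shows "L t = tensor_lift S1 S2 \<beta> t"
proof -
  interpret V: vector_space sV by fact
  have T: "fvec.subspace (tensor_space S1 S2)" by (simp add: tensor_space_def)
  obtain ps where ps: "set ps \<subseteq> S1 \<times> S2" "t = (\<Sum>(f, g)\<leftarrow>ps. tensor f g)"
    using t unfolding tensor_space_iff[OF S1] by blast
  have "L (\<Sum>p\<leftarrow>ps. fscale 1 (tensor (fst p) (snd p))) =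
      (\<Sum>p\<leftarrow>ps. sV 1 (L (tensor (fst p) (snd p))))"
    by (rule linear_on_sum_list(1)[OF L T V])
       (use ps in \<open>force simp: tensor_space_def intro!: fvec.span_base\<close>)
  also have "\<dots> = (\<Sum>(f, g)\<leftarrow>ps. \<beta> f g)"
    by (intro arg_cong[of _ _ sum_list] map_cong refl) (use ps eq in auto)
  finally show ?thesis using tensor_lift_eq[OF S1 S2 V \<beta> ps(1)] ps(2)
    by (simp add: case_prod_unfold)
qed


section \<open>Functions on the universal cover of the punctured plane\<close>

text \<open>
  The universal cover of the punctured plane is \<open>exp\<close> on the complex plane
  (\<open>covering_space_exp_punctured_plane\<close>): the point \<open>w\<close> lies over \<open>z = exp w\<close>, and
  \<open>log z\<close> is \<open>w\<close>.  In this coordinate \<open>z * d/dz\<close> is \<open>d/dw\<close> (see \<open>theta_exp\<close>).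
\<close>

definition holo_cover :: "(complex \<Rightarrow> complex) set" where
  "holo_cover = {f. f holomorphic_on UNIV}"

definition theta :: "(complex \<Rightarrow> complex) \<Rightarrow> complex \<Rightarrow> complex" where
  "theta f = deriv f"

lemma theta_exp:
  assumes "F field_differentiable (at (exp w))"
  shows "theta (\<lambda>w. F (exp w)) w = exp w * deriv F (exp w)"
proof -
  have "((\<lambda>w. F (exp w)) has_field_derivative (deriv F (exp w) * exp w)) (at w)"
    using assms
    by (intro DERIV_chain2[of F]) (auto intro: derivative_intros simp: field_differentiable_derivI)
  then show ?thesis unfolding theta_def by (simp add: DERIV_imp_deriv mult.commute)
qed

definition sol_P1 :: "(complex \<Rightarrow> complex) set" where
  "sol_P1 = {f \<in> holo_cover. \<forall>w. let z = exp w in (theta ^^ 2) f w = 4 * z^2 * f w}"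

definition sol_P2 :: "(complex \<Rightarrow> complex) set" where
  "sol_P2 = {f \<in> holo_cover. \<forall>w. let z = exp w in (theta ^^ 3) f w = 27 * z^3 * f w}"

definition sol_F1 :: "(complex \<Rightarrow> complex) set" where
  "sol_F1 = {f \<in> holo_cover. \<forall>w. let z = exp w in
     (283*z - 24) * (theta ^^ 4) f w
     + (283*z^2 - 590*z + 24) * (theta ^^ 3) f w
     + z * (-2264*z^2 + 192*z + 3) * (theta ^^ 2) f w
     - 4*z^2 * (2547*z^2 + 350*z - 104) * theta f w
     + z^2 * (-3113*z^3 - 9924*z^2 + 1476*z + 192) * f w = 0}"


section \<open>Coordinates on the tensor product\<close>

text \<open>
  \<open>A m i\<close> and \<open>B n j\<close> are the coefficients of the expansions at \<open>z = 0\<close>; only \<open>i \<le> 1\<close> and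
  \<open>j \<le> 2\<close> occur.  Here \<open>w = log z\<close>.
\<close>

definition expansion_P1 :: "(complex \<Rightarrow> complex) \<Rightarrow> (nat \<Rightarrow> nat \<Rightarrow> complex) \<Rightarrow> bool" where
  "expansion_P1 f A \<longleftrightarrow>
     (\<forall>w. (\<lambda>m. (A m 1 + A m 0 * w) * (exp w ^ (2*m) / (fact m)^2)) sums f w)"

definition expansion_P2 :: "(complex \<Rightarrow> complex) \<Rightarrow> (nat \<Rightarrow> nat \<Rightarrow> complex) \<Rightarrow> bool" where
  "expansion_P2 f B \<longleftrightarrow>
     (\<forall>w. (\<lambda>n. (B n 2 + B n 1 * w + B n 0 * w^2) * (exp w ^ (3*n) / (fact n)^3)) sums f w)"

definition A0 :: "nat \<Rightarrow> (complex \<Rightarrow> complex) \<Rightarrow> complex" where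
  "A0 i f = (THE a. \<exists>A. expansion_P1 f A \<and> a = A 0 i)"

definition B0 :: "nat \<Rightarrow> (complex \<Rightarrow> complex) \<Rightarrow> complex" where
  "B0 j f = (THE b. \<exists>B. expansion_P2 f B \<and> b = B 0 j)"

abbreviation sol_P1_P2 :: "(complex \<times> complex \<Rightarrow> complex) set" where
  "sol_P1_P2 \<equiv> tensor_space sol_P1 sol_P2"

definition AB :: "nat \<Rightarrow> nat \<Rightarrow> (complex \<times> complex \<Rightarrow> complex) \<Rightarrow> complex" where
  "AB i j = tensor_lift sol_P1 sol_P2 (\<lambda>f g. A0 i f * B0 j g)"

definition H_space :: "(complex \<times> complex \<Rightarrow> complex) set" where
  "H_space = {t \<in> sol_P1_P2. AB 0 0 t = 0 \<and> 4 * AB 1 0 t = 3 * AB 0 1 t}"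


section \<open>The integral operator\<close>

text \<open>
  The points \<open>z^(1/2) * l^(1/2)\<close> and \<open>z^(2/3) * l^(1/3)\<close> of the universal cover have logarithms \<open>(log z + ln l) / 2\<close> and \<open>(2 * log z + ln l) / 3\<close>.
\<close>

definition P_integrand ::
  "(complex \<Rightarrow> complex) \<Rightarrow> (complex \<Rightarrow> complex) \<Rightarrow> complex \<Rightarrow> real \<Rightarrow> complex" where
  "P_integrand f g w l =
     f (w / 2 + of_real (ln l) / 2) * g (2 * w / 3 + of_real (ln l) / 3) * of_real (exp (- l))"

definition P_dec :: "(complex \<Rightarrow> complex) \<Rightarrow> (complex \<Rightarrow> complex) \<Rightarrow> complex \<Rightarrow> complex" where
  "P_dec f g w = exp (- exp w) * (LBINT l:{0<..}. P_integrand f g w l)"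

definition P_op :: "(complex \<times> complex \<Rightarrow> complex) \<Rightarrow> complex \<Rightarrow> complex" where
  "P_op = tensor_lift sol_P1 sol_P2 P_dec"

end

theory Submission
  imports Defs "HOL-Complex_Analysis.Complex_Analysis" "HOL-Real_Asymp.Real_Asymp"
begin

text \<open>
  Write \<open>X = 1/2 d/du\<close> and \<open>Y = 1/3 d/dv\<close>, so that the two equations read \<open>X\<^sup>2 f = exp (2 * u) * f\<close> and
  \<open>Y\<^sup>3 g = exp (3 * v) * g\<close> in logarithmic coordinates. Consider the integral with independent
  logarithms \<open>s\<close> and \<open>t\<close> in the two arguments,
  \<open>J(f, g)(s, t) = \<integral> f ((s + ln l) / 2) * g ((t + ln l) / 3) * exp (- l) dl\<close> over \<open>l > 0\<close>; the operator is
  \<open>exp (- z) * J(f, g)(log z, 2 * log z)\<close>. Differentiation in \<open>s\<close> and \<open>t\<close> acts as \<open>X\<close> on \<open>f\<close> and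
  \<open>Y\<close> on \<open>g\<close>, and integration by parts gives
  \<open>J(X\<^sup>2 f, g) = exp s * (J(f, g) + J(X f, g) + J(f, Y g))\<close> together with the analogous formula for \<open>J(f, Y\<^sup>3 g)\<close>.
  Thus the six functions \<open>J(X\<^sup>i f, Y\<^sup>j g)\<close> with \<open>i < 2\<close> and \<open>j < 3\<close> form a differential system of rank six
  (lemmas \<open>moment_reduce_left\<close> and \<open>moment_reduce_right\<close>).

  This system is reducible. The combination
  \<open>W = J(X f, Y g) - J(f, Y\<^sup>2 g) - exp s * J(f, Y g) + exp t * J(f, g)\<close> is annihilated by \<open>X + Y\<close>, so it depends
  only on \<open>t - s\<close> and can be read off from its limit as \<open>s\<close> and \<open>t\<close> tend to \<open>- \<infinity>\<close> together. The limit
  involves only the coefficients of index zero, and it vanishes identically exactly when the two equations that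
  define the subspace hold (lemma \<open>defect_zero\<close>). On the subspace, the vanishing of \<open>W\<close> and of its
  derivative along \<open>(w, 2 * w)\<close> leaves four of the six functions; eliminating all but \<open>J(f, g)\<close> from the
  resulting system of rank four yields the quantum differential equation of \<open>F_1\<close> (lemma \<open>F1_system\<close>).

  The operator is injective on the subspace: if the image vanishes, so do all four functions near
  \<open>z = 0\<close>, and their limits there determine the four free coordinates (lemma \<open>P_op_H\<close>). It is onto
  because a solution of an equation of order four is determined by its jet of order three at a point
  where the leading coefficient does not vanish (lemma \<open>ode_solutions_span\<close>). The same counting
  argument shows that the explicit series with logarithms exhaust the solutions for \<open>P^1\<close> and
  \<open>P^2\<close>.

  All integrals converge, and all manipulations with them are legitimate, because in terms of the
  variable \<open>x = exp (k * u)\<close> the solutions grow more slowly than \<open>exp (e * \<bar>x\<bar>)\<close> for every \<open>e > 0\<close>.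
\<close>

section \<open>Linear differential equations on the universal cover\<close>

text \<open>
  The coefficients are functions of \<open>w = log z\<close>, so that \<open>z d/dz\<close> is \<open>deriv\<close>; the leading
  coefficient \<open>a n\<close> may vanish at some points, as it does for the equation of \<open>F_1\<close>.
\<close>

definition ode_space :: "nat \<Rightarrow> (nat \<Rightarrow> complex \<Rightarrow> complex) \<Rightarrow> (complex \<Rightarrow> complex) set" where
  "ode_space n a = {f. f holomorphic_on UNIV \<and> (\<forall>w. (\<Sum>k\<le>n. a k w * (deriv ^^ k) f w) = 0)}"

lemma higher_deriv_sum_UNIV:
  fixes F :: "'i \<Rightarrow> complex \<Rightarrow> complex"
  assumes "finite I" "\<And>i. i \<in> I \<Longrightarrow> F i holomorphic_on UNIV"
  shows "(deriv ^^ k) (\<lambda>w. \<Sum>i\<in>I. F i w) z = (\<Sum>i\<in>I. (deriv ^^ k) (F i) z)"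
  using assms
proof (induction I rule: finite_induct)
  case empty
  show ?case by (induction k arbitrary: z) (auto simp: funpow_Suc_right simp del: funpow.simps)
next
  case (insert i I)
  then show ?case
    by (simp add: higher_deriv_add[of _ UNIV] holomorphic_on_sum)
qed

lemma higher_deriv_combination:
  fixes F :: "'i \<Rightarrow> complex \<Rightarrow> complex"
  assumes "finite I" "\<And>i. i \<in> I \<Longrightarrow> F i holomorphic_on UNIV"
  shows "(deriv ^^ k) (\<lambda>w. \<Sum>i\<in>I. c i * F i w) z = (\<Sum>i\<in>I. c i * (deriv ^^ k) (F i) z)"
  using assms
  by (subst higher_deriv_sum_UNIV) (auto intro!: holomorphic_intros sum.cong higher_deriv_cmult[of _ UNIV])

lemma ode_space_combination:
  assumes "finite I" "\<And>i. i \<in> I \<Longrightarrow> F i \<in> ode_space n a"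
  shows "(\<lambda>w. \<Sum>i\<in>I. c i * F i w) \<in> ode_space n a"
proof -
  have hol: "F i holomorphic_on UNIV" if "i \<in> I" for i
    using assms(2)[OF that] by (simp add: ode_space_def)
  have "(\<Sum>k\<le>n. a k w * (deriv ^^ k) (\<lambda>w. \<Sum>i\<in>I. c i * F i w) w) = 0" for w
  proof -
    have "(\<Sum>k\<le>n. a k w * (deriv ^^ k) (\<lambda>w. \<Sum>i\<in>I. c i * F i w) w)
        = (\<Sum>k\<le>n. \<Sum>i\<in>I. c i * (a k w * (deriv ^^ k) (F i) w))"
      by (simp add: higher_deriv_combination[OF assms(1) hol] sum_distrib_left mult_ac)
    also have "\<dots> = (\<Sum>i\<in>I. c i * (\<Sum>k\<le>n. a k w * (deriv ^^ k) (F i) w))"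
      by (subst sum.swap) (simp add: sum_distrib_left)
    also have "\<dots> = 0"
      using assms(2) by (intro sum.neutral ballI) (simp add: ode_space_def)
    finally show ?thesis .
  qed
  then show ?thesis
    using hol by (auto simp: ode_space_def intro!: holomorphic_intros)
qed

text \<open>
  Differentiating the equation \<open>p\<close> times at a point where the leading coefficient is nonzero, and
  expanding by Leibniz, expresses the derivative of order \<open>n + p\<close> by lower ones. Hence by induction all
  derivatives vanish, and the identity theorem applies.
\<close>

lemma ode_space_jet_zero:
  assumes a: "\<And>k. k \<le> n \<Longrightarrow> a k holomorphic_on UNIV" and lead: "a n \<xi> \<noteq> 0"
    and f: "f \<in> ode_space n a" and jet: "\<And>k. k < n \<Longrightarrow> (deriv ^^ k) f \<xi> = 0"
  shows "f = (\<lambda>w. 0)"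
proof -
  have hol: "f holomorphic_on UNIV" and eq: "\<And>w. (\<Sum>k\<le>n. a k w * (deriv ^^ k) f w) = 0"
    using f by (auto simp: ode_space_def)
  have dd: "(deriv ^^ m) ((deriv ^^ k) f) = (deriv ^^ (m + k)) f" for m k
    by (simp add: funpow_add)
  have all: "(deriv ^^ j) f \<xi> = 0" for j
  proof (induction j rule: less_induct)
    case (less j)
    show ?case
    proof (cases "j < n")
      case True
      then show ?thesis by (rule jet)
    next
      case False
      define p where "p = j - n"
      have j: "j = n + p" using False by (simp add: p_def)
      define T where "T k i = of_nat (p choose i) * (deriv ^^ i) (a k) \<xi> * (deriv ^^ (p - i + k)) f \<xi>"
        for k i
      have "(\<Sum>k\<le>n. \<Sum>i=0..p. T k i) = (deriv ^^ p) (\<lambda>w. \<Sum>k\<le>n. a k w * (deriv ^^ k) f w) \<xi>"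
        using a hol
        by (subst higher_deriv_sum_UNIV)
           (auto simp: T_def higher_deriv_mult[of _ UNIV] holomorphic_higher_deriv dd
             intro!: holomorphic_intros)
      also have "\<dots> = 0"
        unfolding eq using higher_deriv_sum_UNIV[of "{}" "\<lambda>_ _. 0"] by simp
      finally have "(\<Sum>k\<le>n. \<Sum>i=0..p. T k i) = 0" .
      moreover have "(\<Sum>k\<le>n. \<Sum>i=0..p. T k i) = (\<Sum>k\<in>{n}. \<Sum>i\<in>{0}. T k i)"
      proof -
        have "T k i = 0" if "k \<le> n" "i \<le> p" "k < n \<or> i > 0" for k i
        proof -
          have "p - i + k < j" using that unfolding j by auto
          then show ?thesis using less by (simp add: T_def)
        qed
        then show ?thesis
          by (simp add: sum.mono_neutral_right[of "{..n}" "{n}"] sum.mono_neutral_right[of "{0..p}" "{0}"])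
      qed
      ultimately show ?thesis using lead by (simp add: T_def j add.commute)
    qed
  qed
  have "f w = 0" for w
    using holomorphic_fun_eq_0_on_connected[OF hol, of \<xi>] all by auto
  then show ?thesis by auto
qed

text \<open>
  The map from coefficient vectors to the jets at \<open>\<xi>\<close> of the corresponding combinations is a square
  matrix; it is injective by the previous lemma, hence surjective. So some combination has the same jet
  as \<open>f\<close>, and their difference is zero. This one counting argument serves all three equations: it shows
  that the explicit solutions for \<open>P^1\<close> and \<open>P^2\<close> are all solutions, and that the integral
  operator is onto.
\<close>

lemma ode_solutions_span:
  fixes \<phi> :: "'n::finite \<Rightarrow> complex \<Rightarrow> complex"
  assumes a: "\<And>k. k \<le> CARD('n) \<Longrightarrow> a k holomorphic_on UNIV" and lead: "a CARD('n) \<xi> \<noteq> 0"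
    and \<phi>: "\<And>i. \<phi> i \<in> ode_space CARD('n) a"
    and indep: "\<And>c. (\<And>w. (\<Sum>i\<in>UNIV. c i * \<phi> i w) = 0) \<Longrightarrow> (\<And>i. c i = 0)"
    and f: "f \<in> ode_space CARD('n) a"
  shows "\<exists>c. \<forall>w. f w = (\<Sum>i\<in>UNIV. c i * \<phi> i w)"
proof -
  obtain e where e: "bij_betw e {0..<CARD('n)} (UNIV :: 'n set)"
    using ex_bij_betw_nat_finite[of "UNIV :: 'n set"] by auto
  define d where "d = the_inv_into {0..<CARD('n)} e"
  have d: "d i < CARD('n)" for i
    using the_inv_into_into[of e "{0..<CARD('n)}" i "{0..<CARD('n)}"] e
    by (auto simp: bij_betw_def d_def)
  have de: "d (e k) = k" if "k < CARD('n)" for k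
    using that e by (auto simp: d_def bij_betw_def the_inv_into_f_f)
  define M :: "complex^'n^'n" where "M = (\<chi> i j. (deriv ^^ d i) (\<phi> j) \<xi>)"
  have hol: "\<phi> i holomorphic_on UNIV" for i using \<phi> by (simp add: ode_space_def)
  have M: "(M *v c) $ i = (deriv ^^ d i) (\<lambda>w. \<Sum>j\<in>UNIV. c $ j * \<phi> j w) \<xi>" for c i
    by (simp add: matrix_vector_mult_def M_def higher_deriv_combination[OF _ hol] mult.commute)
  have "inj ((*v) M)"
  proof (rule injI)
    fix x y assume "M *v x = M *v y"
    then have c: "M *v (x - y) = 0" by (simp add: matrix_vector_mult_diff_distrib)
    define c where "c = x - y"
    note c = c[folded c_def]
    have "(\<lambda>w. \<Sum>j\<in>UNIV. c $ j * \<phi> j w) = (\<lambda>w. 0)"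
    proof (rule ode_space_jet_zero[where a = a and n = "CARD('n)", OF a lead ode_space_combination[OF _ \<phi>]])
      fix k assume "k < CARD('n)"
      then show "(deriv ^^ k) (\<lambda>w. \<Sum>j\<in>UNIV. c $ j * \<phi> j w) \<xi> = 0"
        using M[of c "e k"] c by (simp add: de)
    qed auto
    then have "c $ i = 0" for i using indep[of "($) c"] by meson
    then show "x = y" by (simp add: vec_eq_iff c_def)
  qed
  then have "surj ((*v) M)"
    by (rule vec.linear_inj_imp_surj[rotated]) (rule matrix_vector_mul_linear_gen)
  then obtain c where c: "(\<chi> i. (deriv ^^ d i) f \<xi>) = M *v c" by (metis surjD)
  \<comment> \<open>Indexing by \<open>option\<close> presents the difference of \<open>f\<close> and the combination as a single combination of solutions.\<close>
  define h where "h w = (\<Sum>i\<in>UNIV. (case i of None \<Rightarrow> 1 | Some j \<Rightarrow> - (c $ j)) *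
      (case i of None \<Rightarrow> f | Some j \<Rightarrow> \<phi> j) w)" for w
  have h_eq: "h w = f w - (\<Sum>j\<in>UNIV. c $ j * \<phi> j w)" for w
    by (simp add: h_def UNIV_option_conv sum.reindex sum_negf)
  have fhol: "f holomorphic_on UNIV" using f by (simp add: ode_space_def)
  have "h = (\<lambda>w. 0)"
  proof (rule ode_space_jet_zero[where a = a and n = "CARD('n)", OF a lead])
    show "h \<in> ode_space CARD('n) a"
      unfolding h_def by (rule ode_space_combination) (use f \<phi> in \<open>auto split: option.splits\<close>)
    fix k assume k: "k < CARD('n)"
    have "(deriv ^^ k) h \<xi> = (deriv ^^ k) f \<xi> - (deriv ^^ k) (\<lambda>w. \<Sum>j\<in>UNIV. c $ j * \<phi> j w) \<xi>"
      unfolding h_eq using fhol hol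
      by (intro higher_deriv_diff[of _ UNIV]) (auto intro!: holomorphic_intros)
    also have "\<dots> = 0"
      using M[of c "e k"] arg_cong[OF c, of "\<lambda>v. v $ e k"] k by (simp add: de)
    finally show "(deriv ^^ k) h \<xi> = 0" .
  qed auto
  then have "f w = (\<Sum>j\<in>UNIV. c $ j * \<phi> j w)" for w
    using h_eq[of w] by simp
  then show ?thesis by (intro exI[of _ "($) c"]) simp
qed

lemma theta_eq_deriv: "theta ^^ n = (deriv ^^ n :: (complex \<Rightarrow> complex) \<Rightarrow> _)"
  unfolding theta_def[abs_def] ..


section \<open>Functions of small exponential growth\<close>

text \<open>
  In terms of \<open>x = exp (k * w)\<close> this is growth of exponential order one and type zero, times a power of
  the logarithm; the exponent two suffices since at most \<open>log\<^sup>2\<close> occurs. Type zero is what makes the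
  product of two such functions integrable against \<open>exp (- l)\<close>, and quantifying over all \<open>e\<close>
  makes the class stable under differentiation and under multiplication by \<open>exp (k * w)\<close>.
\<close>

definition tame :: "real \<Rightarrow> (complex \<Rightarrow> complex) \<Rightarrow> bool" where
  "tame k f \<longleftrightarrow> f holomorphic_on UNIV \<and>
     (\<forall>e>0. \<exists>C. \<forall>w. norm (f w) \<le> C * (1 + norm w)^2 * exp (e * exp (k * Re w)))"

text \<open>
  The scaling makes \<open>exp (k * w)\<close> an eigenfunction with eigenvalue one; with \<open>k = 2\<close> and \<open>k = 3\<close> these
  are the operators \<open>X\<close> and \<open>Y\<close> of the introduction.
\<close>

definition scaled_deriv :: "real \<Rightarrow> (complex \<Rightarrow> complex) \<Rightarrow> complex \<Rightarrow> complex" where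
  "scaled_deriv k f = (\<lambda>w. deriv f w / of_real k)"

definition exp_times :: "real \<Rightarrow> (complex \<Rightarrow> complex) \<Rightarrow> complex \<Rightarrow> complex" where
  "exp_times k f = (\<lambda>w. exp (of_real k * w) * f w)"

lemma tame_holomorphic: "tame k f \<Longrightarrow> f holomorphic_on UNIV"
  by (simp add: tame_def)

lemma tame_continuous: "tame k f \<Longrightarrow> continuous_on UNIV f"
  by (simp add: tame_holomorphic holomorphic_on_imp_continuous_on)

lemma tame_deriv: "tame k f \<Longrightarrow> (f has_field_derivative deriv f w) (at w)"
  by (rule holomorphic_derivI[of f UNIV]) (auto simp: tame_def)

lemma tame_bound:
  assumes "tame k f" "e > 0"
  obtains C where "C \<ge> 0" "\<And>w. norm (f w) \<le> C * (1 + norm w)^2 * exp (e * exp (k * Re w))"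
proof -
  obtain C where C: "\<And>w. norm (f w) \<le> C * (1 + norm w)^2 * exp (e * exp (k * Re w))"
    using assms unfolding tame_def by blast
  have "0 \<le> C * exp e" using order_trans[OF norm_ge_zero C[of 0]] by simp
  then have "C \<ge> 0" by (simp add: zero_le_mult_iff)
  then show ?thesis using C that by blast
qed

lemma tameI:
  assumes "f holomorphic_on UNIV"
    and "\<And>e. e > 0 \<Longrightarrow> \<exists>C. \<forall>w. norm (f w) \<le> C * (1 + norm w)^2 * exp (e * exp (k * Re w))"
  shows "tame k f"
  using assms by (auto simp: tame_def)

lemma tame_add:
  assumes "tame k f" "tame k g"
  shows "tame k (\<lambda>w. f w + g w)"
proof (rule tameI)
  show "(\<lambda>w. f w + g w) holomorphic_on UNIV"
    using assms by (auto simp: tame_def intro!: holomorphic_intros)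
  fix e :: real assume e: "e > 0"
  obtain C where C: "\<And>w. norm (f w) \<le> C * (1 + norm w)^2 * exp (e * exp (k * Re w))"
    using tame_bound[OF assms(1) e] by blast
  obtain D where D: "\<And>w. norm (g w) \<le> D * (1 + norm w)^2 * exp (e * exp (k * Re w))"
    using tame_bound[OF assms(2) e] by blast
  have "norm (f w + g w) \<le> (C + D) * (1 + norm w)^2 * exp (e * exp (k * Re w))" for w
    using norm_triangle_le[OF add_mono[OF C[of w] D[of w]]] by (simp add: algebra_simps)
  then show "\<exists>C. \<forall>w. norm (f w + g w) \<le> C * (1 + norm w)^2 * exp (e * exp (k * Re w))" by blast
qed

lemma tame_cmult:
  assumes "tame k f"
  shows "tame k (\<lambda>w. c * f w)"
proof (rule tameI)
  show "(\<lambda>w. c * f w) holomorphic_on UNIV"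
    using assms by (auto simp: tame_def intro!: holomorphic_intros)
  fix e :: real assume e: "e > 0"
  obtain C where C: "\<And>w. norm (f w) \<le> C * (1 + norm w)^2 * exp (e * exp (k * Re w))"
    using tame_bound[OF assms(1) e] by blast
  have "norm (c * f w) \<le> (norm c * C) * (1 + norm w)^2 * exp (e * exp (k * Re w))" for w
    using mult_left_mono[OF C[of w], of "norm c"] by (simp add: norm_mult mult_ac)
  then show "\<exists>C. \<forall>w. norm (c * f w) \<le> C * (1 + norm w)^2 * exp (e * exp (k * Re w))" by blast
qed

text \<open>
  Cauchy's inequality on discs of radius one: moving \<open>w\<close> by one multiplies \<open>exp (k * Re w)\<close> by at most
  \<open>exp \<bar>k\<bar>\<close>, which is absorbed into \<open>e\<close>.
\<close>

lemma tame_scaled_deriv: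
  assumes f: "tame k f"
  shows "tame k (scaled_deriv k f)"
proof -
  have "tame k (deriv f)"
  proof (rule tameI)
    show "deriv f holomorphic_on UNIV"
      using f by (auto simp: tame_def intro!: holomorphic_deriv)
    fix e :: real assume e: "e > 0"
    \<comment> \<open>Shrinking the type by \<open>exp \<bar>k\<bar>\<close> compensates for moving to the boundary of the disc.\<close>
    define d where "d = e / exp \<bar>k\<bar>"
    have d: "d > 0" using e by (simp add: d_def)
    obtain C where C0: "C \<ge> 0"
      and C: "\<And>w. norm (f w) \<le> C * (1 + norm w)^2 * exp (d * exp (k * Re w))"
      using tame_bound[OF f d] by blast
    have "norm (deriv f w) \<le> (4 * C) * (1 + norm w)^2 * exp (e * exp (k * Re w))" for w
    proof -
      have "norm ((deriv ^^ 1) f w) \<le> fact 1 * ((4 * C) * (1 + norm w)^2 * exp (e * exp (k * Re w))) / 1 ^ 1"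
      proof (rule Cauchy_inequality)
        show "f holomorphic_on ball w 1" using f by (auto simp: tame_def intro: holomorphic_on_subset)
        show "continuous_on (cball w 1) f"
          using tame_continuous[OF f] continuous_on_subset by blast
        fix x assume x: "norm (w - x) = 1"
        have n: "norm x \<le> norm w + 1" using x norm_triangle_ineq2[of x w] by (simp add: norm_minus_commute)
        have "\<bar>Re (x - w)\<bar> \<le> 1" using abs_Re_le_cmod[of "x - w"] x by (simp add: norm_minus_commute)
        then have "\<bar>k * Re (x - w)\<bar> \<le> \<bar>k\<bar> * 1" unfolding abs_mult by (intro mult_left_mono) auto
        then have "k * Re x \<le> \<bar>k\<bar> + k * Re w" by (simp add: algebra_simps)
        then have "d * exp (k * Re x) \<le> d * exp (\<bar>k\<bar> + k * Re w)" using d by simp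
        also have "\<dots> = e * exp (k * Re w)" by (simp add: d_def exp_add)
        finally have 1: "exp (d * exp (k * Re x)) \<le> exp (e * exp (k * Re w))" by simp
        have "(1 + norm x)^2 \<le> (2 * (1 + norm w))^2" proof (rule power_mono)
          show "1 + norm x \<le> 2 * (1 + norm w)" using n norm_ge_zero[of w] unfolding distrib_left by linarith
        qed auto
        also have "(2 * (1 + norm w))^2 = 4 * (1 + norm w)^2" unfolding power_mult_distrib by simp
        finally have "(1 + norm x)^2 \<le> 4 * (1 + norm w)^2" .
        then have "C * (1 + norm x)^2 * exp (d * exp (k * Re x))
            \<le> C * (4 * (1 + norm w)^2) * exp (e * exp (k * Re w))"
          using C0 1 by (intro mult_mono mult_left_mono) auto
        then show "norm (f x) \<le> 4 * C * (1 + norm w)\<^sup>2 * exp (e * exp (k * Re w))"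
          using C[of x] by simp
      qed auto
      then show ?thesis by simp
    qed
    then show "\<exists>C. \<forall>w. norm (deriv f w) \<le> C * (1 + norm w)^2 * exp (e * exp (k * Re w))" by blast
  qed
  then show ?thesis
    using tame_cmult[of k "deriv f" "1 / of_real k"] by (simp add: scaled_deriv_def)
qed

lemma tame_scaled_deriv_funpow: "tame k f \<Longrightarrow> tame k ((scaled_deriv k ^^ n) f)"
  by (induction n) (auto intro: tame_scaled_deriv)

text \<open>
  The extra factor \<open>x = exp (k * Re w)\<close> is at most a multiple of \<open>exp (e / 2 * x)\<close>.
\<close>

lemma tame_exp_times:
  assumes f: "tame k f"
  shows "tame k (exp_times k f)"
proof (rule tameI)
  show "exp_times k f holomorphic_on UNIV"
    using f by (auto simp: tame_def exp_times_def intro!: holomorphic_intros)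
  fix e :: real assume e: "e > 0"
  obtain C where C0: "C \<ge> 0"
    and C: "\<And>w. norm (f w) \<le> C * (1 + norm w)^2 * exp ((e / 2) * exp (k * Re w))"
    using tame_bound[OF f, of "e / 2"] e by auto
  have "norm (exp_times k f w) \<le> (2 / e * C) * (1 + norm w)^2 * exp (e * exp (k * Re w))" for w
  proof -
    define x where "x = exp (k * Re w)"
    have "x \<le> 2 / e * exp (e / 2 * x)"
      using exp_ge_add_one_self[of "e / 2 * x"] e by (simp add: field_simps)
    then have "x * norm (f w) \<le> (2 / e * exp (e / 2 * x)) * (C * (1 + norm w)^2 * exp ((e / 2) * x))"
      using e C[of w] by (intro mult_mono) (auto simp: x_def)
    also have "exp (e / 2 * x) * exp (e / 2 * x) = exp (e * x)" by (simp flip: exp_add)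
    then have "(2 / e * exp (e / 2 * x)) * (C * (1 + norm w)^2 * exp ((e / 2) * x))
        = (2 / e * C) * (1 + norm w)^2 * exp (e * x)" by (simp add: algebra_simps)
    finally show ?thesis by (simp add: exp_times_def norm_mult x_def)
  qed
  then show "\<exists>C. \<forall>w. norm (exp_times k f w) \<le> C * (1 + norm w)^2 * exp (e * exp (k * Re w))" by blast
qed

lemma tame_power:
  assumes "n \<le> 2"
  shows "tame k (\<lambda>w. w ^ n)"
proof (rule tameI)
  fix e :: real assume e: "e > 0"
  have "norm (w ^ n) \<le> 1 * (1 + norm w)^2 * exp (e * exp (k * Re w))" for w
  proof -
    have "norm w ^ n \<le> (1 + norm w) ^ n" by (intro power_mono) auto
    also have "\<dots> \<le> (1 + norm w) ^ 2" using assms by (intro power_increasing) auto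
    also have "\<dots> \<le> (1 + norm w) ^ 2 * exp (e * exp (k * Re w))"
      using e mult_left_mono[of 1 "exp (e * exp (k * Re w))" "(1 + norm w) ^ 2"] by simp
    finally show ?thesis by (simp add: norm_power)
  qed
  then show "\<exists>C. \<forall>w. norm (w ^ n) \<le> C * (1 + norm w)^2 * exp (e * exp (k * Re w))" by blast
qed (auto intro!: holomorphic_intros)


section \<open>The Laplace pairing\<close>

text \<open>
  The two arguments receive independent logarithms \<open>s\<close> and \<open>t\<close>; the operator itself is the
  restriction to \<open>(s, t) = (w, 2 * w)\<close>. The freedom to move in other directions of the \<open>(s, t)\<close>-plane is
  what makes the conserved quantity below visible.
\<close>

definition pairing_integrand :: "(complex \<Rightarrow> complex) \<Rightarrow> (complex \<Rightarrow> complex) \<Rightarrow> complex \<Rightarrow> complex \<Rightarrow> real \<Rightarrow> complex" where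
  "pairing_integrand f g s t l = f (s / 2 + of_real (ln l) / 2) * g (t / 3 + of_real (ln l) / 3) * of_real (exp (- l))"

definition pairing :: "(complex \<Rightarrow> complex) \<Rightarrow> (complex \<Rightarrow> complex) \<Rightarrow> complex \<Rightarrow> complex \<Rightarrow> complex" where
  "pairing f g s t = (LBINT l:{0<..}. pairing_integrand f g s t l)"

text \<open>
  Up to a constant this dominates \<open>(1 + \<bar>ln l\<bar>) ^ 4 * exp (- l / 2)\<close>, the fourth power being the product
  of the two quadratic bounds for tame functions. It is integrable on \<open>{0<..}\<close>, and \<open>l * majorant l\<close>
  tends to zero at both ends.
\<close>

definition majorant :: "real \<Rightarrow> real" where
  "majorant l = (l powr (1/2) + l powr (-1/2)) * exp (- l / 2)"

text \<open>
  \<open>exp (\<bar>ln l\<bar> / 2)\<close> is one of the two powers on the right.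
\<close>

lemma ln_power4_le:
  assumes "l > (0::real)"
  shows "(1 + \<bar>ln l\<bar>) ^ 4 \<le> 8 ^ 4 * (l powr (1/2) + l powr (-1/2))"
proof -
  have "1 + \<bar>ln l\<bar> \<le> 8 * exp (\<bar>ln l\<bar> / 8)"
    using exp_ge_add_one_self[of "\<bar>ln l\<bar> / 8"] by (simp add: field_simps)
  then have "(1 + \<bar>ln l\<bar>) ^ 4 \<le> (8 * exp (\<bar>ln l\<bar> / 8)) ^ 4" by (intro power_mono) auto
  also have "\<dots> = 8 ^ 4 * exp (\<bar>ln l\<bar> / 2)" by (simp add: power_mult_distrib flip: exp_of_nat_mult)
  also have "exp (\<bar>ln l\<bar> / 2) \<le> l powr (1/2) + l powr (-1/2)"
    using assms by (auto simp: powr_def abs_if)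
  finally show ?thesis by simp
qed

text \<open>
  This is the integrand of a Gamma function.
\<close>

lemma set_integrable_powr_exp:
  assumes "a > (-1::real)"
  shows "set_integrable lborel {0<..} (\<lambda>l::real. l powr a * exp (- l / 2))"
proof -
  have "(\<lambda>t. complex_of_real t powr (of_real (a + 1) - 1) / of_real (exp (1/2 * t)))
     absolutely_integrable_on {0<..}"
    using assms by (intro absolutely_integrable_Gamma_integral) auto
  then have "set_integrable lebesgue {0<..}
      (\<lambda>t. norm (complex_of_real t powr (of_real (a + 1) - 1) / of_real (exp (1/2 * t))))"
    by (rule set_integrable_norm)
  also have "?this \<longleftrightarrow> set_integrable lebesgue {0<..} (\<lambda>l::real. l powr a * exp (- l / 2))"
    by (intro set_integrable_cong)
       (auto simp: norm_divide norm_powr_real_powr exp_minus field_simps simp flip: of_real_add)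
  finally show ?thesis
    unfolding set_integrable_def by (subst (asm) integrable_completion) auto
qed

lemma set_integrable_majorant: "set_integrable lborel {0<..} majorant"
  using set_integral_add(1)[OF set_integrable_powr_exp[of "1/2"] set_integrable_powr_exp[of "-1/2"]]
  unfolding majorant_def by (simp add: algebra_simps)

text \<open>
  For \<open>Re s \<le> R\<close> the growth of \<open>f\<close> is governed by \<open>e * exp R * l\<close>, and likewise for \<open>g\<close>; with
  \<open>e = exp (- R) / 4\<close> the two together use up only half of the decay of \<open>exp (- l)\<close>.
\<close>

lemma pairing_integrand_bound:
  assumes f: "tame 2 f" and g: "tame 3 g"
  shows "\<exists>C\<ge>0. \<forall>s t l. Re s \<le> R \<longrightarrow> Re t \<le> R \<longrightarrow> l > 0 \<longrightarrow>
     norm (pairing_integrand f g s t l) \<le> C * (1 + norm s + norm t) ^ 4 * majorant l"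
proof -
  define e where "e = exp (- R) / 4"
  have e: "e > 0" by (simp add: e_def)
  obtain A where A: "A \<ge> 0" "\<And>w. norm (f w) \<le> A * (1 + norm w)^2 * exp (e * exp (2 * Re w))"
    using tame_bound[OF f e] by blast
  obtain B where B: "B \<ge> 0" "\<And>w. norm (g w) \<le> B * (1 + norm w)^2 * exp (e * exp (3 * Re w))"
    using tame_bound[OF g e] by blast
  show ?thesis
  proof (intro exI[of _ "A * B * 8 ^ 4"] conjI allI impI)
    fix s t :: complex and l :: real
    assume s: "Re s \<le> R" and t: "Re t \<le> R" and l: "l > 0"
    \<comment> \<open>\<open>N\<close> collects the dependence on \<open>(s, t)\<close>, \<open>M\<close> that on \<open>l\<close>.\<close>
    define N where "N = 1 + norm s + norm t"
    define M where "M = 1 + \<bar>ln l\<bar>"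
    define u where "u = s / 2 + of_real (ln l) / 2"
    define v where "v = t / 3 + of_real (ln l) / 3"
    have NM: "N \<ge> 1 + norm s" "N \<ge> 1 + norm t" "M \<ge> 1" by (auto simp: N_def M_def)
    have *: "1 + a + \<bar>ln l\<bar> \<le> (1 + a) * M" if "a \<ge> 0" for a
      using that by (simp add: M_def algebra_simps)
    have "norm u \<le> norm (s / 2) + norm (complex_of_real (ln l) / 2)" unfolding u_def by (rule norm_triangle_ineq)
    then have "1 + norm u \<le> 1 + norm s + \<bar>ln l\<bar>" using norm_ge_zero[of s] norm_ge_zero[of t] by (simp add: norm_divide del: norm_ge_zero) linarith?
    also have "\<dots> \<le> (1 + norm s) * M" by (rule *) auto
    also have "\<dots> \<le> N * M" using NM by (intro mult_right_mono) auto
    finally have u1: "(1 + norm u)^2 \<le> (N * M)^2" by (intro power_mono) auto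
    have "norm v \<le> norm (t / 3) + norm (complex_of_real (ln l) / 3)" unfolding v_def by (rule norm_triangle_ineq)
    then have "1 + norm v \<le> 1 + norm t + \<bar>ln l\<bar>" using norm_ge_zero[of s] norm_ge_zero[of t] by (simp add: norm_divide del: norm_ge_zero) linarith?
    also have "\<dots> \<le> (1 + norm t) * M" by (rule *) auto
    also have "\<dots> \<le> N * M" using NM by (intro mult_right_mono) auto
    finally have v1: "(1 + norm v)^2 \<le> (N * M)^2" by (intro power_mono) auto
    have ex: "e * exp (x + ln l) \<le> l / 4" if "x \<le> R" for x
    proof -
      have "e * exp (x + ln l) = exp (x - R) * l / 4"
        using l by (simp add: e_def exp_add exp_diff exp_minus field_simps)
      also have "\<dots> \<le> 1 * l / 4" using l that by (intro divide_right_mono mult_right_mono) auto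
      finally show ?thesis by simp
    qed
    have "2 * Re u = Re s + ln l" "3 * Re v = Re t + ln l" by (auto simp: u_def v_def)
    then have u2: "exp (e * exp (2 * Re u)) \<le> exp (l / 4)" and v2: "exp (e * exp (3 * Re v)) \<le> exp (l / 4)"
      using ex[OF s] ex[OF t] by auto
    have fu: "norm (f u) \<le> A * (N * M)^2 * exp (l / 4)"
      using A u1 u2 by (intro order_trans[OF A(2)] mult_mono mult_left_mono) auto
    have gv: "norm (g v) \<le> B * (N * M)^2 * exp (l / 4)"
      using B v1 v2 by (intro order_trans[OF B(2)] mult_mono mult_left_mono) auto
    have "norm (pairing_integrand f g s t l) = norm (f u) * norm (g v) * exp (- l)"
      by (simp add: pairing_integrand_def u_def v_def norm_mult)
    also have "\<dots> \<le> (A * (N * M)^2 * exp (l / 4)) * (B * (N * M)^2 * exp (l / 4)) * exp (- l)"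
      using fu gv A B by (intro mult_right_mono mult_mono) auto
    also have "\<dots> = A * B * N ^ 4 * M ^ 4 * (exp (l / 4) * exp (l / 4) * exp (- l))"
      by (simp only: power_mult_distrib power4_eq_xxxx power2_eq_square mult_ac)
    also have "exp (l / 4) * exp (l / 4) * exp (- l) = exp (- l / 2)" by (simp flip: exp_add)
    also have "A * B * N ^ 4 * M ^ 4 * exp (- l / 2)
        \<le> A * B * N ^ 4 * (8 ^ 4 * (l powr (1/2) + l powr (-1/2))) * exp (- l / 2)"
      using ln_power4_le[OF l] A B NM by (intro mult_right_mono mult_left_mono) (auto simp: M_def N_def)
    also have "\<dots> = A * B * 8 ^ 4 * N ^ 4 * majorant l" by (simp add: majorant_def)
    finally show "norm (pairing_integrand f g s t l) \<le> A * B * 8 ^ 4 * (1 + norm s + norm t) ^ 4 * majorant l"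
      by (simp add: N_def)
  qed (use A B in auto)
qed

lemma continuous_on_pairing_integrand:
  assumes f: "continuous_on UNIV f" and g: "continuous_on UNIV g"
  shows "continuous_on {0<..} (pairing_integrand f g s t)"
  unfolding pairing_integrand_def
  by (intro continuous_intros continuous_on_compose2[OF f] continuous_on_compose2[OF g]) auto

lemma set_borel_measurable_pairing_integrand:
  assumes f: "tame 2 f" and g: "tame 3 g"
  shows "set_borel_measurable lborel {0<..} (pairing_integrand f g s t)"
  using borel_measurable_continuous_on_indicator[OF _ continuous_on_pairing_integrand[OF tame_continuous[OF f] tame_continuous[OF g]]]
  by (simp add: set_borel_measurable_def)

lemma set_integrable_pairing_integrand:
  assumes f: "tame 2 f" and g: "tame 3 g"
  shows "set_integrable lborel {0<..} (pairing_integrand f g s t)"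
proof -
  obtain C where "C \<ge> 0" and C: "\<And>s' t' l. Re s' \<le> max (Re s) (Re t) \<Longrightarrow> Re t' \<le> max (Re s) (Re t) \<Longrightarrow> l > 0 \<Longrightarrow>
     norm (pairing_integrand f g s' t' l) \<le> C * (1 + norm s' + norm t') ^ 4 * majorant l"
    using pairing_integrand_bound[OF f g, of "max (Re s) (Re t)"] by blast
  have "set_integrable lborel {0<..} (\<lambda>l. C * (1 + norm s + norm t) ^ 4 * majorant l)"
    using set_integrable_majorant by simp
  then show ?thesis
    by (rule set_integrable_bound)
       (use C[of s t] in \<open>auto intro!: AE_I2 set_borel_measurable_pairing_integrand f g order_trans[OF _ abs_ge_self]\<close>)
qed

lemma pairing_bound:
  assumes f: "tame 2 f" and g: "tame 3 g"
  shows "\<exists>C\<ge>0. \<forall>s t. Re s \<le> R \<longrightarrow> Re t \<le> R \<longrightarrow>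
     norm (pairing f g s t) \<le> C * (1 + norm s + norm t) ^ 4"
proof -
  obtain C where C: "C \<ge> 0" "\<And>s t l. Re s \<le> R \<Longrightarrow> Re t \<le> R \<Longrightarrow> l > 0 \<Longrightarrow>
     norm (pairing_integrand f g s t l) \<le> C * (1 + norm s + norm t) ^ 4 * majorant l"
    using pairing_integrand_bound[OF f g, of R] by blast
  define I where "I = (LBINT l:{0<..}. majorant l)"
  have I: "I \<ge> 0" unfolding I_def set_lebesgue_integral_def
    by (intro Bochner_Integration.integral_nonneg) (auto simp: majorant_def indicator_def)
  show ?thesis
  proof (intro exI[of _ "C * I"] conjI allI impI)
    fix s t assume st: "Re s \<le> R" "Re t \<le> R"
    have "norm (pairing f g s t) \<le> (LBINT l:{0<..}. norm (pairing_integrand f g s t l))"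
      unfolding pairing_def by (rule set_integral_norm_bound[OF set_integrable_pairing_integrand[OF f g]])
    also have "\<dots> \<le> (LBINT l:{0<..}. C * (1 + norm s + norm t) ^ 4 * majorant l)"
      using C(2)[OF st] set_integrable_majorant
      by (intro set_integral_mono set_integrable_norm set_integrable_pairing_integrand f g) auto
    also have "\<dots> = C * I * (1 + norm s + norm t) ^ 4" by (simp add: I_def)
    finally show "norm (pairing f g s t) \<le> C * I * (1 + norm s + norm t) ^ 4" .
  qed (use C I in auto)
qed

text \<open>
  Difference quotients are bounded by the supremum of the derivative, so dominated convergence
  applies along every sequence.
\<close>

lemma has_field_derivative_set_integral:
  fixes F F' :: "complex \<Rightarrow> real \<Rightarrow> complex"
  assumes S: "S \<in> sets lborel"
    and int: "\<And>w. w \<in> ball w0 1 \<Longrightarrow> set_integrable lborel S (F w)"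
    and der: "\<And>w l. w \<in> ball w0 1 \<Longrightarrow> l \<in> S \<Longrightarrow> ((\<lambda>w. F w l) has_field_derivative F' w l) (at w)"
    and meas: "set_borel_measurable lborel S (F' w0)"
    and bound: "\<And>w l. w \<in> ball w0 1 \<Longrightarrow> l \<in> S \<Longrightarrow> norm (F' w l) \<le> B l"
    and B: "set_integrable lborel S B"
  shows "((\<lambda>w. LBINT l:S. F w l) has_field_derivative (LBINT l:S. F' w0 l)) (at w0)"
proof -
  have w0: "w0 \<in> ball w0 1" by simp
  have "((\<lambda>w. LBINT l:S. F w l) has_field_derivative (LBINT l:S. F' w0 l)) (at w0 within ball w0 1)"
    unfolding has_field_derivative_iff tendsto_at_iff_sequentially
  proof (intro allI impI)
    fix X assume X: "\<forall>i. X i \<in> ball w0 1 - {w0}" and lim: "X \<longlonglongrightarrow> w0"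
    define Q where "Q i l = (F (X i) l - F w0 l) / (X i - w0)" for i l
    have XB: "X i \<in> ball w0 1" and X0: "X i \<noteq> w0" for i using X by auto
    have intQ: "set_integrable lborel S (Q i)" for i
      unfolding Q_def using int[OF XB] int[OF w0] by (intro set_integrable_divide set_integral_diff(1)) auto
    have "(\<lambda>i. LBINT l:S. Q i l) \<longlonglongrightarrow> (LBINT l:S. F' w0 l)"
      unfolding set_lebesgue_integral_def
    proof (rule integral_dominated_convergence)
      show "(\<lambda>x. indicat_real S x *\<^sub>R F' w0 x) \<in> borel_measurable lborel"
        using meas by (simp add: set_borel_measurable_def)
      show "(\<lambda>x. indicat_real S x *\<^sub>R Q i x) \<in> borel_measurable lborel" for i
        using intQ[of i] by (simp add: set_integrable_def borel_measurable_integrable)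
      show "integrable lborel (\<lambda>x. indicat_real S x *\<^sub>R B x)"
        using B by (simp add: set_integrable_def)
      have "(\<lambda>i. Q i l) \<longlonglongrightarrow> F' w0 l" if "l \<in> S" for l
        using has_field_derivative_at_within[OF der[OF w0 that], of "ball w0 1"] X lim
        unfolding has_field_derivative_iff tendsto_at_iff_sequentially Q_def o_def by blast
      then show "AE x in lborel. (\<lambda>i. indicat_real S x *\<^sub>R Q i x) \<longlonglongrightarrow> indicat_real S x *\<^sub>R F' w0 x"
        by (intro AE_I2) (auto simp: indicator_def)
      have "norm (Q i l) \<le> B l" if "l \<in> S" for i l
      proof -
        have "norm (F (X i) l - F w0 l) \<le> B l * norm (X i - w0)"
          by (rule field_differentiable_bound[of "ball w0 1" "\<lambda>w. F w l" "\<lambda>w. F' w l"])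
             (use der bound that XB w0 in \<open>auto intro: has_field_derivative_at_within\<close>)
        then show ?thesis using X0[of i] by (simp add: Q_def norm_divide field_simps)
      qed
      then show "AE x in lborel. norm (indicat_real S x *\<^sub>R Q i x) \<le> indicat_real S x *\<^sub>R B x" for i
        by (intro AE_I2) (auto simp: indicator_def)
    qed
    also have "(\<lambda>i. LBINT l:S. Q i l) = (\<lambda>w. ((LBINT l:S. F w l) - (LBINT l:S. F w0 l)) / (w - w0)) \<circ> X"
      unfolding Q_def using int[OF XB] int[OF w0]
      by (auto simp: fun_eq_iff set_integral_diff(2) set_integral_divide_zero)
    finally show "((\<lambda>w. ((LBINT l:S. F w l) - (LBINT l:S. F w0 l)) / (w - w0)) \<circ> X)
        \<longlonglongrightarrow> (LBINT l:S. F' w0 l)" .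
  qed
  then show ?thesis by (simp add: at_within_open[of w0 "ball w0 1"])
qed

lemma pairing_add_left:
  assumes "tame 2 f" "tame 2 f'" "tame 3 g"
  shows "pairing (\<lambda>w. f w + f' w) g s t = pairing f g s t + pairing f' g s t"
proof -
  have "pairing_integrand (\<lambda>w. f w + f' w) g s t = (\<lambda>l. pairing_integrand f g s t l + pairing_integrand f' g s t l)"
    by (simp add: pairing_integrand_def fun_eq_iff algebra_simps)
  then show ?thesis
    using assms by (simp add: pairing_def set_integral_add(2) set_integrable_pairing_integrand)
qed

lemma pairing_add_right:
  assumes "tame 2 f" "tame 3 g" "tame 3 g'"
  shows "pairing f (\<lambda>w. g w + g' w) s t = pairing f g s t + pairing f g' s t"
proof -
  have "pairing_integrand f (\<lambda>w. g w + g' w) s t = (\<lambda>l. pairing_integrand f g s t l + pairing_integrand f g' s t l)"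
    by (simp add: pairing_integrand_def fun_eq_iff algebra_simps)
  then show ?thesis
    using assms by (simp add: pairing_def set_integral_add(2) set_integrable_pairing_integrand)
qed

lemma pairing_cmult_left: "pairing (\<lambda>w. c * f w) g s t = c * pairing f g s t"
  unfolding pairing_def by (subst set_integral_mult_right[symmetric]) (simp add: pairing_integrand_def[abs_def] mult_ac)

lemma pairing_cmult_right: "pairing f (\<lambda>w. c * g w) s t = c * pairing f g s t"
  unfolding pairing_def by (subst set_integral_mult_right[symmetric]) (simp add: pairing_integrand_def[abs_def] mult_ac)

text \<open>
  This is \<open>\<Gamma> 1 = 1\<close>. In the limits taken below, all integrals that involve logarithms carry
  vanishing coefficients, so that no derivative of \<open>\<Gamma>\<close> enters.
\<close>

lemma pairing_const: "pairing (\<lambda>_. a) (\<lambda>_. b) s t = a * b"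
proof -
  have t: "tame k (\<lambda>_. c)" for k c
    using tame_cmult[OF tame_power[of 0 k], of c] by simp
  have i: "set_integrable lborel {0<..} (pairing_integrand (\<lambda>_. 1) (\<lambda>_. 1) s t)"
    by (rule set_integrable_pairing_integrand[OF t t])
  have "((\<lambda>l. complex_of_real l powr (1 - 1) / of_real (exp l)) has_integral Gamma 1) {0<..}"
    by (rule Gamma_integral_complex') auto
  from has_integral_eq[OF _ this, of "pairing_integrand (\<lambda>_. 1) (\<lambda>_. 1) s t"]
  have "(pairing_integrand (\<lambda>_. 1) (\<lambda>_. 1) s t has_integral 1) {0<..}"
    by (simp add: pairing_integrand_def exp_minus divide_inverse)
  then have "pairing (\<lambda>_. 1) (\<lambda>_. 1) s t = 1"
    unfolding pairing_def using set_borel_integral_eq_integral(2)[OF i] integral_unique by metis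
  then show ?thesis
    using pairing_cmult_left[of a "\<lambda>_. 1" "\<lambda>_. b" s t] pairing_cmult_right[of "\<lambda>_. 1" b "\<lambda>_. 1" s t] by simp
qed

lemma pairing_zero: "pairing (\<lambda>_. 0) g s t = 0" "pairing f (\<lambda>_. 0) s t = 0"
  using pairing_cmult_left[of 0 f g s t] pairing_cmult_right[of f 0 g s t] pairing_cmult_left[of 0 "\<lambda>_. 0" g s t] by auto

text \<open>
  Along a line \<open>(s + a * w, t + b * w)\<close>, differentiation acts on the arguments as \<open>a * X + b * Y\<close>.
\<close>

lemma has_field_derivative_pairing:
  assumes f: "tame 2 f" and g: "tame 3 g"
  shows "((\<lambda>w. pairing f g (s + a * w) (t + b * w)) has_field_derivative
     a * pairing (scaled_deriv 2 f) g (s + a * w) (t + b * w) + b * pairing f (scaled_deriv 3 g) (s + a * w) (t + b * w)) (at w)"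
proof -
  define F where "F w l = pairing_integrand f g (s + a * w) (t + b * w) l" for w l
  define F' where "F' w l = a * pairing_integrand (scaled_deriv 2 f) g (s + a * w) (t + b * w) l
      + b * pairing_integrand f (scaled_deriv 3 g) (s + a * w) (t + b * w) l" for w l
  note f' = tame_scaled_deriv[OF f] and g' = tame_scaled_deriv[OF g]
  define K where "K = norm w + 1"
  define R where "R = max (norm s + norm a * K) (norm t + norm b * K)"
  obtain C where C: "C \<ge> 0" "\<And>s t l. Re s \<le> R \<Longrightarrow> Re t \<le> R \<Longrightarrow> l > 0 \<Longrightarrow>
     norm (pairing_integrand (scaled_deriv 2 f) g s t l) \<le> C * (1 + norm s + norm t) ^ 4 * majorant l"
    using pairing_integrand_bound[OF f' g, of R] by blast
  obtain D where D: "D \<ge> 0" "\<And>s t l. Re s \<le> R \<Longrightarrow> Re t \<le> R \<Longrightarrow> l > 0 \<Longrightarrow>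
     norm (pairing_integrand f (scaled_deriv 3 g) s t l) \<le> D * (1 + norm s + norm t) ^ 4 * majorant l"
    using pairing_integrand_bound[OF f g', of R] by blast
  define B where "B l = (norm a * C + norm b * D) * (1 + R + R) ^ 4 * majorant l" for l
  have "((\<lambda>w. LBINT l:{0<..}. F w l) has_field_derivative (LBINT l:{0<..}. F' w l)) (at w)"
  proof (rule has_field_derivative_set_integral)
    show "set_integrable lborel {0<..} (F w)" for w
      unfolding F_def by (rule set_integrable_pairing_integrand[OF f g])
    show "((\<lambda>w. F w l) has_field_derivative F' w l) (at w)" for w l
      unfolding F_def F'_def pairing_integrand_def scaled_deriv_def
      by (auto intro!: derivative_eq_intros DERIV_chain2[OF tame_deriv[OF f]] DERIV_chain2[OF tame_deriv[OF g]]
            simp: algebra_simps)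
    show "set_borel_measurable lborel {0<..} (F' w)"
    proof -
      have "set_integrable lborel {0<..} (F' w)"
        unfolding F'_def
        by (intro set_integral_add(1) set_integrable_mult_right set_integrable_pairing_integrand f g f' g')
      then show ?thesis
        unfolding set_borel_measurable_def set_integrable_def by (rule borel_measurable_integrable)
    qed
    show "set_integrable lborel {0<..} B"
      unfolding B_def using set_integrable_majorant by simp
    fix w' l assume w': "w' \<in> ball w 1" and l: "l \<in> {0::real<..}"
    have "norm w' \<le> K" using w' norm_triangle_ineq2[of w' w] by (simp add: K_def dist_norm norm_minus_commute)
    then have "norm (s + a * w') \<le> norm s + norm a * K" "norm (t + b * w') \<le> norm t + norm b * K"
      by (auto intro!: norm_triangle_le add_mono mult_left_mono simp: norm_mult)
    then have n: "norm (s + a * w') \<le> R" "norm (t + b * w') \<le> R" by (auto simp: R_def)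
    then have r: "Re (s + a * w') \<le> R" "Re (t + b * w') \<le> R"
      using complex_Re_le_cmod order_trans by blast+
    define N where "N = (1 + norm (s + a * w') + norm (t + b * w')) ^ 4"
    have N: "N \<le> (1 + R + R) ^ 4" unfolding N_def using n by (intro power_mono) auto
    have m: "majorant l \<ge> 0" by (simp add: majorant_def)
    have "norm (F' w' l) \<le> norm a * (C * N * majorant l) + norm b * (D * N * majorant l)"
      unfolding F'_def N_def using C(2)[OF r] D(2)[OF r] l
      by (auto intro!: norm_triangle_le add_mono mult_left_mono simp: norm_mult)
    also have "\<dots> = (norm a * C + norm b * D) * N * majorant l" by (simp add: algebra_simps)
    also have "\<dots> \<le> B l"
      unfolding B_def using N m C(1) D(1) by (intro mult_right_mono mult_left_mono) auto
    finally show "norm (F' w' l) \<le> B l" .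
  qed auto
  also have "(LBINT l:{0<..}. F' w l) = a * pairing (scaled_deriv 2 f) g (s + a * w) (t + b * w)
      + b * pairing f (scaled_deriv 3 g) (s + a * w) (t + b * w)"
    unfolding F'_def pairing_def using f g f' g'
    by (subst set_integral_add(2)) (auto intro!: set_integrable_pairing_integrand)
  finally show ?thesis by (simp add: F_def pairing_def)
qed

text \<open>
  The function \<open>exp (2 * u)\<close> at \<open>u = (s + ln l) / 2\<close> is \<open>exp s * l\<close>: multiplication of an argument by
  an exponential becomes multiplication of the integrand by \<open>l\<close>.
\<close>

lemma pairing_integrand_exp_times_left:
  assumes "l > 0"
  shows "pairing_integrand (exp_times 2 f) g s t l = exp s * (of_real l * pairing_integrand f g s t l)"
proof -
  have "exp (of_real 2 * (s / 2 + of_real (ln l) / 2)) = exp s * of_real l"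
    using assms by (simp add: algebra_simps exp_add exp_of_real)
  then show ?thesis by (simp add: pairing_integrand_def exp_times_def)
qed

lemma pairing_integrand_exp_times_right:
  assumes "l > 0"
  shows "pairing_integrand f (exp_times 3 g) s t l = exp t * (of_real l * pairing_integrand f g s t l)"
proof -
  have "exp (of_real 3 * (t / 3 + of_real (ln l) / 3)) = exp t * of_real l"
    using assms by (simp add: algebra_simps exp_add exp_of_real)
  then show ?thesis by (simp add: pairing_integrand_def exp_times_def)
qed

text \<open>
  The operator \<open>l d/dl\<close> acts on \<open>f ((s + ln l) / 2) * g ((t + ln l) / 3)\<close> as \<open>X + Y\<close>. Integrating the
  derivative of \<open>l * f * g * exp (- l)\<close> over \<open>{0<..}\<close> gives zero because that function tends to
  zero at both ends.
\<close>

lemma pairing_by_parts: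
  assumes f: "tame 2 f" and g: "tame 3 g"
  shows "(LBINT l:{0<..}. of_real l * pairing_integrand f g s t l)
      = pairing f g s t + pairing (scaled_deriv 2 f) g s t + pairing f (scaled_deriv 3 g) s t"
proof -
  note f' = tame_scaled_deriv[OF f] and g' = tame_scaled_deriv[OF g]
  define G where "G l = pairing_integrand f g s t l + pairing_integrand (scaled_deriv 2 f) g s t l + pairing_integrand f (scaled_deriv 3 g) s t l" for l
  \<comment> \<open>The factor \<open>l\<close> is harmless because it can be moved into the first argument.\<close>
  have int_l: "set_integrable lborel {0<..} (\<lambda>l. of_real l * pairing_integrand f g s t l)"
    using set_integrable_mult_right[OF set_integrable_pairing_integrand[OF tame_exp_times[OF f] g], of "exp (- s)"]
      pairing_integrand_exp_times_left[of _ f g s t]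
    by (subst set_integrable_cong[OF refl refl, of _ _ "\<lambda>l. exp (- s) * pairing_integrand (exp_times 2 f) g s t l"])
       (auto simp: exp_minus)
  have intG: "set_integrable lborel {0<..} G"
    unfolding G_def by (intro set_integral_add(1) set_integrable_pairing_integrand f g f' g')
  obtain C where C: "C \<ge> 0" "\<And>s' t' l. Re s' \<le> max (Re s) (Re t) \<Longrightarrow> Re t' \<le> max (Re s) (Re t) \<Longrightarrow> l > 0 \<Longrightarrow>
     norm (pairing_integrand f g s' t' l) \<le> C * (1 + norm s' + norm t') ^ 4 * majorant l"
    using pairing_integrand_bound[OF f g, of "max (Re s) (Re t)"] by blast
  define K where "K = C * (1 + norm s + norm t) ^ 4"
  have K: "norm (of_real l * pairing_integrand f g s t l) \<le> K * (l * majorant l)" if "l > 0" for l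
    using mult_left_mono[OF C(2)[of s t l], of l] that by (simp add: norm_mult K_def mult_ac)
  define H where "H l = of_real l * pairing_integrand f g s t l" for l
  have lim0: "(H \<longlongrightarrow> 0) (at_right 0)"
  proof (rule Lim_null_comparison)
    show "\<forall>\<^sub>F l in at_right 0. norm (H l) \<le> K * (l * majorant l)"
      using K by (auto simp: eventually_at_right_field H_def intro: exI[of _ 1])
    have "((\<lambda>l. l * majorant l) \<longlongrightarrow> 0) (at_right 0)" unfolding majorant_def by real_asymp
    then show "((\<lambda>l. K * (l * majorant l)) \<longlongrightarrow> 0) (at_right 0)" using tendsto_mult_right_zero by blast
  qed
  have liminf: "(H \<longlongrightarrow> 0) at_top"
  proof (rule Lim_null_comparison)
    show "\<forall>\<^sub>F l in at_top. norm (H l) \<le> K * (l * majorant l)"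
      using K by (auto simp: H_def intro: eventually_mono[OF eventually_gt_at_top[of 0]])
    have "((\<lambda>l. l * majorant l) \<longlongrightarrow> 0) at_top" unfolding majorant_def by real_asymp
    then show "((\<lambda>l. K * (l * majorant l)) \<longlongrightarrow> 0) at_top" using tendsto_mult_right_zero by blast
  qed
  have "(LBINT l=0..\<infinity>. G l - of_real l * pairing_integrand f g s t l) = 0 - 0"
  proof (rule interval_integral_FTC_integrable[where F = H])
    show "(0::ereal) < \<infinity>" by simp
    fix l :: real assume "0 < ereal l"
    then have l: "l > 0" by simp
    have [derivative_intros]: "((\<lambda>l. complex_of_real (ln l)) has_vector_derivative of_real (1 / l)) (at l)"
      using has_vector_derivative_of_real[OF DERIV_ln_divide[OF l]] .
    have fl: "((\<lambda>l. f (s / 2 + of_real (ln l) / 2)) has_vector_derivative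
        of_real (1 / l) / 2 * deriv f (s / 2 + of_real (ln l) / 2)) (at l)"
    proof -
      have "((\<lambda>l. s / 2 + of_real (ln l) / 2) has_vector_derivative of_real (1 / l) / 2) (at l)"
        by (auto intro!: derivative_eq_intros)
      from field_vector_diff_chain_at[OF this tame_deriv[OF f]] show ?thesis by (simp add: o_def)
    qed
    have gl: "((\<lambda>l. g (t / 3 + of_real (ln l) / 3)) has_vector_derivative
        of_real (1 / l) / 3 * deriv g (t / 3 + of_real (ln l) / 3)) (at l)"
    proof -
      have "((\<lambda>l. t / 3 + of_real (ln l) / 3) has_vector_derivative of_real (1 / l) / 3) (at l)"
        by (auto intro!: derivative_eq_intros)
      from field_vector_diff_chain_at[OF this tame_deriv[OF g]] show ?thesis by (simp add: o_def)
    qed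
    have el: "((\<lambda>l. complex_of_real (exp (- l))) has_vector_derivative of_real (- exp (- l))) (at l)"
      by (intro has_vector_derivative_of_real) (auto intro!: derivative_eq_intros)
    have idl: "((\<lambda>l. complex_of_real l) has_vector_derivative of_real 1) (at l)"
      by (intro has_vector_derivative_of_real) (auto intro!: derivative_eq_intros)
    show "(H has_vector_derivative G l - of_real l * pairing_integrand f g s t l) (at l)"
      unfolding H_def pairing_integrand_def G_def scaled_deriv_def using l
      by (rule_tac has_vector_derivative_eq_rhs[OF has_vector_derivative_mult[OF idl
            has_vector_derivative_mult[OF has_vector_derivative_mult[OF fl gl] el]]])
         (simp add: field_simps)
    have "isCont (pairing_integrand f' g' s t) l" if "continuous_on UNIV f'" "continuous_on UNIV g'" for f' g'
      using continuous_on_pairing_integrand[OF that] l by (simp add: continuous_on_eq_continuous_at)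
    then show "isCont (\<lambda>l. G l - of_real l * pairing_integrand f g s t l) l"
      unfolding G_def using f g f' g' by (intro continuous_intros) (auto simp: tame_continuous)
  next
    show "set_integrable lborel (einterval 0 \<infinity>) (\<lambda>l. G l - of_real l * pairing_integrand f g s t l)"
      using set_integral_diff(1)[OF intG int_l] by (simp add: einterval_eq_Ici zero_ereal_def)
    show "((H \<circ> real_of_ereal) \<longlongrightarrow> 0) (at_right 0)"
      using lim0 by (simp add: zero_ereal_def ereal_tendsto_simps)
    show "((H \<circ> real_of_ereal) \<longlongrightarrow> 0) (at_left \<infinity>)"
      using liminf by (simp add: ereal_tendsto_simps)
  qed
  then have "(LBINT l:{0<..}. G l - of_real l * pairing_integrand f g s t l) = 0"
    by (simp add: interval_lebesgue_integral_def einterval_eq_Ici zero_ereal_def)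
  then have "(LBINT l:{0<..}. of_real l * pairing_integrand f g s t l) = (LBINT l:{0<..}. G l)"
    using set_integral_diff(2)[OF intG int_l] by simp
  also have "\<dots> = pairing f g s t + pairing (scaled_deriv 2 f) g s t + pairing f (scaled_deriv 3 g) s t"
    unfolding G_def pairing_def using f g f' g'
    by (subst set_integral_add(2), auto intro!: set_integrable_pairing_integrand set_integral_add(1))+
  finally show "(LBINT l:{0<..}. of_real l * pairing_integrand f g s t l)
      = pairing f g s t + pairing (scaled_deriv 2 f) g s t + pairing f (scaled_deriv 3 g) s t" .
qed

text \<open>
  Together with the equations \<open>X\<^sup>2 f = exp (2 * u) * f\<close> and \<open>Y\<^sup>3 g = exp (3 * v) * g\<close> this and the next
  lemma reduce every moment to those with \<open>i < 2\<close> and \<open>j < 3\<close>.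
\<close>

lemma pairing_exp_times_left:
  assumes f: "tame 2 f" and g: "tame 3 g"
  shows "pairing (exp_times 2 f) g s t = exp s * (pairing f g s t + pairing (scaled_deriv 2 f) g s t + pairing f (scaled_deriv 3 g) s t)"
proof -
  have "pairing (exp_times 2 f) g s t = (LBINT l:{0<..}. exp s * (of_real l * pairing_integrand f g s t l))"
    unfolding pairing_def by (intro set_lebesgue_integral_cong) (auto simp: pairing_integrand_exp_times_left)
  then show ?thesis by (simp add: pairing_by_parts[OF f g])
qed

lemma pairing_exp_times_right:
  assumes f: "tame 2 f" and g: "tame 3 g"
  shows "pairing f (exp_times 3 g) s t = exp t * (pairing f g s t + pairing (scaled_deriv 2 f) g s t + pairing f (scaled_deriv 3 g) s t)"
proof -
  have "pairing f (exp_times 3 g) s t = (LBINT l:{0<..}. exp t * (of_real l * pairing_integrand f g s t l))"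
    unfolding pairing_def by (intro set_lebesgue_integral_cong) (auto simp: pairing_integrand_exp_times_right)
  then show ?thesis by (simp add: pairing_by_parts[OF f g])
qed

text \<open>
  The pairing grows at most like the fourth power of \<open>\<bar>x\<bar>\<close>. The slope \<open>\<beta>\<close> is needed for two directions:
  \<open>\<beta> = 1\<close>, along which the conserved quantity is constant, and \<open>\<beta> = 2\<close>, the line on which the operator
  is evaluated.
\<close>

lemma exp_mult_pairing_tendsto_0:
  assumes f: "tame 2 f" and g: "tame 3 g" and \<beta>: "1 \<le> \<beta>" "\<beta> \<le> 2" and \<kappa>: "1 \<le> \<kappa>"
  shows "((\<lambda>x. exp (a + of_real (\<kappa> * x)) * pairing f g (s + of_real x) (t + of_real (\<beta> * x))) \<longlongrightarrow> 0) at_bot"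
proof -
  define R where "R = max (Re s) (Re t)"
  obtain C where C: "\<And>s t. Re s \<le> R \<Longrightarrow> Re t \<le> R \<Longrightarrow> norm (pairing f g s t) \<le> C * (1 + norm s + norm t) ^ 4"
    and C0: "C \<ge> 0"
    using pairing_bound[OF f g, of R] by blast
  define K where "K = 1 + norm s + norm t"
  show ?thesis
  proof (rule Lim_null_comparison)
    \<comment> \<open>For \<open>x \<le> 0\<close> the slopes may be replaced by their worst cases, \<open>\<kappa> = 1\<close> and \<open>\<beta> = 2\<close>.\<close>
    show "\<forall>\<^sub>F x in at_bot. norm (exp (a + of_real (\<kappa> * x)) * pairing f g (s + of_real x) (t + of_real (\<beta> * x)))
        \<le> exp (Re a + x) * (C * (K - 3 * x) ^ 4)"
      using eventually_le_at_bot[of 0]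
    proof eventually_elim
      case (elim x)
      have \<beta>x: "\<beta> * x \<le> 0" "2 * x \<le> \<beta> * x" and \<kappa>x: "\<kappa> * x \<le> x"
        using elim \<beta> \<kappa> by (auto simp: mult_le_0_iff intro: mult_right_mono_neg mult_right_mono_neg[of 1 \<kappa> x, simplified])
      have "norm (pairing f g (s + of_real x) (t + of_real (\<beta> * x)))
          \<le> C * (1 + norm (s + of_real x) + norm (t + of_real (\<beta> * x))) ^ 4"
        using elim \<beta>x by (intro C) (auto simp: R_def)
      also have "\<dots> \<le> C * (K - 3 * x) ^ 4"
      proof (intro mult_left_mono power_mono)
        have "norm (s + of_real x) \<le> norm s - x" "norm (t + of_real (\<beta> * x)) \<le> norm t - \<beta> * x"
          using elim \<beta>x norm_triangle_ineq[of s "of_real x"] norm_triangle_ineq[of t "of_real (\<beta> * x)"]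
          by (auto simp: norm_mult simp flip: of_real_mult)
        then show "1 + norm (s + of_real x) + norm (t + of_real (\<beta> * x)) \<le> K - 3 * x"
          using \<beta>x by (simp add: K_def)
      qed (use C0 in auto)
      finally have 1: "norm (pairing f g (s + of_real x) (t + of_real (\<beta> * x))) \<le> C * (K - 3 * x) ^ 4" .
      have "norm (exp (a + of_real (\<kappa> * x))) \<le> exp (Re a + x)"
        using \<kappa>x by simp
      then show ?case unfolding norm_mult using 1 by (intro mult_mono) auto
    qed
    show "((\<lambda>x. exp (Re a + x) * (C * (K - 3 * x) ^ 4)) \<longlongrightarrow> 0) at_bot"
      by real_asymp
  qed
qed


section \<open>Leading parts and their pairing\<close>

text \<open>
  Here \<open>p\<close> is the part of an expansion in powers of \<open>exp (k * w)\<close> that carries no positive power; for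
  the solutions it is the polynomial in \<open>log z\<close> formed from the coefficients of index zero.
\<close>

definition leading :: "real \<Rightarrow> (complex \<Rightarrow> complex) \<Rightarrow> (complex \<Rightarrow> complex) \<Rightarrow> bool" where
  "leading k f p \<longleftrightarrow> tame k p \<and> (\<exists>r. tame k r \<and> f = (\<lambda>w. p w + exp_times k r w))"

lemma leading_tame: "leading k f p \<Longrightarrow> tame k f" "leading k f p \<Longrightarrow> tame k p"
  by (auto simp: leading_def intro: tame_add tame_exp_times)

lemma leading_scaled_deriv:
  assumes "leading k f p" "k \<noteq> 0"
  shows "leading k (scaled_deriv k f) (scaled_deriv k p)"
proof -
  obtain r where p: "tame k p" and r: "tame k r" and f: "f = (\<lambda>w. p w + exp_times k r w)"
    using assms by (auto simp: leading_def)
  have "deriv f w = deriv p w + (of_real k * exp (of_real k * w) * r w + exp (of_real k * w) * deriv r w)" for w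
    unfolding f exp_times_def
    by (rule DERIV_imp_deriv) (auto intro!: derivative_eq_intros tame_deriv p r)
  then have "scaled_deriv k f = (\<lambda>w. scaled_deriv k p w + exp_times k (\<lambda>w. r w + scaled_deriv k r w) w)"
    using assms(2) by (auto simp: scaled_deriv_def exp_times_def fun_eq_iff field_simps)
  then show ?thesis
    using p r unfolding leading_def by (intro conjI exI[of _ "\<lambda>w. r w + scaled_deriv k r w"] tame_add tame_scaled_deriv) auto
qed

lemma leading_scaled_deriv_funpow: "leading k f p \<Longrightarrow> k \<noteq> 0 \<Longrightarrow> leading k ((scaled_deriv k ^^ n) f) ((scaled_deriv k ^^ n) p)"
  by (induction n) (auto intro: leading_scaled_deriv)

text \<open>
  Each remainder contributes, after the reduction by parts, only terms with a factor \<open>exp s\<close> or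
  \<open>exp t\<close>.
\<close>

lemma pairing_leading:
  assumes f: "leading 2 f p" and g: "leading 3 g q" and \<beta>: "1 \<le> \<beta>" "\<beta> \<le> 2"
  shows "((\<lambda>x. pairing f g (s + of_real x) (t + of_real (\<beta> * x)) - pairing p q (s + of_real x) (t + of_real (\<beta> * x))) \<longlongrightarrow> 0) at_bot"
proof -
  obtain r where p: "tame 2 p" and r: "tame 2 r" and fr: "f = (\<lambda>w. p w + exp_times 2 r w)"
    using f by (auto simp: leading_def)
  obtain r' where q: "tame 3 q" and r': "tame 3 r'" and gr: "g = (\<lambda>w. q w + exp_times 3 r' w)"
    using g by (auto simp: leading_def)
  note t = p q r r' leading_tame[OF f] leading_tame[OF g] tame_scaled_deriv[OF r] tame_scaled_deriv[OF r']
     tame_scaled_deriv[OF leading_tame(1)[OF g]] tame_scaled_deriv[OF p] tame_exp_times[OF r] tame_exp_times[OF r']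
  have eq: "pairing f g s t - pairing p q s t
      = (exp s * pairing r g s t + exp s * pairing (scaled_deriv 2 r) g s t + exp s * pairing r (scaled_deriv 3 g) s t)
      + (exp t * pairing p r' s t + exp t * pairing (scaled_deriv 2 p) r' s t + exp t * pairing p (scaled_deriv 3 r') s t)" for s t
  proof -
    have "pairing f g s t = pairing p g s t + pairing (exp_times 2 r) g s t"
      unfolding fr by (rule pairing_add_left) (use t in auto)
    moreover have "pairing p g s t = pairing p q s t + pairing p (exp_times 3 r') s t"
      unfolding gr by (rule pairing_add_right) (use t in auto)
    ultimately show ?thesis
      using t by (simp add: pairing_exp_times_left pairing_exp_times_right algebra_simps)
  qed
  have s0: "((\<lambda>x. exp (s + of_real x) * pairing f g (s + of_real x) (t + of_real (\<beta> * x))) \<longlongrightarrow> 0) at_bot"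
    if "tame 2 f" "tame 3 g" for f g
    using exp_mult_pairing_tendsto_0[OF that \<beta>, of 1 s s t] by simp
  have t0: "((\<lambda>x. exp (t + of_real (\<beta> * x)) * pairing f g (s + of_real x) (t + of_real (\<beta> * x))) \<longlongrightarrow> 0) at_bot"
    if "tame 2 f" "tame 3 g" for f g
    using exp_mult_pairing_tendsto_0[OF that \<beta> \<beta>(1)] .
  have "((\<lambda>x. pairing f g (s + of_real x) (t + of_real (\<beta> * x)) - pairing p q (s + of_real x) (t + of_real (\<beta> * x))) \<longlongrightarrow> (0+0+0)+(0+0+0)) at_bot"
    unfolding eq by (intro tendsto_add s0 t0 t)
  then show ?thesis by simp
qed


section \<open>Power series with logarithms\<close>

definition fast_decay :: "(nat \<Rightarrow> complex) \<Rightarrow> bool" where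
  "fast_decay c \<longleftrightarrow> (\<exists>K q. K \<ge> 0 \<and> q \<ge> 0 \<and> (\<forall>m. norm (c m) \<le> K * q ^ m / (fact m)\<^sup>2))"

lemma fast_decayI:
  assumes "K \<ge> 0" "q \<ge> 0" "\<And>m. norm (c m) \<le> K * q ^ m / (fact m)\<^sup>2"
  shows "fast_decay c"
  using assms by (auto simp: fast_decay_def)

lemma fast_decay_add:
  assumes "fast_decay a" "fast_decay b"
  shows "fast_decay (\<lambda>m. a m + b m)"
proof -
  obtain K q where 1: "K \<ge> 0" "q \<ge> 0" "\<And>m. norm (a m) \<le> K * q ^ m / (fact m)\<^sup>2"
    using assms(1) by (auto simp: fast_decay_def)
  obtain L p where 2: "L \<ge> 0" "p \<ge> 0" "\<And>m. norm (b m) \<le> L * p ^ m / (fact m)\<^sup>2"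
    using assms(2) by (auto simp: fast_decay_def)
  show ?thesis
  proof (rule fast_decayI[of "K + L" "max q p"])
    fix m
    have "K * q ^ m \<le> K * max q p ^ m" "L * p ^ m \<le> L * max q p ^ m"
      using 1 2 by (auto intro!: mult_left_mono power_mono)
    then have "K * q ^ m / (fact m)\<^sup>2 + L * p ^ m / (fact m)\<^sup>2 \<le> (K + L) * max q p ^ m / (fact m)\<^sup>2"
      unfolding add_divide_distrib[symmetric] distrib_right by (intro divide_right_mono add_mono) auto
    then show "norm (a m + b m) \<le> (K + L) * max q p ^ m / (fact m)\<^sup>2"
      using norm_triangle_le[OF add_mono[OF 1(3)[of m] 2(3)[of m]]] by simp
  qed (use 1 2 in auto)
qed

lemma fast_decay_cmult:
  assumes "fast_decay a"
  shows "fast_decay (\<lambda>m. x * a m)"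
proof -
  obtain K q where 1: "K \<ge> 0" "q \<ge> 0" "\<And>m. norm (a m) \<le> K * q ^ m / (fact m)\<^sup>2"
    using assms(1) by (auto simp: fast_decay_def)
  show ?thesis
    by (rule fast_decayI[of "norm x * K" q])
       (use 1 mult_left_mono[OF 1(3), of "norm x"] in \<open>auto simp: norm_mult mult_ac\<close>)
qed

lemma fast_decay_of_nat_mult:
  assumes "fast_decay a"
  shows "fast_decay (\<lambda>m. of_nat m * a m)"
proof -
  obtain K q where 1: "K \<ge> 0" "q \<ge> 0" "\<And>m. norm (a m) \<le> K * q ^ m / (fact m)\<^sup>2"
    using assms(1) by (auto simp: fast_decay_def)
  show ?thesis
  proof (rule fast_decayI[of K "2 * q"])
    fix m
    have "real m \<le> 2 ^ m" using less_imp_le[OF of_nat_less_two_power] by blast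
    then have "real m * norm (a m) \<le> 2 ^ m * (K * q ^ m / (fact m)\<^sup>2)"
      using 1 by (intro mult_mono) auto
    then show "norm (of_nat m * a m) \<le> K * (2 * q) ^ m / (fact m)\<^sup>2"
      by (simp add: norm_mult power_mult_distrib mult_ac)
  qed (use 1 in auto)
qed

lemma fast_decay_Suc:
  assumes "fast_decay a"
  shows "fast_decay (\<lambda>m. a (Suc m))"
proof -
  obtain K q where 1: "K \<ge> 0" "q \<ge> 0" "\<And>m. norm (a m) \<le> K * q ^ m / (fact m)\<^sup>2"
    using assms(1) by (auto simp: fast_decay_def)
  show ?thesis
  proof (rule fast_decayI[of "K * q" q])
    fix m
    have "norm (a (Suc m)) \<le> K * q ^ Suc m / (fact (Suc m))\<^sup>2" by (rule 1)
    also have "\<dots> \<le> K * q ^ Suc m / (fact m)\<^sup>2"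
      using 1 fact_mono[of m "Suc m", where ?'a = real] by (intro divide_left_mono power_mono) auto
    finally show "norm (a (Suc m)) \<le> K * q * q ^ m / (fact m)\<^sup>2" by (simp add: mult_ac)
  qed (use 1 in auto)
qed

lemma fast_decay_zero: "fast_decay (\<lambda>_. 0)"
  by (rule fast_decayI[of 0 0]) auto

lemma norm_harm_le: "norm (harm m :: complex) \<le> m"
proof (induction m)
  case (Suc m)
  have "norm (harm (Suc m) :: complex) \<le> norm (harm m :: complex) + norm (inverse (of_nat (Suc m)) :: complex)"
    unfolding harm_Suc by (rule norm_triangle_ineq)
  also have "norm (inverse (of_nat (Suc m)) :: complex) \<le> 1"
    by (simp add: norm_inverse field_simps norm_divide del: of_nat_Suc)
  finally show ?case using Suc by simp
qed (simp add: harm_def)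

text \<open>
  Quadratic growth of the numerators covers all coefficients below: harmonic numbers are at most
  linear, and the coefficients for \<open>P^2\<close> are summed up once more.
\<close>

lemma fast_decay_poly:
  assumes "\<And>m. norm (p m) \<le> K * (1 + real m) ^ 2"
  shows "fast_decay (\<lambda>m. p m / (fact m)\<^sup>2)" "fast_decay (\<lambda>m. p m / (fact m) ^ 3)"
proof -
  have "0 \<le> norm (p 0)" by simp
  also have "\<dots> \<le> K" using assms[of 0] by simp
  finally have K: "K \<ge> 0" .
  have p: "norm (p m) \<le> K * 4 ^ m" for m
  proof -
    have "Suc m \<le> 2 ^ m" by (rule Suc_leI) simp
    then have "(1 + real m) \<le> 2 ^ m" by (metis of_nat_Suc of_nat_le_iff of_nat_numeral of_nat_power add.commute)
    then have "(1 + real m) ^ 2 \<le> (2 ^ m) ^ 2" by (intro power_mono) auto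
    also have "((2::real) ^ m) ^ 2 = 4 ^ m" by (simp add: power2_eq_square flip: power_mult_distrib)
    finally have "K * (1 + real m) ^ 2 \<le> K * 4 ^ m"
      using K by (rule mult_left_mono)
    then show ?thesis using assms[of m] by simp
  qed
  show "fast_decay (\<lambda>m. p m / (fact m)\<^sup>2)"
    by (rule fast_decayI[of K 4]) (use K p in \<open>auto simp: norm_divide norm_power divide_right_mono\<close>)
  show "fast_decay (\<lambda>m. p m / (fact m) ^ 3)"
  proof (rule fast_decayI[of K 4])
    fix m
    have "(fact m :: real) ^ 2 \<le> fact m ^ 3" by (intro power_increasing) (auto simp: fact_ge_1)
    then have "norm (p m) / fact m ^ 3 \<le> K * 4 ^ m / (fact m)\<^sup>2"
      using p[of m] K by (intro frac_le) auto
    then show "norm (p m / fact m ^ 3) \<le> K * 4 ^ m / (fact m)\<^sup>2"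
      by (simp add: norm_divide norm_power)
  qed (use K in auto)
qed

lemmas fast_decay_intros = fast_decay_add fast_decay_cmult fast_decay_of_nat_mult fast_decay_zero

text \<open>
  One of the two factorials turns \<open>q ^ m\<close> into \<open>e ^ m\<close> at the price of the constant
  \<open>exp (q / e)\<close>, the other one remains to form an exponential series.
\<close>

lemma fast_decay_bound:
  assumes "fast_decay c" "e > 0"
  shows "\<exists>C\<ge>0. \<forall>m (x::complex). norm (c m * x ^ m) \<le> C * ((e * norm x) ^ m / fact m)"
proof -
  obtain K q where 1: "K \<ge> 0" "q \<ge> 0" "\<And>m. norm (c m) \<le> K * q ^ m / (fact m)\<^sup>2"
    using assms(1) by (auto simp: fast_decay_def)
  show ?thesis
  proof (intro exI[of _ "K * exp (q / e)"] conjI allI)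
    fix m and x :: complex
    have ex: "(\<lambda>i. (q / e) ^ i / fact i) sums exp (q / e)"
      using exp_converges[of "q / e"] by (simp add: divide_inverse_commute)
    have "(\<Sum>i\<in>{m}. (q / e) ^ i / fact i) \<le> (\<Sum>i. (q / e) ^ i / fact i)"
      using 1 assms(2) by (intro sum_le_suminf sums_summable[OF ex]) auto
    also have "\<dots> = exp (q / e)" using ex by (simp add: sums_iff)
    finally  have "(q / e) ^ m / fact m \<le> exp (q / e)" by simp
    then have *: "K * ((q / e) ^ m / fact m) * ((e * norm x) ^ m / fact m)
        \<le> K * exp (q / e) * ((e * norm x) ^ m / fact m)"
      using 1 assms(2) by (intro mult_right_mono mult_left_mono) auto
    have "norm (c m * x ^ m) \<le> K * q ^ m / (fact m)\<^sup>2 * norm x ^ m"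
      unfolding norm_mult norm_power by (intro mult_right_mono 1(3)) auto
    also have "\<dots> = K * ((q / e) ^ m / fact m) * ((e * norm x) ^ m / fact m)"
      using assms(2) by (simp add: power_divide power_mult_distrib power2_eq_square field_simps)
    finally show "norm (c m * x ^ m) \<le> K * exp (q / e) * ((e * norm x) ^ m / fact m)"
      using * by linarith
  qed (use 1 in auto)
qed

lemma summable_fast_decay:
  assumes "fast_decay c"
  shows "summable (\<lambda>m. c m * x ^ m)"
proof -
  obtain C where C: "C \<ge> 0" "\<And>m x. norm (c m * x ^ m) \<le> C * ((1 * norm x) ^ m / fact m)"
    using fast_decay_bound[OF assms zero_less_one] by blast
  show ?thesis
  proof (rule summable_comparison_test'[where N = 0])
    show "summable (\<lambda>m. C * ((1 * norm x) ^ m / fact m))"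
      using summable_exp[of "norm x"] by (intro summable_mult) (simp add: field_simps)
  qed (use C in auto)
qed

definition exp_series :: "nat \<Rightarrow> (nat \<Rightarrow> complex) \<Rightarrow> complex \<Rightarrow> complex" where
  "exp_series k c w = (\<Sum>m. c m * exp w ^ (k * m))"

lemma exp_series_sums:
  assumes "fast_decay c"
  shows "(\<lambda>m. c m * exp w ^ (k * m)) sums exp_series k c w"
  using summable_sums[OF summable_fast_decay[OF assms, of "exp w ^ k"]]
  by (simp add: exp_series_def power_mult)

lemma exp_series_bound:
  assumes "fast_decay c" "e > 0"
  shows "\<exists>C\<ge>0. \<forall>w. norm (exp_series k c w) \<le> C * exp (e * exp (real k * Re w))"
proof -
  obtain C where C: "C \<ge> 0" "\<And>m x. norm (c m * x ^ m) \<le> C * ((e * norm x) ^ m / fact m)"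
    using fast_decay_bound[OF assms] by blast
  have "norm (exp_series k c w) \<le> C * exp (e * exp (real k * Re w))" for w
  proof -
    have x: "norm (exp w ^ k) = exp (real k * Re w)"
      by (simp add: norm_power exp_of_nat_mult)
    have s: "(\<lambda>m. C * ((e * norm (exp w ^ k)) ^ m / fact m)) sums (C * exp (e * exp (real k * Re w)))"
      using sums_mult[OF exp_converges[of "e * norm (exp w ^ k)"], of C]
      unfolding x by (simp add: scaleR_conv_of_real field_simps)
    have "norm (\<Sum>m. c m * (exp w ^ k) ^ m) \<le> (\<Sum>m. C * ((e * norm (exp w ^ k)) ^ m / fact m))"
      using C(2) by (intro norm_suminf_le sums_summable[OF s]) auto
    then show ?thesis using s by (simp add: exp_series_def power_mult sums_iff)
  qed
  then show ?thesis using C(1) by blast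
qed

lemma has_field_derivative_exp_series:
  assumes c: "fast_decay c"
  shows "(exp_series k c has_field_derivative exp_series k (\<lambda>m. of_nat k * (of_nat m * c m)) w) (at w)"
proof -
  define F where "F x = (\<Sum>m. c m * x ^ m)" for x :: complex
  define x where "x = exp w ^ k"
  have F: "(F has_field_derivative (\<Sum>n. diffs c n * x ^ n)) (at x)"
    unfolding F_def by (rule termdiffs_strong_converges_everywhere) (rule summable_fast_decay[OF c])
  have "((\<lambda>w. F (exp w ^ k)) has_field_derivative (\<Sum>n. diffs c n * x ^ n) * (of_nat k * x)) (at w)"
  proof (rule DERIV_chain2[of F _ "\<lambda>w. exp w ^ k" w])
    show "(F has_field_derivative (\<Sum>n. diffs c n * x ^ n)) (at (exp w ^ k))"
      using F by (simp add: x_def)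
    show "((\<lambda>w. exp w ^ k) has_field_derivative of_nat k * x) (at w)"
      using DERIV_power[OF DERIV_exp[of w], of k] unfolding x_def by (cases k) simp_all
  qed
  also have "(\<Sum>n. diffs c n * x ^ n) * (of_nat k * x) = (\<Sum>m. of_nat k * (of_nat m * c m) * x ^ m)"
  proof -
    have "summable (\<lambda>n. diffs c n * x ^ n)"
      using summable_fast_decay[OF fast_decay_Suc[OF fast_decay_of_nat_mult[OF c]], of x] by (simp add: diffs_def)
    from sums_mult2[OF diffs_equiv[OF this], of "of_nat k * x"]
    have "(\<lambda>n. of_nat n * c n * x ^ (n - Suc 0) * (of_nat k * x)) sums ((\<Sum>n. diffs c n * x ^ n) * (of_nat k * x))" .
    also have "(\<lambda>n. of_nat n * c n * x ^ (n - Suc 0) * (of_nat k * x)) = (\<lambda>n. of_nat k * (of_nat n * c n) * x ^ n)"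
      by (rule ext, rename_tac n, case_tac n) auto
    finally show ?thesis by (simp add: sums_iff)
  qed
  finally show ?thesis by (simp add: exp_series_def[abs_def] F_def x_def power_mult)
qed

text \<open>
  Splitting off the term of index zero; this yields both the leading part of a solution and, when that
  term vanishes, the factor \<open>exp (k * w)\<close> in the differential equation.
\<close>

lemma exp_series_split:
  assumes "fast_decay c"
  shows "exp_series k c w = c 0 + exp (of_nat k * w) * exp_series k (\<lambda>m. c (Suc m)) w"
proof -
  have "(\<lambda>m. c (Suc m) * exp w ^ (k * m) * exp (of_nat k * w)) sums (exp_series k (\<lambda>m. c (Suc m)) w * exp (of_nat k * w))"
    by (intro sums_mult2 exp_series_sums fast_decay_Suc assms)
  then have "(\<lambda>m. c (Suc m) * exp w ^ (k * Suc m)) sums (exp_series k (\<lambda>m. c (Suc m)) w * exp (of_nat k * w))"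
    unfolding exp_of_nat_mult by (simp add: power_add mult_ac)
  then have "(\<lambda>m. c m * exp w ^ (k * m)) sums (exp_series k (\<lambda>m. c (Suc m)) w * exp (of_nat k * w) + c 0 * exp w ^ (k * 0))"
    by (subst (asm) sums_Suc_iff) simp
  then show ?thesis by (simp add: exp_series_def sums_iff add.commute mult.commute)
qed

definition log_series :: "nat \<Rightarrow> (nat \<Rightarrow> complex) \<Rightarrow> (nat \<Rightarrow> complex) \<Rightarrow> (nat \<Rightarrow> complex) \<Rightarrow> complex \<Rightarrow> complex" where
  "log_series k a b c w = exp_series k a w + w * exp_series k b w + w ^ 2 * exp_series k c w"

lemma log_series_sums:
  assumes "fast_decay a" "fast_decay b" "fast_decay c"
  shows "(\<lambda>m. (a m + b m * w + c m * w ^ 2) * exp w ^ (k * m)) sums log_series k a b c w"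
proof -
  have "(\<lambda>m. a m * exp w ^ (k * m) + w * (b m * exp w ^ (k * m)) + w ^ 2 * (c m * exp w ^ (k * m))) sums log_series k a b c w"
    unfolding log_series_def by (intro sums_add sums_mult exp_series_sums assms)
  then show ?thesis by (simp add: algebra_simps)
qed

text \<open>
  On the coefficient polynomial of \<open>exp (k * m * w)\<close>, differentiation acts as \<open>k * m + d/dw\<close>.
\<close>

lemma has_field_derivative_log_series:
  assumes "fast_decay a" "fast_decay b" "fast_decay c"
  shows "(log_series k a b c has_field_derivative
     log_series k (\<lambda>m. of_nat k * (of_nat m * a m) + b m) (\<lambda>m. of_nat k * (of_nat m * b m) + 2 * c m)
       (\<lambda>m. of_nat k * (of_nat m * c m)) w) (at w)"
proof -
  define D where "D c m = of_nat k * (of_nat m * c m)" for c :: "nat \<Rightarrow> complex" and m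
  have D: "fast_decay (D c)" if "fast_decay c" for c
    unfolding D_def by (intro fast_decay_cmult fast_decay_of_nat_mult that)
  have "exp_series k (\<lambda>m. D a m + b m) w = exp_series k (D a) w + exp_series k b w"
    using sums_add[OF exp_series_sums[OF D[OF assms(1)], of w k] exp_series_sums[OF assms(2), of w k]]
    by (simp add: exp_series_def sums_iff algebra_simps)
  moreover have "exp_series k (\<lambda>m. D b m + 2 * c m) w = exp_series k (D b) w + 2 * exp_series k c w"
    using sums_add[OF exp_series_sums[OF D[OF assms(2)], of w k] sums_mult[OF exp_series_sums[OF assms(3), of w k], of 2]]
    by (simp add: exp_series_def sums_iff algebra_simps)
  moreover have "(log_series k a b c has_field_derivative
      exp_series k (D a) w + (exp_series k b w + w * exp_series k (D b) w) + (2 * w * exp_series k c w + w ^ 2 * exp_series k (D c) w)) (at w)"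
    unfolding log_series_def[abs_def] D_def
    by (auto intro!: derivative_eq_intros has_field_derivative_exp_series assms)
  ultimately show ?thesis
    unfolding D_def[symmetric] by (simp add: log_series_def algebra_simps power2_eq_square)
qed

lemma deriv_log_series:
  assumes "fast_decay a" "fast_decay b" "fast_decay c"
  shows "deriv (log_series k a b c) = log_series k (\<lambda>m. of_nat k * (of_nat m * a m) + b m)
       (\<lambda>m. of_nat k * (of_nat m * b m) + 2 * c m) (\<lambda>m. of_nat k * (of_nat m * c m))"
  by (rule ext, rule DERIV_imp_deriv, rule has_field_derivative_log_series[OF assms])

lemma tame_log_series:
  assumes "fast_decay a" "fast_decay b" "fast_decay c"
  shows "tame (real k) (log_series k a b c)"
proof (rule tameI)
  show "log_series k a b c holomorphic_on UNIV"
    using has_field_derivative_log_series[OF assms, of k]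
    by (auto simp: holomorphic_on_def field_differentiable_def)
  fix e :: real assume e: "e > 0"
  obtain A where A: "A \<ge> 0" "\<And>w. norm (exp_series k a w) \<le> A * exp (e * exp (real k * Re w))"
    using exp_series_bound[OF assms(1) e] by blast
  obtain B where B: "B \<ge> 0" "\<And>w. norm (exp_series k b w) \<le> B * exp (e * exp (real k * Re w))"
    using exp_series_bound[OF assms(2) e] by blast
  obtain C where C: "C \<ge> 0" "\<And>w. norm (exp_series k c w) \<le> C * exp (e * exp (real k * Re w))"
    using exp_series_bound[OF assms(3) e] by blast
  have "norm (log_series k a b c w) \<le> (A + B + C) * (1 + norm w)^2 * exp (e * exp (real k * Re w))" for w
  proof -
    define E where "E = exp (e * exp (real k * Re w))"
    have n: "1 \<le> (1 + norm w)^2" "norm w \<le> (1 + norm w)^2" "norm w ^ 2 \<le> (1 + norm w)^2"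
      by (auto simp: power2_eq_square algebra_simps)
    have "norm (log_series k a b c w) \<le> norm (exp_series k a w) + norm w * norm (exp_series k b w) + norm w ^ 2 * norm (exp_series k c w)"
      unfolding log_series_def by (metis (no_types) norm_mult norm_power norm_triangle_ineq norm_triangle_le add_mono_thms_linordered_semiring(3))
    also have "\<dots> \<le> (1 + norm w)^2 * (A * E) + (1 + norm w)^2 * (B * E) + (1 + norm w)^2 * (C * E)"
      using A B C n mult_mono[OF n(1) A(2)[of w]]
      by (intro add_mono mult_mono) (auto simp: E_def)
    finally show ?thesis by (simp add: E_def algebra_simps)
  qed
  then show "\<exists>C. \<forall>w. norm (log_series k a b c w) \<le> C * (1 + norm w)^2 * exp (e * exp (real k * Re w))" by blast
qed

lemma log_series_split:
  assumes "fast_decay a" "fast_decay b" "fast_decay c"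
  shows "log_series k a b c w = (a 0 + b 0 * w + c 0 * w ^ 2)
    + exp_times (real k) (log_series k (\<lambda>m. a (Suc m)) (\<lambda>m. b (Suc m)) (\<lambda>m. c (Suc m))) w"
  using exp_series_split[OF assms(1), of k w] exp_series_split[OF assms(2), of k w] exp_series_split[OF assms(3), of k w]
  by (simp add: log_series_def exp_times_def algebra_simps)

lemma leading_log_series:
  assumes "fast_decay a" "fast_decay b" "fast_decay c"
  shows "leading (real k) (log_series k a b c) (\<lambda>w. a 0 + b 0 * w + c 0 * w ^ 2)"
  unfolding leading_def
proof (intro conjI exI)
  show "tame (real k) (\<lambda>w. a 0 + b 0 * w + c 0 * w ^ 2)"
    using tame_cmult[OF tame_power[of 0 "real k"], of "a 0"] tame_cmult[OF tame_power[of 1 "real k"], of "b 0"]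
      tame_cmult[OF tame_power[of 2 "real k"], of "c 0"]
    by (intro tame_add) simp_all
  show "tame (real k) (log_series k (\<lambda>m. a (Suc m)) (\<lambda>m. b (Suc m)) (\<lambda>m. c (Suc m)))"
    by (intro tame_log_series fast_decay_Suc assms)
qed (rule ext, rule log_series_split[OF assms])

text \<open>
  The hypothesis excludes \<open>x = 0\<close>, since only the values \<open>x = exp (k * w)\<close> are available.
\<close>

lemma power_series_zero_coeff:
  fixes c :: "nat \<Rightarrow> complex"
  assumes "\<And>x. x \<noteq> 0 \<Longrightarrow> (\<lambda>m. c m * x ^ m) sums 0"
  shows "c m = 0"
  using assms
proof (induction m arbitrary: c)
  case 0
  have "((\<lambda>x::complex. 0::complex) \<longlongrightarrow> c 0) (at 0)"
    by (rule powser_limit_0_strong[of 1 c]) (use 0 in auto)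
  then show ?case using tendsto_unique[OF _ tendsto_const] by (metis trivial_limit_at)
next
  case (Suc m)
  have c0: "c 0 = 0"
  proof -
    have "((\<lambda>x::complex. 0::complex) \<longlongrightarrow> c 0) (at 0)"
      by (rule powser_limit_0_strong[of 1 c]) (use Suc.prems in auto)
    then show ?thesis using tendsto_unique[OF _ tendsto_const] by (metis trivial_limit_at)
  qed
  show ?case
  proof (rule Suc.IH)
    fix x :: complex assume x: "x \<noteq> 0"
    have "(\<lambda>m. c (Suc m) * x ^ Suc m) sums 0"
      using Suc.prems[OF x] c0 by (subst sums_Suc_iff) simp
    from sums_mult2[OF this, of "inverse x"] x show "(\<lambda>m. c (Suc m) * x ^ m) sums 0"
      by (simp add: field_simps)
  qed
qed

text \<open>
  The translation by \<open>T = 2 * pi * \<i> / k\<close> does not change \<open>exp (k * w)\<close>, so it only acts on the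
  polynomials in \<open>w\<close>. The second difference isolates \<open>c\<close>, then the first difference isolates
  \<open>b\<close>; what remains are ordinary power series.
\<close>

lemma log_series_zero_coeff:
  fixes a b c :: "nat \<Rightarrow> complex"
  assumes k: "k > 0" and s: "\<And>w. (\<lambda>m. (a m + b m * w + c m * w ^ 2) * exp w ^ (k * m)) sums 0"
  shows "a m = 0" "b m = 0" "c m = 0"
proof -
  define T where "T = 2 * of_real pi * \<i> / of_nat k"
  have T: "T \<noteq> 0" using k by (simp add: T_def)
  have ekT: "exp T ^ k = 1"
    using k exp_of_nat_mult[of k T] by (simp add: T_def)
  have e1: "exp (w + T) ^ (k * m) = exp w ^ (k * m)" for w m
    using ekT by (simp add: exp_add power_mult_distrib power_mult)
  have e2: "exp (w + 2 * T) ^ (k * m) = exp w ^ (k * m)" for w m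
    using e1[of "w + T" m] e1[of w m] by (simp add: algebra_simps)
  have root: "\<exists>w. exp w ^ k = x" if "x \<noteq> 0" for x :: complex
    using k that exp_of_nat_mult[of k "Ln x / of_nat k"] by (intro exI[of _ "Ln x / of_nat k"]) auto
  have pz: "d m = 0" if d: "\<And>w. (\<lambda>m. d m * exp w ^ (k * m)) sums 0" for d :: "nat \<Rightarrow> complex" and m
  proof (rule power_series_zero_coeff)
    fix x :: complex assume "x \<noteq> 0"
    then obtain w where "exp w ^ k = x" using root by blast
    then show "(\<lambda>m. d m * x ^ m) sums 0" using d[of w] by (simp add: power_mult)
  qed
  have c: "c m = 0" for m
  proof -
    have "(\<lambda>m. (2 * T\<^sup>2 * c m) * exp w ^ (k * m)) sums 0" for w
      using sums_add[OF sums_diff[OF s[of "w + 2 * T"] sums_mult[OF s[of "w + T"], of 2]] s[of w]]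
      unfolding e1 e2 by (simp add: algebra_simps power2_eq_square)
    from pz[OF this, of m] T show ?thesis by simp
  qed
  have b: "b m = 0" for m
  proof -
    have "(\<lambda>m. (T * b m) * exp w ^ (k * m)) sums 0" for w
      using sums_diff[OF s[of "w + T"] s[of w]]
      unfolding e1 by (simp add: algebra_simps c)
    from pz[OF this, of m] T show ?thesis by simp
  qed
  have a: "a m = 0" for m
    by (rule pz) (use s b c in simp)
  show "a m = 0" "b m = 0" "c m = 0" by (fact a b c)+
qed


section \<open>The equation of the projective line\<close>

text \<open>
  With the factor \<open>1 / (m!)\<^sup>2\<close> taken out, the coefficients \<open>p m\<close> are linear polynomials in \<open>w\<close>
  with \<open>(1 + (d/dw) / (2 * m))\<^sup>2 (p m) = p (m - 1)\<close>, that is, \<open>p m = q - q' / m\<close> with \<open>q = p (m - 1)\<close>.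
\<close>

definition P1_sol :: "complex \<Rightarrow> complex \<Rightarrow> complex \<Rightarrow> complex" where
  "P1_sol x y = log_series 2 (\<lambda>m. (x - y * harm m) / (fact m)\<^sup>2) (\<lambda>m. y / (fact m)\<^sup>2) (\<lambda>_. 0)"

lemma fast_decay_P1_sol:
  "fast_decay (\<lambda>m. (x - y * harm m) / (fact m)\<^sup>2)" "fast_decay (\<lambda>m. y / (fact m)\<^sup>2)"
proof -
  have m1: "1 \<le> (1 + real m)^2" "real m \<le> (1 + real m)^2" for m
    by (auto simp: power2_eq_square algebra_simps)
  show "fast_decay (\<lambda>m. (x - y * harm m) / (fact m)\<^sup>2)"
  proof (rule fast_decay_poly)
    fix m
    have "norm (x - y * harm m) \<le> norm x * 1 + norm y * real m"
      using norm_harm_le[of m] by (auto intro!: order_trans[OF norm_triangle_ineq4] mult_left_mono simp: norm_mult)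
    also have "\<dots> \<le> norm x * (1 + real m)^2 + norm y * (1 + real m)^2"
      using m1 by (intro add_mono mult_left_mono) auto
    finally show "norm (x - y * harm m) \<le> (norm x + norm y) * (1 + real m)^2" by (simp add: algebra_simps)
  qed
  show "fast_decay (\<lambda>m. y / (fact m)\<^sup>2)"
    by (rule fast_decay_poly[of _ "norm y"]) (use mult_left_mono[OF m1(1), of "norm y"] in auto)
qed

lemmas P1_sol_fast_decay = fast_decay_P1_sol fast_decay_zero

text \<open>
  Differentiating twice multiplies the coefficient of index \<open>m\<close> by zero for \<open>m = 0\<close> and shifts the
  series by one otherwise, so a factor \<open>exp (2 * w)\<close> splits off.
\<close>

lemma deriv2_P1_sol: "(deriv ^^ 2) (P1_sol x y) w = 4 * exp w ^ 2 * P1_sol x y w"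
proof -
  define a where "a m = (x - y * harm m) / (fact m)\<^sup>2" for m
  define b where "b m = y / (fact m)\<^sup>2" for m
  define a2 where "a2 m = 4 * of_nat m ^ 2 * a m + 4 * of_nat m * b m" for m
  define b2 where "b2 m = 4 * of_nat m ^ 2 * b m" for m
  have fa: "fast_decay a" "fast_decay b" by (simp_all add: a_def[abs_def] b_def[abs_def] fast_decay_P1_sol)
  have "(deriv ^^ 2) (log_series 2 a b (\<lambda>_. 0)) = deriv (deriv (log_series 2 a b (\<lambda>_. 0)))"
    by (simp add: numeral_2_eq_2)
  also have "\<dots> = log_series 2 a2 b2 (\<lambda>_. 0)"
  proof -
    note d1 = deriv_log_series[OF fa fast_decay_zero, of 2]
    have f1: "fast_decay (\<lambda>m. of_nat 2 * (of_nat m * a m) + b m)"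
      "fast_decay (\<lambda>m. of_nat 2 * (of_nat m * b m) + 2 * 0)"
      "fast_decay (\<lambda>m. of_nat 2 * (of_nat m * (0::complex)))"
      by (intro fast_decay_intros fa)+
    note d2 = deriv_log_series[OF f1, of 2]
    show ?thesis
      unfolding d1 d2 a2_def[abs_def] b2_def[abs_def] by (simp add: algebra_simps power2_eq_square)
  qed
  finally have "(deriv ^^ 2) (log_series 2 a b (\<lambda>_. 0)) w = log_series 2 a2 b2 (\<lambda>_. 0) w" by simp
  also have "\<dots> = (a2 0 + b2 0 * w + 0 * w ^ 2)
     + exp_times (real 2) (log_series 2 (\<lambda>m. a2 (Suc m)) (\<lambda>m. b2 (Suc m)) (\<lambda>_. 0)) w"
  proof (rule log_series_split)
    have "fast_decay (\<lambda>m. 4 * (of_nat m * (of_nat m * a m)) + 4 * (of_nat m * b m))"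
      "fast_decay (\<lambda>m. 4 * (of_nat m * (of_nat m * b m)))"
      by (intro fast_decay_intros fa)+
    then show "fast_decay a2" "fast_decay b2"
      by (simp_all add: a2_def[abs_def] b2_def[abs_def] power2_eq_square mult_ac)
  qed (rule fast_decay_zero)
  also have "(\<lambda>m. a2 (Suc m)) = (\<lambda>m. 4 * a m)"
    by (auto simp: a2_def a_def b_def harm_Suc fun_eq_iff field_simps power2_eq_square simp del: of_nat_Suc)
  also have "(\<lambda>m. b2 (Suc m)) = (\<lambda>m. 4 * b m)"
    by (auto simp: b2_def b_def fun_eq_iff field_simps power2_eq_square simp del: of_nat_Suc)
  also have "log_series 2 (\<lambda>m. 4 * a m) (\<lambda>m. 4 * b m) (\<lambda>_. 0) = (\<lambda>w. 4 * log_series 2 a b (\<lambda>_. 0) w)"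
  proof
    fix w
    have "(\<lambda>m. 4 * ((a m + b m * w + 0 * w ^ 2) * exp w ^ (2 * m))) sums (4 * log_series 2 a b (\<lambda>_. 0) w)"
      by (intro sums_mult log_series_sums fa fast_decay_zero)
    moreover have "(\<lambda>m. (4 * a m + 4 * b m * w + 0 * w ^ 2) * exp w ^ (2 * m))
        sums log_series 2 (\<lambda>m. 4 * a m) (\<lambda>m. 4 * b m) (\<lambda>_. 0) w"
      by (intro log_series_sums fa fast_decay_intros)
    ultimately show "log_series 2 (\<lambda>m. 4 * a m) (\<lambda>m. 4 * b m) (\<lambda>_. 0) w = 4 * log_series 2 a b (\<lambda>_. 0) w"
      by (simp add: sums_iff algebra_simps)
  qed
  finally show ?thesis
    by (simp add: P1_sol_def a_def[symmetric] b_def[symmetric] a2_def b2_def exp_times_def exp_double)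
qed

lemma tame_P1_sol: "tame 2 (P1_sol x y)"
  using tame_log_series[OF P1_sol_fast_decay, of 2] by (simp add: P1_sol_def)

lemma P1_sol_in: "P1_sol x y \<in> sol_P1"
  using tame_holomorphic[OF tame_P1_sol] deriv2_P1_sol
  by (simp add: sol_P1_def holo_cover_def theta_eq_deriv Let_def)

lemma leading_P1_sol: "leading 2 (P1_sol x y) (\<lambda>w. x + y * w)"
  using leading_log_series[OF fast_decay_P1_sol(1)[of x y] fast_decay_P1_sol(2)[of y] fast_decay_zero, of 2] by (simp add: P1_sol_def harm_def)

lemma expansion_P1_sol:
  "expansion_P1 (P1_sol x y) (\<lambda>m i. if i = 1 then x - y * harm m else y)"
  unfolding expansion_P1_def
proof
  fix w
  show "(\<lambda>m. ((if 1 = (1::nat) then x - y * harm m else y) + (if 0 = (1::nat) then x - y * harm m else y) * w)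
      * (exp w ^ (2 * m) / (fact m)\<^sup>2)) sums P1_sol x y w"
    using log_series_sums[OF fast_decay_P1_sol(1)[of x y] fast_decay_P1_sol(2)[of y] fast_decay_zero, of w 2] by (simp add: P1_sol_def field_simps)
qed

lemma expansion_P1_unique:
  assumes "expansion_P1 f A" "expansion_P1 f B" "i \<le> 1"
  shows "A m i = B m i"
proof -
  define a where "a m = (A m 1 - B m 1) / (fact m)\<^sup>2" for m
  define b where "b m = (A m 0 - B m 0) / (fact m)\<^sup>2" for m
  have s: "(\<lambda>m. (a m + b m * w + 0 * w ^ 2) * exp w ^ (2 * m)) sums 0" for w
    using sums_diff[OF assms(1)[unfolded expansion_P1_def, rule_format, of w]
       assms(2)[unfolded expansion_P1_def, rule_format, of w]]
    by (simp add: a_def b_def algebra_simps add_divide_distrib diff_divide_distrib)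
  have "a m = 0" "b m = 0"
    using log_series_zero_coeff[of 2 a b "\<lambda>_. 0" m] s by auto
  moreover have "i = 0 \<or> i = 1" using assms(3) by auto
  ultimately show ?thesis by (auto simp: a_def b_def)
qed

text \<open>
  By uniqueness of the expansion, any expansion computes the coordinates.
\<close>

lemma A0_eq:
  assumes "expansion_P1 f A" "i \<le> 1"
  shows "A0 i f = A 0 i"
  unfolding A0_def using assms expansion_P1_unique by (intro the_equality) blast+

lemma A0_P1_sol: "A0 0 (P1_sol x y) = y" "A0 1 (P1_sol x y) = x" "A0 (Suc 0) (P1_sol x y) = x"
  using A0_eq[OF expansion_P1_sol[of x y], of 0] A0_eq[OF expansion_P1_sol[of x y], of 1] by (auto simp: harm_def)

lemma P1_sol_linear: "P1_sol (c * x + d * x') (c * y + d * y') = (\<lambda>w. c * P1_sol x y w + d * P1_sol x' y' w)"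
proof
  fix w
  have "(\<lambda>m. c * (((x - y * harm m) / (fact m)\<^sup>2 + y / (fact m)\<^sup>2 * w + 0 * w ^ 2) * exp w ^ (2 * m))
      + d * (((x' - y' * harm m) / (fact m)\<^sup>2 + y' / (fact m)\<^sup>2 * w + 0 * w ^ 2) * exp w ^ (2 * m)))
      sums (c * P1_sol x y w + d * P1_sol x' y' w)"
    unfolding P1_sol_def by (intro sums_add sums_mult log_series_sums P1_sol_fast_decay)
  moreover have "(\<lambda>m. (((c * x + d * x') - (c * y + d * y') * harm m) / (fact m)\<^sup>2
      + (c * y + d * y') / (fact m)\<^sup>2 * w + 0 * w ^ 2) * exp w ^ (2 * m)) sums P1_sol (c * x + d * x') (c * y + d * y') w"
    unfolding P1_sol_def by (intro log_series_sums P1_sol_fast_decay)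
  ultimately show "P1_sol (c * x + d * x') (c * y + d * y') w = c * P1_sol x y w + d * P1_sol x' y' w"
    by (simp add: sums_iff field_simps)
qed

lemma sol_P1_ode: "sol_P1 = ode_space 2 (\<lambda>k w. [- 4 * exp w ^ 2, 0, 1] ! k)"
proof -
  have "{..2} = {0, 1, 2::nat}" by auto
  then show ?thesis
    by (auto simp: sol_P1_def ode_space_def holo_cover_def theta_eq_deriv Let_def algebra_simps
         eq_neg_iff_add_eq_0)
qed

text \<open>
  Two independent solutions of an equation of order two span its solutions.
\<close>

lemma sol_P1_obtain: "f \<in> sol_P1 \<Longrightarrow> \<exists>x y. f = P1_sol x y"
proof -
  assume f: "f \<in> sol_P1"
  define \<phi> :: "2 \<Rightarrow> complex \<Rightarrow> complex" where "\<phi> i = (if i = 1 then P1_sol 1 0 else P1_sol 0 1)" for i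
  \<comment> \<open>Since \<open>2 = 0\<close> in the index type, the two indices are \<open>1\<close> and \<open>2\<close>.\<close>
  have comb: "(\<Sum>i\<in>UNIV. c i * \<phi> i w) = P1_sol (c 1) (c 2) w" for c w
    using P1_sol_linear[of "c 1" 1 "c 2" 0 0 1] by (simp add: sum_2 \<phi>_def)
  have "\<exists>c. \<forall>w. f w = (\<Sum>i\<in>UNIV. c i * \<phi> i w)"
  proof (rule ode_solutions_span[where a = "\<lambda>k w. [- 4 * exp w ^ 2, 0, 1] ! k" and \<xi> = 0])
    fix k assume "k \<le> CARD(2)"
    then have "k \<in> {0, 1, 2}" by auto
    then show "(\<lambda>w. [- 4 * exp w ^ 2, 0, 1] ! k) holomorphic_on UNIV"
      by (auto intro!: holomorphic_intros)
  next
    show "\<phi> i \<in> ode_space CARD(2) (\<lambda>k w. [- 4 * exp w ^ 2, 0, 1] ! k)" for i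
      using P1_sol_in unfolding \<phi>_def sol_P1_ode by simp
    show "f \<in> ode_space CARD(2) (\<lambda>k w. [- 4 * exp w ^ 2, 0, 1] ! k)"
      using f unfolding sol_P1_ode by simp
    fix c i assume z: "\<And>w. (\<Sum>i\<in>UNIV. c i * \<phi> i w) = 0"
    have "P1_sol (c 1) (c 2) = P1_sol 0 0"
      using z P1_sol_linear[of 0 0 0 0 0 0] by (auto simp: comb fun_eq_iff)
    then have "c 1 = 0" "c 2 = 0"
      using A0_P1_sol[of "c 1" "c 2"] A0_P1_sol[of 0 0] by auto
    then show "c i = 0" using exhaust_2[of i] by auto
  qed auto
  then show ?thesis unfolding comb fun_eq_iff by blast
qed


section \<open>The equation of the projective plane\<close>

text \<open>
  With the factor \<open>1 / (n!)\<^sup>3\<close> taken out, the coefficients \<open>p n\<close> are quadratic polynomials in \<open>w\<close>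
  with \<open>(1 + (d/dw) / (3 * n))\<^sup>3 (p n) = p (n - 1)\<close>, that is,
  \<open>p n = q - q' / n + 2/3 * q'' / n\<^sup>2\<close> with \<open>q = p (n - 1)\<close>. The linear coefficients sum up to
  \<open>y - 2 * z * harm n\<close>, the constant ones to the expression below.
\<close>

definition P2_const_coeff :: "complex \<Rightarrow> complex \<Rightarrow> complex \<Rightarrow> nat \<Rightarrow> complex" where
  "P2_const_coeff x y z n = x + (\<Sum>i<n. 4 / 3 * z / of_nat (Suc i) ^ 2 - (y - 2 * z * harm i) / of_nat (Suc i))"

text \<open>
  The arguments are the coefficients of \<open>1\<close>, \<open>log z\<close> and \<open>log\<^sup>2 z\<close>, in this order.
\<close>

definition P2_sol :: "complex \<Rightarrow> complex \<Rightarrow> complex \<Rightarrow> complex \<Rightarrow> complex" where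
  "P2_sol x y z = log_series 3 (\<lambda>n. P2_const_coeff x y z n / fact n ^ 3) (\<lambda>n. (y - 2 * z * harm n) / fact n ^ 3)
     (\<lambda>n. z / fact n ^ 3)"

lemma fast_decay_P2_sol:
  "fast_decay (\<lambda>n. P2_const_coeff x y z n / fact n ^ 3)"
  "fast_decay (\<lambda>n. (y - 2 * z * harm n) / fact n ^ 3)"
  "fast_decay (\<lambda>n. z / fact n ^ 3)"
proof -
  define K where "K = norm x + norm y + 2 * norm z"
  have K: "K \<ge> 0" by (simp add: K_def)
  have b: "norm (y - 2 * z * harm n) \<le> K * (1 + real n)" for n
  proof -
    have "norm (y - 2 * z * harm n) \<le> norm y + 2 * norm z * real n"
      using norm_harm_le[of n] by (auto intro!: order_trans[OF norm_triangle_ineq4] mult_left_mono simp: norm_mult)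
    also have "\<dots> \<le> K * 1 + K * real n" unfolding K_def by (intro add_mono mult_right_mono) auto
    finally show ?thesis by (simp add: algebra_simps)
  qed
  have a: "norm (P2_const_coeff x y z n) \<le> K * (1 + real n) ^ 2" for n
  proof (induction n)
    case 0
    show ?case by (simp add: P2_const_coeff_def K_def)
  next
    case (Suc n)
    have i1: "norm (1 / of_nat (Suc n) :: complex) \<le> 1" by (simp add: norm_divide field_simps del: of_nat_Suc)
    have "norm (4 / 3 * z / of_nat (Suc n) ^ 2) = 4 / 3 * norm z * norm (1 / of_nat (Suc n) :: complex) ^ 2"
      by (simp add: norm_mult norm_divide norm_power power_divide del: of_nat_Suc)
    also have "\<dots> \<le> 4 / 3 * norm z * 1"
      using i1 by (intro mult_left_mono power_le_one) auto
    also have "\<dots> \<le> K" by (simp add: K_def)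
    finally have 1: "norm (4 / 3 * z / of_nat (Suc n) ^ 2) \<le> K" .
    have "norm ((y - 2 * z * harm n) / of_nat (Suc n)) = norm (y - 2 * z * harm n) * norm (1 / of_nat (Suc n) :: complex)"
      by (simp add: norm_divide del: of_nat_Suc)
    also have "\<dots> \<le> K * (1 + real n) * 1"
      using b[of n] i1 K by (intro mult_mono) auto
    finally have 2: "norm ((y - 2 * z * harm n) / of_nat (Suc n)) \<le> K * (1 + real n)" by simp
    have "P2_const_coeff x y z (Suc n) = P2_const_coeff x y z n + (4 / 3 * z / of_nat (Suc n) ^ 2 - (y - 2 * z * harm n) / of_nat (Suc n))"
      by (simp add: P2_const_coeff_def)
    then have "norm (P2_const_coeff x y z (Suc n)) \<le> norm (P2_const_coeff x y z n) +
       (norm (4 / 3 * z / of_nat (Suc n) ^ 2) + norm ((y - 2 * z * harm n) / of_nat (Suc n)))"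
      using norm_triangle_le[OF add_mono[OF order_refl norm_triangle_ineq4]] by simp
    also have "\<dots> \<le> K * (1 + real n) ^ 2 + (K + K * (1 + real n))"
      using Suc 1 2 by (intro add_mono) auto
    also have "\<dots> \<le> K * (1 + real (Suc n)) ^ 2"
      using K by (simp add: power2_eq_square algebra_simps)
    finally show ?case .
  qed
  have m1: "1 + real n \<le> (1 + real n)^2" "1 \<le> (1 + real n)^2" for n
    by (auto simp: power2_eq_square algebra_simps)
  show "fast_decay (\<lambda>n. P2_const_coeff x y z n / fact n ^ 3)"
    by (rule fast_decay_poly(2)[OF a])
  show "fast_decay (\<lambda>n. (y - 2 * z * harm n) / fact n ^ 3)"
    by (rule fast_decay_poly(2)[of _ K]) (use b m1(1) K in \<open>meson order_trans mult_left_mono\<close>)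
  show "fast_decay (\<lambda>n. z / fact n ^ 3)"
    by (rule fast_decay_poly(2)[of _ "norm z"]) (use mult_left_mono[OF m1(2), of "norm z"] in auto)
qed

lemma deriv3_P2_sol: "(deriv ^^ 3) (P2_sol x y z) w = 27 * exp w ^ 3 * P2_sol x y z w"
proof -
  define a where "a n = P2_const_coeff x y z n / fact n ^ 3" for n
  define b where "b n = (y - 2 * z * harm n) / fact n ^ 3" for n
  define c where "c n = z / fact n ^ 3" for n
  define a3 where "a3 n = 27 * of_nat n ^ 3 * a n + 27 * of_nat n ^ 2 * b n + 18 * of_nat n * c n" for n
  define b3 where "b3 n = 27 * of_nat n ^ 3 * b n + 54 * of_nat n ^ 2 * c n" for n
  define c3 where "c3 n = 27 * of_nat n ^ 3 * c n" for n
  have fa: "fast_decay a" "fast_decay b" "fast_decay c"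
    by (simp_all add: a_def[abs_def] b_def[abs_def] c_def[abs_def] fast_decay_P2_sol)
  have "(deriv ^^ 3) (log_series 3 a b c) = deriv (deriv (deriv (log_series 3 a b c)))"
    by (simp add: numeral_3_eq_3)
  also have "\<dots> = log_series 3 a3 b3 c3"
  proof -
    note d1 = deriv_log_series[OF fa, of 3]
    have f1: "fast_decay (\<lambda>m. of_nat 3 * (of_nat m * a m) + b m)"
      "fast_decay (\<lambda>m. of_nat 3 * (of_nat m * b m) + 2 * c m)"
      "fast_decay (\<lambda>m. of_nat 3 * (of_nat m * c m))"
      by (intro fast_decay_intros fa)+
    note d2 = deriv_log_series[OF f1, of 3]
    have f2: "fast_decay (\<lambda>m. of_nat 3 * (of_nat m * (of_nat 3 * (of_nat m * a m) + b m)) +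
          (of_nat 3 * (of_nat m * b m) + 2 * c m))"
      "fast_decay (\<lambda>m. of_nat 3 * (of_nat m * (of_nat 3 * (of_nat m * b m) + 2 * c m)) +
          2 * (of_nat 3 * (of_nat m * c m)))"
      "fast_decay (\<lambda>m. of_nat 3 * (of_nat m * (of_nat 3 * (of_nat m * c m))))"
      by (intro fast_decay_intros fa)+
    note d3 = deriv_log_series[OF f2, of 3]
    show ?thesis
      unfolding d1 d2 d3 a3_def[abs_def] b3_def[abs_def] c3_def[abs_def]
      by (simp add: algebra_simps power2_eq_square power3_eq_cube)
  qed
  finally have "(deriv ^^ 3) (log_series 3 a b c) w = log_series 3 a3 b3 c3 w" by simp
  also have "\<dots> = (a3 0 + b3 0 * w + c3 0 * w ^ 2)
     + exp_times (real 3) (log_series 3 (\<lambda>m. a3 (Suc m)) (\<lambda>m. b3 (Suc m)) (\<lambda>m. c3 (Suc m))) w"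
  proof (rule log_series_split)
    have "fast_decay (\<lambda>m. 27 * (of_nat m * (of_nat m * (of_nat m * a m))) + 27 * (of_nat m * (of_nat m * b m)) + 18 * (of_nat m * c m))"
      "fast_decay (\<lambda>m. 27 * (of_nat m * (of_nat m * (of_nat m * b m))) + 54 * (of_nat m * (of_nat m * c m)))"
      "fast_decay (\<lambda>m. 27 * (of_nat m * (of_nat m * (of_nat m * c m))))"
      by (intro fast_decay_intros fa)+
    then show "fast_decay a3" "fast_decay b3" "fast_decay c3"
      by (simp_all add: a3_def[abs_def] b3_def[abs_def] c3_def[abs_def] power2_eq_square power3_eq_cube mult_ac)
  qed
  also have "(\<lambda>m. a3 (Suc m)) = (\<lambda>m. 27 * a m)"
  proof
    fix m
    define N where "N = (of_nat (Suc m) :: complex)"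
    have N: "N \<noteq> 0" by (simp add: N_def del: of_nat_Suc)
    have f: "fact (Suc m) = N * fact m" by (simp add: N_def)
    have "a3 (Suc m) = 27 * (P2_const_coeff x y z (Suc m) + (y - 2 * z * harm (Suc m)) / N + 2 / 3 * z / N ^ 2) / fact m ^ 3"
      using N unfolding a3_def a_def b_def c_def f N_def[symmetric]
      by (simp add: field_simps power2_eq_square power3_eq_cube)
    also have "P2_const_coeff x y z (Suc m) + (y - 2 * z * harm (Suc m)) / N + 2 / 3 * z / N ^ 2 = P2_const_coeff x y z m"
      using N unfolding P2_const_coeff_def harm_Suc N_def[symmetric] lessThan_Suc
      by (simp add: N_def[symmetric] field_simps power2_eq_square del: of_nat_Suc)
    finally show "a3 (Suc m) = 27 * a m" by (simp add: a_def)
  qed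
  also have "(\<lambda>m. b3 (Suc m)) = (\<lambda>m. 27 * b m)"
    by (auto simp: b3_def b_def c_def harm_Suc fun_eq_iff field_simps power2_eq_square power3_eq_cube simp del: of_nat_Suc)
  also have "(\<lambda>m. c3 (Suc m)) = (\<lambda>m. 27 * c m)"
    by (auto simp: c3_def c_def fun_eq_iff field_simps power2_eq_square power3_eq_cube simp del: of_nat_Suc)
  also have "log_series 3 (\<lambda>m. 27 * a m) (\<lambda>m. 27 * b m) (\<lambda>m. 27 * c m) = (\<lambda>w. 27 * log_series 3 a b c w)"
  proof
    fix w
    have "(\<lambda>m. 27 * ((a m + b m * w + c m * w ^ 2) * exp w ^ (3 * m))) sums (27 * log_series 3 a b c w)"
      by (intro sums_mult log_series_sums fa fast_decay_zero)
    moreover have "(\<lambda>m. (27 * a m + 27 * b m * w + 27 * c m * w ^ 2) * exp w ^ (3 * m))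
        sums log_series 3 (\<lambda>m. 27 * a m) (\<lambda>m. 27 * b m) (\<lambda>m. 27 * c m) w"
      by (intro log_series_sums fa fast_decay_intros)
    ultimately show "log_series 3 (\<lambda>m. 27 * a m) (\<lambda>m. 27 * b m) (\<lambda>m. 27 * c m) w = 27 * log_series 3 a b c w"
      by (simp add: sums_iff algebra_simps)
  qed
  finally show ?thesis
    using exp_of_nat_mult[of 3 w]
    by (simp add: P2_sol_def a_def[symmetric] b_def[symmetric] c_def[symmetric] a3_def b3_def c3_def exp_times_def)
qed

lemma tame_P2_sol: "tame 3 (P2_sol x y z)"
  using tame_log_series[OF fast_decay_P2_sol, of 3] by (simp add: P2_sol_def)

lemma P2_sol_in: "P2_sol x y z \<in> sol_P2"
  using tame_holomorphic[OF tame_P2_sol] deriv3_P2_sol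
  by (simp add: sol_P2_def holo_cover_def theta_eq_deriv Let_def)

lemma leading_P2_sol: "leading 3 (P2_sol x y z) (\<lambda>w. x + y * w + z * w ^ 2)"
  using leading_log_series[OF fast_decay_P2_sol(1)[of x y z] fast_decay_P2_sol(2)[of y z] fast_decay_P2_sol(3)[of z], of 3] by (simp add: P2_sol_def harm_def P2_const_coeff_def)

lemma expansion_P2_sol:
  "expansion_P2 (P2_sol x y z) (\<lambda>n j. if j = 2 then P2_const_coeff x y z n else if j = 1 then y - 2 * z * harm n else z)"
  unfolding expansion_P2_def
proof
  fix w
  show "(\<lambda>n. ((if 2 = (2::nat) then P2_const_coeff x y z n else if 2 = (1::nat) then y - 2 * z * harm n else z)
      + (if 1 = (2::nat) then P2_const_coeff x y z n else if 1 = (1::nat) then y - 2 * z * harm n else z) * w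
      + (if 0 = (2::nat) then P2_const_coeff x y z n else if 0 = (1::nat) then y - 2 * z * harm n else z) * w ^ 2)
      * (exp w ^ (3 * n) / fact n ^ 3)) sums P2_sol x y z w"
    using log_series_sums[OF fast_decay_P2_sol(1)[of x y z] fast_decay_P2_sol(2)[of y z] fast_decay_P2_sol(3)[of z], of w 3] by (simp add: P2_sol_def field_simps)
qed

lemma expansion_P2_unique:
  assumes "expansion_P2 f A" "expansion_P2 f B" "i \<le> 2"
  shows "A m i = B m i"
proof -
  define a where "a m = (A m 2 - B m 2) / fact m ^ 3" for m
  define b where "b m = (A m 1 - B m 1) / fact m ^ 3" for m
  define c where "c m = (A m 0 - B m 0) / fact m ^ 3" for m
  have s: "(\<lambda>m. (a m + b m * w + c m * w ^ 2) * exp w ^ (3 * m)) sums 0" for w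
    using sums_diff[OF assms(1)[unfolded expansion_P2_def, rule_format, of w]
       assms(2)[unfolded expansion_P2_def, rule_format, of w]]
    by (simp add: a_def b_def c_def algebra_simps add_divide_distrib diff_divide_distrib)
  have "a m = 0" "b m = 0" "c m = 0"
    using log_series_zero_coeff[of 3 a b c m] s by auto
  moreover have "i = 0 \<or> i = 1 \<or> i = 2" using assms(3) by auto
  ultimately show ?thesis by (auto simp: a_def b_def c_def)
qed

lemma B0_eq:
  assumes "expansion_P2 f A" "i \<le> 2"
  shows "B0 i f = A 0 i"
  unfolding B0_def using assms expansion_P2_unique by (intro the_equality) blast+

lemma B0_P2_sol: "B0 0 (P2_sol x y z) = z" "B0 1 (P2_sol x y z) = y" "B0 (Suc 0) (P2_sol x y z) = y" "B0 2 (P2_sol x y z) = x"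
  using B0_eq[OF expansion_P2_sol[of x y z], of 0] B0_eq[OF expansion_P2_sol[of x y z], of 1]
    B0_eq[OF expansion_P2_sol[of x y z], of 2] by (auto simp: harm_def P2_const_coeff_def)

lemma P2_const_coeff_linear:
  "P2_const_coeff (c * x + d * x') (c * y + d * y') (c * z + d * z') n = c * P2_const_coeff x y z n + d * P2_const_coeff x' y' z' n"
  by (induction n) (auto simp: P2_const_coeff_def field_simps power2_eq_square simp del: of_nat_Suc)

lemma P2_sol_linear:
  "P2_sol (c * x + d * x') (c * y + d * y') (c * z + d * z') = (\<lambda>w. c * P2_sol x y z w + d * P2_sol x' y' z' w)"
proof
  fix w
  have "(\<lambda>m. c * ((P2_const_coeff x y z m / fact m ^ 3 + (y - 2 * z * harm m) / fact m ^ 3 * w + z / fact m ^ 3 * w ^ 2) * exp w ^ (3 * m))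
      + d * ((P2_const_coeff x' y' z' m / fact m ^ 3 + (y' - 2 * z' * harm m) / fact m ^ 3 * w + z' / fact m ^ 3 * w ^ 2) * exp w ^ (3 * m)))
      sums (c * P2_sol x y z w + d * P2_sol x' y' z' w)"
    unfolding P2_sol_def by (intro sums_add sums_mult log_series_sums fast_decay_P2_sol)
  moreover have "(\<lambda>m. (P2_const_coeff (c * x + d * x') (c * y + d * y') (c * z + d * z') m / fact m ^ 3
      + ((c * y + d * y') - 2 * (c * z + d * z') * harm m) / fact m ^ 3 * w
      + (c * z + d * z') / fact m ^ 3 * w ^ 2) * exp w ^ (3 * m))
      sums P2_sol (c * x + d * x') (c * y + d * y') (c * z + d * z') w"
    unfolding P2_sol_def by (intro log_series_sums fast_decay_P2_sol)
  moreover have "c * ((P2_const_coeff x y z m / fact m ^ 3 + (y - 2 * z * harm m) / fact m ^ 3 * w + z / fact m ^ 3 * w ^ 2) * exp w ^ (3 * m))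
      + d * ((P2_const_coeff x' y' z' m / fact m ^ 3 + (y' - 2 * z' * harm m) / fact m ^ 3 * w + z' / fact m ^ 3 * w ^ 2) * exp w ^ (3 * m))
    = (P2_const_coeff (c * x + d * x') (c * y + d * y') (c * z + d * z') m / fact m ^ 3
      + ((c * y + d * y') - 2 * (c * z + d * z') * harm m) / fact m ^ 3 * w
      + (c * z + d * z') / fact m ^ 3 * w ^ 2) * exp w ^ (3 * m)" for m
    unfolding P2_const_coeff_linear by (simp add: add_divide_distrib diff_divide_distrib algebra_simps)
  ultimately show "P2_sol (c * x + d * x') (c * y + d * y') (c * z + d * z') w = c * P2_sol x y z w + d * P2_sol x' y' z' w"
    by (simp add: sums_iff)
qed

lemma sol_P2_ode: "sol_P2 = ode_space 3 (\<lambda>k w. [- 27 * exp w ^ 3, 0, 0, 1] ! k)"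
proof -
  have "{..3} = {0, 1, 2, 3::nat}" by auto
  then show ?thesis
    by (auto simp: sol_P2_def ode_space_def holo_cover_def theta_eq_deriv Let_def algebra_simps
         eq_neg_iff_add_eq_0)
qed

lemma sol_P2_obtain: "f \<in> sol_P2 \<Longrightarrow> \<exists>x y z. f = P2_sol x y z"
proof -
  assume f: "f \<in> sol_P2"
  define \<phi> :: "3 \<Rightarrow> complex \<Rightarrow> complex"
    where "\<phi> i = (if i = 1 then P2_sol 1 0 0 else if i = 2 then P2_sol 0 1 0 else P2_sol 0 0 1)" for i
  have comb: "(\<Sum>i\<in>UNIV. c i * \<phi> i w) = P2_sol (c 1) (c 2) (c 3) w" for c w
    using P2_sol_linear[of "c 1" 1 "c 2" 0 0 1 0 0] P2_sol_linear[of 1 "c 1" "c 3" 0 "c 2" 0 0 1]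
    by (simp add: sum_3 \<phi>_def)
  have "\<exists>c. \<forall>w. f w = (\<Sum>i\<in>UNIV. c i * \<phi> i w)"
  proof (rule ode_solutions_span[where a = "\<lambda>k w. [- 27 * exp w ^ 3, 0, 0, 1] ! k" and \<xi> = 0])
    fix k assume "k \<le> CARD(3)"
    then have "k \<in> {0, 1, 2, 3}" by auto
    then show "(\<lambda>w. [- 27 * exp w ^ 3, 0, 0, 1] ! k) holomorphic_on UNIV"
      by (auto intro!: holomorphic_intros)
  next
    show "\<phi> i \<in> ode_space CARD(3) (\<lambda>k w. [- 27 * exp w ^ 3, 0, 0, 1] ! k)" for i
      using P2_sol_in unfolding \<phi>_def sol_P2_ode by simp
    show "f \<in> ode_space CARD(3) (\<lambda>k w. [- 27 * exp w ^ 3, 0, 0, 1] ! k)"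
      using f unfolding sol_P2_ode by simp
    fix c i assume z: "\<And>w. (\<Sum>i\<in>UNIV. c i * \<phi> i w) = 0"
    have "P2_sol (c 1) (c 2) (c 3) = P2_sol 0 0 0"
      using z P2_sol_linear[of 0 0 0 0 0 0 0 0] by (auto simp: comb fun_eq_iff)
    then have "c 1 = 0" "c 2 = 0" "c 3 = 0"
      using B0_P2_sol[of "c 1" "c 2" "c 3"] B0_P2_sol[of 0 0 0] by auto
    then show "c i = 0" using exhaust_3[of i] by auto
  qed auto
  then show ?thesis unfolding comb fun_eq_iff by blast
qed


section \<open>The solution spaces and the bilinear maps on them\<close>

lemma sol_P1_iff: "f \<in> sol_P1 \<longleftrightarrow> (\<exists>x y. f = P1_sol x y)"
  using sol_P1_obtain P1_sol_in by blast

lemma sol_P2_iff: "f \<in> sol_P2 \<longleftrightarrow> (\<exists>x y z. f = P2_sol x y z)"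
  using sol_P2_obtain P2_sol_in by blast

lemma P1_sol_add: "P1_sol x y + P1_sol x' y' = P1_sol (x + x') (y + y')"
  using P1_sol_linear[of 1 x 1 x' y y'] by (simp add: fun_eq_iff)

lemma P1_sol_scale: "fscale c (P1_sol x y) = P1_sol (c * x) (c * y)"
  using P1_sol_linear[of c x 0 0 y 0] by (simp add: fun_eq_iff fscale_def)

lemma P2_sol_add: "P2_sol x y z + P2_sol x' y' z' = P2_sol (x + x') (y + y') (z + z')"
  using P2_sol_linear[of 1 x 1 x' y y' z z'] by (simp add: fun_eq_iff)

lemma P2_sol_scale: "fscale c (P2_sol x y z) = P2_sol (c * x) (c * y) (c * z)"
  using P2_sol_linear[of c x 0 0 y 0 z 0] by (simp add: fun_eq_iff fscale_def)

lemma subspace_sol_P1: "fvec.subspace sol_P1"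
  unfolding fvec.subspace_def sol_P1_iff
proof (intro conjI ballI allI)
  show "\<exists>x y. (0 :: complex \<Rightarrow> complex) = P1_sol x y"
    using P1_sol_scale[of 0 0 0] by (intro exI[of _ 0]) (simp add: fscale_def fun_eq_iff)
qed (auto simp del: plus_fun_apply simp: P1_sol_add P1_sol_scale sol_P1_iff, blast+)

lemma subspace_sol_P2: "fvec.subspace sol_P2"
  unfolding fvec.subspace_def sol_P2_iff
proof (intro conjI ballI allI)
  show "\<exists>x y z. (0 :: complex \<Rightarrow> complex) = P2_sol x y z"
    using P2_sol_scale[of 0 0 0 0] by (intro exI[of _ 0]) (simp add: fscale_def fun_eq_iff)
qed (auto simp del: plus_fun_apply simp: P2_sol_add P2_sol_scale sol_P2_iff, blast+)

lemma tame_sol_P1: "f \<in> sol_P1 \<Longrightarrow> tame 2 f"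
  using tame_P1_sol by (auto simp: sol_P1_iff)

lemma tame_sol_P2: "f \<in> sol_P2 \<Longrightarrow> tame 3 f"
  using tame_P2_sol by (auto simp: sol_P2_iff)

lemma linear_A0: "i \<le> 1 \<Longrightarrow> linear_on fscale (*) sol_P1 (A0 i)"
  by (cases i) (auto simp: linear_on_def sol_P1_iff P1_sol_add P1_sol_scale A0_P1_sol simp del: plus_fun_apply)

lemma linear_B0: "j \<le> 2 \<Longrightarrow> linear_on fscale (*) sol_P2 (B0 j)"
proof -
  assume "j \<le> 2"
  then have "j = 0 \<or> j = 1 \<or> j = 2" by auto
  then show ?thesis
    by (auto simp: linear_on_def sol_P2_iff P2_sol_add P2_sol_scale B0_P2_sol simp del: plus_fun_apply)
qed

lemma bilinear_AB:
  assumes "i \<le> 1" "j \<le> 2"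
  shows "bilinear_on (*) sol_P1 sol_P2 (\<lambda>f g. A0 i f * B0 j g)"
  using linear_A0[OF assms(1)] linear_B0[OF assms(2)]
  unfolding bilinear_on_def linear_on_def by (simp add: algebra_simps)

lemma P_dec_eq_pairing: "P_dec f g w = exp (- exp w) * pairing f g w (2 * w)"
  by (simp add: P_dec_def pairing_def P_integrand_def[abs_def] pairing_integrand_def[abs_def])

text \<open>
  Additivity of the integral uses integrability, which holds by tameness.
\<close>

lemma bilinear_P_dec: "bilinear_on fscale sol_P1 sol_P2 P_dec"
  unfolding bilinear_on_def linear_on_def
  using tame_sol_P1 tame_sol_P2
  by (auto simp: fun_eq_iff P_dec_eq_pairing fscale_def plus_fun_def pairing_add_left pairing_add_right pairing_cmult_left
       pairing_cmult_right algebra_simps)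


section \<open>Coordinates on the tensor product\<close>

text \<open>
  The index is that of the coordinate \<open>A\<^sub>0\<^sub>,\<^sub>i\<close> that equals one, so index \<open>0\<close> is the logarithmic
  solution; likewise for \<open>P^2\<close>.
\<close>

definition P1_basis :: "nat \<Rightarrow> complex \<Rightarrow> complex" where
  "P1_basis i = P1_sol (if i = 1 then 1 else 0) (if i = 0 then 1 else 0)"

definition P2_basis :: "nat \<Rightarrow> complex \<Rightarrow> complex" where
  "P2_basis j = P2_sol (if j = 2 then 1 else 0) (if j = 1 then 1 else 0) (if j = 0 then 1 else 0)"

definition tensor_indices :: "(nat \<times> nat) set" where
  "tensor_indices = {(0,0), (0,1), (0,2), (1,0), (1,1), (1,2)}"

definition tensor_comb :: "(nat \<times> nat \<Rightarrow> complex) \<Rightarrow> complex \<times> complex \<Rightarrow> complex" where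
  "tensor_comb c = (\<Sum>p\<in>tensor_indices. fscale (c p) (tensor (P1_basis (fst p)) (P2_basis (snd p))))"

lemma sum_tensor_indices: "(\<Sum>p\<in>tensor_indices. F p) = F (0,0) + F (0,1) + F (0,2) + F (1,0) + F (1,1) + F (1,2)"
  for F :: "nat \<times> nat \<Rightarrow> 'v::comm_monoid_add"
  by (simp add: tensor_indices_def add.assoc)

lemma P1_basis_in: "P1_basis i \<in> sol_P1" and P2_basis_in: "P2_basis j \<in> sol_P2"
  by (simp_all add: P1_basis_def P2_basis_def P1_sol_in P2_sol_in)

lemma tensor_in: "f \<in> sol_P1 \<Longrightarrow> g \<in> sol_P2 \<Longrightarrow> tensor f g \<in> sol_P1_P2"
  unfolding tensor_space_def by (rule fvec.span_base) blast

lemma subspace_sol_P1_P2: "fvec.subspace sol_P1_P2"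
  by (simp add: tensor_space_def)

lemma tensor_comb_in: "tensor_comb c \<in> sol_P1_P2"
  unfolding tensor_comb_def
  by (intro fvec.subspace_sum[OF subspace_sol_P1_P2] fvec.subspace_scale[OF subspace_sol_P1_P2] tensor_in P1_basis_in P2_basis_in)

lemma tensor_comb_add: "tensor_comb c + tensor_comb d = tensor_comb (\<lambda>p. c p + d p)"
  unfolding tensor_comb_def by (simp add: fvec.scale_left_distrib sum.distrib del: plus_fun_apply)

lemma tensor_comb_scale: "fscale a (tensor_comb c) = tensor_comb (\<lambda>p. a * c p)"
  unfolding tensor_comb_def by (simp add: fvec.scale_sum_right)

lemma linear_on_tensor_comb:
  assumes "linear_on fscale sV sol_P1_P2 L" "vector_space sV"
  shows "L (tensor_comb c) = (\<Sum>p\<in>tensor_indices. sV (c p) (L (tensor (P1_basis (fst p)) (P2_basis (snd p)))))"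
  unfolding tensor_comb_def
  by (rule linear_on_sum[OF assms(1) subspace_sol_P1_P2 assms(2)]) (intro tensor_in P1_basis_in P2_basis_in)

lemma sol_P1_P2_obtain:
  assumes "t \<in> sol_P1_P2"
  shows "\<exists>c. t = tensor_comb c"
  using assms unfolding tensor_space_def
proof (induction rule: fvec.span_induct_alt)
  case base
  have "0 = tensor_comb (\<lambda>_. 0)" by (simp add: tensor_comb_def del: zero_fun_apply)
  then show ?case by blast
next
  case (step a t u)
  then obtain f g d where t: "t = tensor f g" and fg: "f \<in> sol_P1" "g \<in> sol_P2" and u: "u = tensor_comb d" by blast
  obtain x y where f: "f = P1_sol x y" using fg by (auto simp: sol_P1_iff)
  obtain x' y' z' where g: "g = P2_sol x' y' z'" using fg by (auto simp: sol_P2_iff)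
  have f': "f w = x * P1_basis 1 w + y * P1_basis 0 w" for w
    using P1_sol_linear[of x 1 y 0 0 1] by (simp add: f P1_basis_def fun_eq_iff)
  have g': "g w = x' * P2_basis 2 w + y' * P2_basis 1 w + z' * P2_basis 0 w" for w
    using P2_sol_linear[of x' 1 y' 0 0 1 0 0] P2_sol_linear[of 1 x' z' 0 y' 0 0 1] by (simp add: g P2_basis_def fun_eq_iff)
  define c where "c p = (if fst p = 1 then x else y) * (if snd p = 2 then x' else if snd p = 1 then y' else z')"
    for p :: "nat \<times> nat"
  have "t = tensor_comb c"
    by (simp add: t tensor_def fun_eq_iff tensor_comb_def sum_tensor_indices fscale_def f' g' c_def algebra_simps)
  then have "fscale a t + u = tensor_comb (\<lambda>p. a * c p + d p)"
    by (simp add: u tensor_comb_scale tensor_comb_add del: plus_fun_apply)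
  then show ?case by blast
qed

text \<open>
  Hence the functionals \<open>AB i j\<close> are linear coordinates, dual to the tensors of basis solutions.
\<close>

lemma AB_tensor_comb: "p \<in> tensor_indices \<Longrightarrow> AB (fst p) (snd p) (tensor_comb c) = c p"
proof -
  assume p: "p \<in> tensor_indices"
  then have b: "bilinear_on (*) sol_P1 sol_P2 (\<lambda>f g. A0 (fst p) f * B0 (snd p) g)"
    by (intro bilinear_AB) (auto simp: tensor_indices_def)
  note V = vector_space_over_itself.vector_space_axioms[where ?'a = complex]
  have "AB (fst p) (snd p) (tensor_comb c) = (\<Sum>q\<in>tensor_indices. c q * (A0 (fst p) (P1_basis (fst q)) * B0 (snd p) (P2_basis (snd q))))"
    unfolding AB_def
      linear_on_tensor_comb[OF tensor_lift_linear[OF subspace_sol_P1 subspace_sol_P2 V b] V]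
      tensor_lift_tensor[OF subspace_sol_P1 subspace_sol_P2 V b P1_basis_in P2_basis_in] ..
  also have "\<dots> = c p"
    using p by (auto simp: sum_tensor_indices P1_basis_def P2_basis_def A0_P1_sol B0_P2_sol) (auto simp: tensor_indices_def A0_P1_sol B0_P2_sol)
  finally show ?thesis .
qed

lemma AB_tensor_comb_H: "AB 0 0 (tensor_comb c) = c (0,0)" "AB 1 0 (tensor_comb c) = c (1,0)" "AB 0 1 (tensor_comb c) = c (0,1)"
  using AB_tensor_comb[of "(0,0)" c] AB_tensor_comb[of "(1,0)" c] AB_tensor_comb[of "(0,1)" c] by (auto simp: tensor_indices_def)

lemma linear_P_op: "linear_on fscale fscale sol_P1_P2 P_op"
  unfolding P_op_def
  by (rule tensor_lift_linear[OF subspace_sol_P1 subspace_sol_P2 fvec.vector_space_axioms bilinear_P_dec])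

lemma P_op_tensor: "f \<in> sol_P1 \<Longrightarrow> g \<in> sol_P2 \<Longrightarrow> P_op (tensor f g) = P_dec f g"
  unfolding P_op_def
  by (rule tensor_lift_tensor[OF subspace_sol_P1 subspace_sol_P2 fvec.vector_space_axioms bilinear_P_dec])


section \<open>The differential system of the moments\<close>

text \<open>
  The integrals of \<open>X\<^sup>k f * Y\<^sup>l g\<close>, extended linearly to the tensor with coordinates \<open>c\<close>.
\<close>

definition moment :: "(nat \<times> nat \<Rightarrow> complex) \<Rightarrow> nat \<Rightarrow> nat \<Rightarrow> complex \<Rightarrow> complex \<Rightarrow> complex" where
  "moment c k l s t = (\<Sum>p\<in>tensor_indices. c p * pairing ((scaled_deriv 2 ^^ k) (P1_basis (fst p))) ((scaled_deriv 3 ^^ l) (P2_basis (snd p))) s t)"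

lemma P_op_tensor_comb: "P_op (tensor_comb c) w = exp (- exp w) * moment c 0 0 w (2 * w)"
  unfolding linear_on_tensor_comb[OF linear_P_op fvec.vector_space_axioms] P_op_tensor[OF P1_basis_in P2_basis_in]
  by (simp add: sum_fun_apply fscale_def P_dec_eq_pairing moment_def sum_distrib_left mult_ac)

lemma H_space_iff: "t \<in> H_space \<longleftrightarrow> (\<exists>c. t = tensor_comb c \<and> c (0,0) = 0 \<and> 4 * c (1,0) = 3 * c (0,1))"
  unfolding H_space_def using sol_P1_P2_obtain tensor_comb_in by (auto simp: AB_tensor_comb_H simp del: One_nat_def) (metis AB_tensor_comb_H)

lemma deriv_divide_const:
  assumes "f holomorphic_on UNIV"
  shows "deriv (\<lambda>w. f w / a) w = deriv f w / a"
  using deriv_cmult[of f w "1 / a"] assms holomorphic_on_imp_differentiable_at[OF assms open_UNIV]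
  by (simp add: field_simps)

lemma holomorphic_basis: "P1_basis i holomorphic_on UNIV" "P2_basis j holomorphic_on UNIV"
  unfolding P1_basis_def P2_basis_def by (rule tame_holomorphic tame_P1_sol tame_P2_sol)+

lemma scaled_deriv_P1_basis: "scaled_deriv 2 (scaled_deriv 2 (P1_basis i)) = exp_times 2 (P1_basis i)"
proof -
  have "scaled_deriv 2 (scaled_deriv 2 (P1_basis i)) = (\<lambda>w. (deriv ^^ 2) (P1_basis i) w / 4)"
    using holomorphic_basis(1) by (auto simp: scaled_deriv_def fun_eq_iff deriv_divide_const holomorphic_deriv numeral_2_eq_2)
  then show ?thesis
    by (simp add: P1_basis_def deriv2_P1_sol exp_times_def fun_eq_iff exp_double)
qed

lemma scaled_deriv_P2_basis: "scaled_deriv 3 (scaled_deriv 3 (scaled_deriv 3 (P2_basis j))) = exp_times 3 (P2_basis j)"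
proof -
  have "scaled_deriv 3 (scaled_deriv 3 (scaled_deriv 3 (P2_basis j))) = (\<lambda>w. (deriv ^^ 3) (P2_basis j) w / 27)"
    using holomorphic_basis(2)
    by (auto simp: scaled_deriv_def fun_eq_iff deriv_divide_const holomorphic_deriv numeral_3_eq_3 intro!: holomorphic_intros)
  then show ?thesis
    using exp_of_nat_mult[of 3, where ?'a = complex] by (simp add: P2_basis_def deriv3_P2_sol exp_times_def fun_eq_iff)
qed

lemma tame_basis: "tame 2 ((scaled_deriv 2 ^^ k) (P1_basis i))" "tame 3 ((scaled_deriv 3 ^^ l) (P2_basis j))"
  by (auto intro!: tame_scaled_deriv_funpow simp: P1_basis_def P2_basis_def tame_P1_sol tame_P2_sol)

lemma has_field_derivative_moment:
  "((\<lambda>w. moment c k l (s + a * w) (t + b * w)) has_field_derivative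
     a * moment c (Suc k) l (s + a * w) (t + b * w) + b * moment c k (Suc l) (s + a * w) (t + b * w)) (at w)"
  unfolding moment_def sum_distrib_left sum.distrib[symmetric]
  by (rule DERIV_sum, rule DERIV_cong[OF DERIV_cmult[OF has_field_derivative_pairing[OF tame_basis]]])
     (simp add: algebra_simps)

text \<open>
  These are the relations \<open>X\<^sup>2 = q\<^sub>1 (X + Y + 1)\<close> and \<open>Y\<^sup>3 = q\<^sub>2 (X + Y + 1)\<close> of a
  hypergeometric system in two variables, with \<open>q\<^sub>1 = exp s\<close> and \<open>q\<^sub>2 = exp t\<close>.
\<close>

lemma moment_reduce_left: "moment c (Suc (Suc 0)) l s t = exp s * (moment c 0 l s t + moment c (Suc 0) l s t + moment c 0 (Suc l) s t)"
proof -
  have "pairing ((scaled_deriv 2 ^^ Suc (Suc 0)) (P1_basis i)) ((scaled_deriv 3 ^^ l) (P2_basis j)) s t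
     = exp s * (pairing ((scaled_deriv 2 ^^ 0) (P1_basis i)) ((scaled_deriv 3 ^^ l) (P2_basis j)) s t
        + pairing ((scaled_deriv 2 ^^ Suc 0) (P1_basis i)) ((scaled_deriv 3 ^^ l) (P2_basis j)) s t
        + pairing ((scaled_deriv 2 ^^ 0) (P1_basis i)) ((scaled_deriv 3 ^^ Suc l) (P2_basis j)) s t)" for i j
    using pairing_exp_times_left[OF tame_basis(1)[of 0 i] tame_basis(2)[of l j]] by (simp add: scaled_deriv_P1_basis)
  then show ?thesis unfolding moment_def by (simp add: sum_distrib_left sum.distrib algebra_simps)
qed

lemma moment_reduce_right: "moment c k (Suc (Suc (Suc 0))) s t = exp t * (moment c k 0 s t + moment c (Suc k) 0 s t + moment c k (Suc 0) s t)"
proof -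
  have "pairing ((scaled_deriv 2 ^^ k) (P1_basis i)) ((scaled_deriv 3 ^^ Suc (Suc (Suc 0))) (P2_basis j)) s t
     = exp t * (pairing ((scaled_deriv 2 ^^ k) (P1_basis i)) ((scaled_deriv 3 ^^ 0) (P2_basis j)) s t
        + pairing ((scaled_deriv 2 ^^ Suc k) (P1_basis i)) ((scaled_deriv 3 ^^ 0) (P2_basis j)) s t
        + pairing ((scaled_deriv 2 ^^ k) (P1_basis i)) ((scaled_deriv 3 ^^ Suc 0) (P2_basis j)) s t)" for i j
    using pairing_exp_times_right[OF tame_basis(1)[of k i] tame_basis(2)[of 0 j]] by (simp add: scaled_deriv_P2_basis)
  then show ?thesis unfolding moment_def by (simp add: sum_distrib_left sum.distrib algebra_simps)
qed


section \<open>The first-order system behind the equation of the blown-up plane\<close>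

text \<open>
  Each derivative of \<open>exp (- z) * s00\<close> is \<open>exp (- z)\<close> times a combination of the four functions with
  coefficients polynomial in \<open>z\<close>. Five such combinations are dependent, and the equation of \<open>F_1\<close> is the
  dependency. The determinant of the first four is \<open>z * (283 * z - 24)\<close>, which explains the exceptional
  point in the second claim.
\<close>

lemma F1_system:
  fixes s00 s01 s02 s10 :: "complex \<Rightarrow> complex"
  assumes d00: "\<And>w. (s00 has_field_derivative s10 w + 2 * s01 w) (at w)"
    and d01: "\<And>w. (s01 has_field_derivative 3 * s02 w + exp w * s01 w - exp w ^ 2 * s00 w) (at w)"
    and d02: "\<And>w. (s02 has_field_derivative
        2 * exp w ^ 2 * s00 w + 2 * exp w ^ 2 * s01 w + exp w * s02 w + 3 * exp w ^ 2 * s10 w) (at w)"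
    and d10: "\<And>w. (s10 has_field_derivative
        (exp w - 2 * exp w ^ 2) * s00 w + 3 * exp w * s01 w + 2 * s02 w + exp w * s10 w) (at w)"
  defines "G \<equiv> \<lambda>w. exp (- exp w) * s00 w"
  shows "G \<in> sol_F1"
    and "(\<And>w. G w = 0) \<Longrightarrow> 283 * exp w \<noteq> 24 \<Longrightarrow> s00 w = 0 \<and> s01 w = 0 \<and> s02 w = 0 \<and> s10 w = 0"
proof -
  have D: "deriv (\<lambda>w. exp (- exp w) * (a w * s00 w + b w * s01 w + c w * s02 w + d w * s10 w)) =
    (\<lambda>w. exp (- exp w) *
      ((a' w - exp w * a w - exp w ^ 2 * b w + 2 * exp w ^ 2 * c w + (exp w - 2 * exp w ^ 2) * d w) * s00 w
      + (b' w + 2 * a w + 2 * exp w ^ 2 * c w + 3 * exp w * d w) * s01 w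
      + (c' w + 3 * b w + 2 * d w) * s02 w
      + (d' w + a w + 3 * exp w ^ 2 * c w) * s10 w))"
    if "\<And>w. (a has_field_derivative a' w) (at w)" "\<And>w. (b has_field_derivative b' w) (at w)"
      "\<And>w. (c has_field_derivative c' w) (at w)" "\<And>w. (d has_field_derivative d' w) (at w)"
    for a b c d a' b' c' d'
    by (rule ext, rule DERIV_imp_deriv)
       (auto intro!: derivative_eq_intros that d00 d01 d02 d10 simp: algebra_simps)
  define E where "E w = exp (- exp w)" for w :: complex
  define comb where "comb p q r u = (\<lambda>w. E w * (p (exp w) * s00 w + q (exp w) * s01 w + r (exp w) * s02 w + u (exp w) * s10 w))"
    for p q r u :: "complex \<Rightarrow> complex"
  have G0: "G = comb (\<lambda>z. 1) (\<lambda>z. 0) (\<lambda>z. 0) (\<lambda>z. 0)"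
    by (simp add: G_def comb_def E_def)
  have G1: "deriv G = comb (\<lambda>z. - z) (\<lambda>z. 2) (\<lambda>z. 0) (\<lambda>z. 1)"
    unfolding G0 comb_def E_def
    by (subst D[where a' = "\<lambda>_. 0" and b' = "\<lambda>_. 0" and c' = "\<lambda>_. 0" and d' = "\<lambda>_. 0"])
       (auto intro!: derivative_eq_intros simp: algebra_simps power2_eq_square)
  have G2: "deriv (deriv G) = comb (\<lambda>z. - 3 * z ^ 2) (\<lambda>z. z) (\<lambda>z. 8) (\<lambda>z. - z)"
    unfolding G1 comb_def E_def
    by (subst D[where a' = "\<lambda>w. - exp w" and b' = "\<lambda>_. 0" and c' = "\<lambda>_. 0" and d' = "\<lambda>_. 0"])
       (auto intro!: derivative_eq_intros simp: algebra_simps power2_eq_square)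
  have G3: "deriv (deriv (deriv G)) = comb (\<lambda>z. 9 * z ^ 2 + 4 * z ^ 3) (\<lambda>z. z + 7 * z ^ 2) (\<lambda>z. z) (\<lambda>z. - z + 21 * z ^ 2)"
    unfolding G2 comb_def E_def
    by (subst D[where a' = "\<lambda>w. - 6 * exp w ^ 2" and b' = "\<lambda>w. exp w" and c' = "\<lambda>_. 0" and d' = "\<lambda>w. - exp w"])
       (auto intro!: derivative_eq_intros simp: algebra_simps power2_eq_square power3_eq_cube)
  have G4: "deriv (deriv (deriv (deriv G))) = comb (\<lambda>z. 17 * z ^ 2 + 27 * z ^ 3 - 53 * z ^ 4)
      (\<lambda>z. z + 29 * z ^ 2 + 73 * z ^ 3) (\<lambda>z. 2 * z + 63 * z ^ 2) (\<lambda>z. - z + 51 * z ^ 2 + 7 * z ^ 3)"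
    unfolding G3 comb_def E_def
    by (subst D[where a' = "\<lambda>w. 18 * exp w ^ 2 + 12 * exp w ^ 3" and b' = "\<lambda>w. exp w + 14 * exp w ^ 2"
          and c' = "\<lambda>w. exp w" and d' = "\<lambda>w. - exp w + 42 * exp w ^ 2"])
       (auto intro!: derivative_eq_intros simp: algebra_simps power2_eq_square power3_eq_cube power4_eq_xxxx)
  have hol: "G holomorphic_on UNIV"
    unfolding G_def using d00
    by (intro holomorphic_intros) (auto simp: holomorphic_on_def field_differentiable_def)
  have "(283*z - 24) * deriv (deriv (deriv (deriv G))) w
     + (283*z^2 - 590*z + 24) * deriv (deriv (deriv G)) w
     + z * (-2264*z^2 + 192*z + 3) * deriv (deriv G) w
     - 4*z^2 * (2547*z^2 + 350*z - 104) * deriv G w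
     + z^2 * (-3113*z^3 - 9924*z^2 + 1476*z + 192) * G w = 0" if "z = exp w" for z w
    unfolding G4 unfolding G3 unfolding G2 unfolding G1 unfolding G0 comb_def that[symmetric] by algebra
  then show "G \<in> sol_F1"
    using hol by (simp add: sol_F1_def holo_cover_def Let_def theta_eq_deriv theta_def eval_nat_numeral)
  assume z: "\<And>w. G w = 0" and ne: "283 * exp w \<noteq> 24"
  have G: "G = (\<lambda>_. 0)" using z by auto
  have "deriv G w = 0" "deriv (deriv G) w = 0" "deriv (deriv (deriv G)) w = 0"
    unfolding G by auto
  moreover have E: "E w \<noteq> 0" by (simp add: E_def)
  moreover define x where "x = exp w"
  ultimately have e: "s00 w = 0" "2 * s01 w + s10 w = 0" "x * s01 w + 8 * s02 w - x * s10 w = 0"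
    "(x + 7 * x ^ 2) * s01 w + x * s02 w + (- x + 21 * x ^ 2) * s10 w = 0"
    using z[of w] unfolding G3 unfolding G2 unfolding G1 unfolding G0 comb_def x_def[symmetric] by auto
  have s10: "s10 w = - 2 * s01 w" using e(2) by (simp add: eq_neg_iff_add_eq_0 add.commute)
  have "x * (24 - 283 * x) * s01 w = 0"
    using e(3,4) unfolding s10 by algebra
  moreover have "x \<noteq> 0" by (simp add: x_def)
  ultimately have s01: "s01 w = 0" using ne by (auto simp: x_def[symmetric])
  then show "s00 w = 0 \<and> s01 w = 0 \<and> s02 w = 0 \<and> s10 w = 0"
    using e s10 by auto
qed


section \<open>Asymptotics of the moments\<close>

definition P1_leading :: "nat \<Rightarrow> complex \<Rightarrow> complex" where
  "P1_leading i = (\<lambda>w. (if i = 1 then 1 else 0) + (if i = 0 then 1 else 0) * w)"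

definition P2_leading :: "nat \<Rightarrow> complex \<Rightarrow> complex" where
  "P2_leading j = (\<lambda>w. (if j = 2 then 1 else 0) + (if j = 1 then 1 else 0) * w + (if j = 0 then 1 else 0) * w ^ 2)"

lemma leading_basis: "leading 2 (P1_basis i) (P1_leading i)" "leading 3 (P2_basis j) (P2_leading j)"
  unfolding P1_basis_def P2_basis_def P1_leading_def P2_leading_def by (rule leading_P1_sol leading_P2_sol)+

lemma scaled_deriv_P1_leading: "scaled_deriv 2 (P1_leading i) = (\<lambda>_. (if i = 0 then 1 / 2 else 0))"
  unfolding P1_leading_def scaled_deriv_def by (auto simp: fun_eq_iff)

lemma scaled_deriv_P2_leading: "scaled_deriv 3 (P2_leading j) = (\<lambda>w. (if j = 1 then 1 / 3 else 0) + (if j = 0 then 2 / 3 else 0) * w)"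
proof -
  have "deriv (P2_leading j) w = (if j = 1 then 1 else 0) + (if j = 0 then 2 else 0) * w" for w
    unfolding P2_leading_def by (rule DERIV_imp_deriv) (auto intro!: derivative_eq_intros)
  then show ?thesis by (auto simp: scaled_deriv_def)
qed

lemma scaled_deriv_linear: "scaled_deriv 3 (\<lambda>w. (if j = 1 then 1 / 3 else 0) + (if j = 0 then 2 / 3 else 0) * w) = (\<lambda>_. (if j = 0 then 2 / 9 else 0))"
proof -
  have "deriv (\<lambda>w. (if j = 1 then 1 / 3 else 0) + (if j = 0 then 2 / 3 else 0) * w) w = (if j = 0 then 2 / 3 else 0)"
    for w :: complex
    by (rule DERIV_imp_deriv) (auto intro!: derivative_eq_intros)
  then show ?thesis by (auto simp: scaled_deriv_def)
qed

lemma scaled_deriv_leading: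
  "(scaled_deriv 2 ^^ Suc 0) (P1_leading i) = (\<lambda>_. (if i = 0 then 1 / 2 else 0))"
  "(scaled_deriv 3 ^^ Suc 0) (P2_leading j) = (\<lambda>w. (if j = 1 then 1 / 3 else 0) + (if j = 0 then 2 / 3 else 0) * w)"
  "(scaled_deriv 3 ^^ Suc (Suc 0)) (P2_leading j) = (\<lambda>_. (if j = 0 then 2 / 9 else 0))"
  by (simp_all only: scaled_deriv_P1_leading scaled_deriv_P2_leading scaled_deriv_linear funpow.simps o_def id_def)

definition leading_moment :: "(nat \<times> nat \<Rightarrow> complex) \<Rightarrow> nat \<Rightarrow> nat \<Rightarrow> complex \<Rightarrow> complex \<Rightarrow> complex" where
  "leading_moment c k l s t = (\<Sum>p\<in>tensor_indices. c p * pairing ((scaled_deriv 2 ^^ k) (P1_leading (fst p))) ((scaled_deriv 3 ^^ l) (P2_leading (snd p))) s t)"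

lemma moment_leading:
  assumes "1 \<le> \<beta>" "\<beta> \<le> 2"
  shows "((\<lambda>x. moment c k l (s + of_real x) (t + of_real (\<beta> * x)) - leading_moment c k l (s + of_real x) (t + of_real (\<beta> * x))) \<longlongrightarrow> 0) at_bot"
proof -
  have "((\<lambda>x. \<Sum>p\<in>tensor_indices. c p * (pairing ((scaled_deriv 2 ^^ k) (P1_basis (fst p))) ((scaled_deriv 3 ^^ l) (P2_basis (snd p))) (s + of_real x) (t + of_real (\<beta> * x))
      - pairing ((scaled_deriv 2 ^^ k) (P1_leading (fst p))) ((scaled_deriv 3 ^^ l) (P2_leading (snd p))) (s + of_real x) (t + of_real (\<beta> * x))))
      \<longlongrightarrow> (\<Sum>p\<in>tensor_indices. c p * 0)) at_bot"
    by (intro tendsto_sum tendsto_mult tendsto_const pairing_leading leading_scaled_deriv_funpow leading_basis assms) auto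
  then show ?thesis
    by (simp add: moment_def leading_moment_def sum_subtractf right_diff_distrib)
qed

lemma exp_mult_moment_tendsto_0:
  "((\<lambda>x. exp (a + of_real x) * moment c k l (s + of_real x) (t + of_real x)) \<longlongrightarrow> 0) at_bot"
proof -
  have "((\<lambda>x. \<Sum>p\<in>tensor_indices. c p * (exp (a + of_real (1 * x)) * pairing ((scaled_deriv 2 ^^ k) (P1_basis (fst p))) ((scaled_deriv 3 ^^ l) (P2_basis (snd p)))
      (s + of_real x) (t + of_real (1 * x)))) \<longlongrightarrow> (\<Sum>p\<in>tensor_indices. c p * 0)) at_bot"
    by (intro tendsto_sum tendsto_mult tendsto_const exp_mult_pairing_tendsto_0 tame_basis) auto
  then show ?thesis
    by (simp add: moment_def sum_distrib_left mult_ac)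
qed


section \<open>The conserved quantity that cuts out the subspace\<close>

text \<open>
  Write \<open>q\<^sub>1 = exp s\<close> and \<open>q\<^sub>2 = exp t\<close>. From \<open>X\<^sup>2 = (X + Y) (X - Y) + Y\<^sup>2\<close> and
  \<open>X\<^sup>2 = q\<^sub>1 (X + Y + 1) = (X + Y) q\<^sub>1\<close> one gets \<open>Y\<^sup>2 = - (X + Y) (X - Y - q\<^sub>1)\<close>; applying \<open>Y\<close> and comparing
  with \<open>Y\<^sup>3 = (X + Y) q\<^sub>2\<close> gives \<open>(X + Y) (Y (X - Y - q\<^sub>1) + q\<^sub>2) = 0\<close>. The second factor,
  applied to the pairing, is the function defined here.
\<close>

definition defect :: "(nat \<times> nat \<Rightarrow> complex) \<Rightarrow> complex \<Rightarrow> complex \<Rightarrow> complex" where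
  "defect c s t = moment c (Suc 0) (Suc 0) s t - moment c 0 (Suc (Suc 0)) s t - exp s * moment c 0 (Suc 0) s t + exp t * moment c 0 0 s t"

text \<open>
  For \<open>a = b\<close> this is the conservation law; for \<open>a \<noteq> b\<close> it gives, once the defect is known to vanish,
  a second relation between the moments.
\<close>

lemma has_field_derivative_defect:
  "((\<lambda>w. defect c (s + a * w) (t + b * w)) has_field_derivative
    (b - a) * (moment c (Suc 0) (Suc (Suc 0)) (s + a * w) (t + b * w)
      - exp (s + a * w) * moment c 0 (Suc (Suc 0)) (s + a * w) (t + b * w)
      - exp (t + b * w) * moment c (Suc 0) 0 (s + a * w) (t + b * w))) (at w)"
  unfolding defect_def
  by (rule DERIV_cong, (rule derivative_eq_intros has_field_derivative_moment refl)+)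
     (simp add: moment_reduce_left moment_reduce_right algebra_simps)

definition H_coeffs :: "(nat \<times> nat \<Rightarrow> complex) \<Rightarrow> bool" where
  "H_coeffs c \<longleftrightarrow> c (0,0) = 0 \<and> 4 * c (1,0) = 3 * c (0,1)"

text \<open>
  Along \<open>(s + x, t + x)\<close> the defect is constant, and for \<open>x \<rightarrow> - \<infinity>\<close> it tends to the contribution of
  the leading polynomials, which for a general tensor is
  \<open>c\<^sub>0\<^sub>1 / 6 - 2 * c\<^sub>1\<^sub>0 / 9 + c\<^sub>0\<^sub>0 * (t - s) / 9\<close>. So the two equations defining the subspace say exactly
  that the defect vanishes identically.
\<close>

lemma defect_zero:
  assumes "H_coeffs c"
  shows "defect c s t = 0"
proof -
  have c: "c (0,0) = 0" "c (Suc 0,0) = 3 / 4 * c (0,Suc 0)"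
    using assms by (auto simp: H_coeffs_def field_simps)
  have "\<exists>C. \<forall>w\<in>UNIV. defect c (s + 1 * w) (t + 1 * w) = C"
  proof (rule has_field_derivative_zero_constant)
    fix w
    show "((\<lambda>w. defect c (s + 1 * w) (t + 1 * w)) has_field_derivative 0) (at w within UNIV)"
      using has_field_derivative_defect[of c s 1 t 1 w] by simp
  qed auto
  then obtain C where C: "defect c (s + w) (t + w) = C" for w by auto
  \<comment> \<open>Here the two equations on the coordinates are used.\<close>
  have L: "leading_moment c (Suc 0) (Suc 0) s t - leading_moment c 0 (Suc (Suc 0)) s t = 0" for s t
    by (simp add: leading_moment_def sum_tensor_indices c scaled_deriv_leading pairing_zero pairing_const del: funpow.simps)
       (simp add: P1_leading_def pairing_const)
  have "((\<lambda>x. (moment c (Suc 0) (Suc 0) (s + of_real x) (t + of_real (1 * x)) - leading_moment c (Suc 0) (Suc 0) (s + of_real x) (t + of_real (1 * x)))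
     - (moment c 0 (Suc (Suc 0)) (s + of_real x) (t + of_real (1 * x)) - leading_moment c 0 (Suc (Suc 0)) (s + of_real x) (t + of_real (1 * x)))
     - exp (s + of_real x) * moment c 0 (Suc 0) (s + of_real x) (t + of_real x)
     + exp (t + of_real x) * moment c 0 0 (s + of_real x) (t + of_real x)) \<longlongrightarrow> 0 - 0 - 0 + 0) at_bot"
    by (intro tendsto_add tendsto_diff moment_leading exp_mult_moment_tendsto_0) auto
  also have "(\<lambda>x. (moment c (Suc 0) (Suc 0) (s + of_real x) (t + of_real (1 * x)) - leading_moment c (Suc 0) (Suc 0) (s + of_real x) (t + of_real (1 * x)))
     - (moment c 0 (Suc (Suc 0)) (s + of_real x) (t + of_real (1 * x)) - leading_moment c 0 (Suc (Suc 0)) (s + of_real x) (t + of_real (1 * x)))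
     - exp (s + of_real x) * moment c 0 (Suc 0) (s + of_real x) (t + of_real x)
     + exp (t + of_real x) * moment c 0 0 (s + of_real x) (t + of_real x)) = (\<lambda>x. defect c (s + of_real x) (t + of_real x))"
    using L by (auto simp: defect_def fun_eq_iff algebra_simps)
  finally have "((\<lambda>x::real. C) \<longlongrightarrow> 0) at_bot" unfolding C by simp
  then have "C = 0" using tendsto_unique[OF trivial_limit_at_bot_linorder tendsto_const] by blast
  then show ?thesis using C[of 0] by simp
qed

text \<open>
  The vanishing of the defect and of its derivative expresses two of the six moments by the other four,
  which then satisfy the first-order system. If the image is zero, so are all four moments near
  \<open>w = - \<infinity>\<close>; their limits there are, one after the other, nonzero multiples of \<open>c\<^sub>1\<^sub>0\<close>, \<open>c\<^sub>0\<^sub>2\<close>,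
  \<open>c\<^sub>1\<^sub>1\<close> and \<open>c\<^sub>1\<^sub>2\<close>.
\<close>

lemma P_op_H:
  assumes H: "H_coeffs c"
  shows "P_op (tensor_comb c) \<in> sol_F1"
    and "P_op (tensor_comb c) = (\<lambda>_. 0) \<Longrightarrow> p \<in> tensor_indices \<Longrightarrow> c p = 0"
proof -
  define s00 s01 s02 s10 where "s00 = (\<lambda>w. moment c 0 0 w (2 * w))"
    and "s01 = (\<lambda>w. moment c 0 (Suc 0) w (2 * w))" and "s02 = (\<lambda>w. moment c 0 (Suc (Suc 0)) w (2 * w))"
    and "s10 = (\<lambda>w. moment c (Suc 0) 0 w (2 * w))"
  note s_def = s00_def s01_def s02_def s10_def
  have e2: "exp (2 * w) = exp w ^ 2" for w :: complex by (rule exp_double)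
  have der: "((\<lambda>w. moment c k l w (2 * w)) has_field_derivative
      moment c (Suc k) l w (2 * w) + 2 * moment c k (Suc l) w (2 * w)) (at w)" for k l w
    using has_field_derivative_moment[of c k l 0 1 0 2 w] by simp
  \<comment> \<open>Vanishing of the defect on the line \<open>(w, 2 * w)\<close>.\<close>
  have s11: "moment c (Suc 0) (Suc 0) w (2 * w) = s02 w + exp w * s01 w - exp w ^ 2 * s00 w" for w
    using defect_zero[OF H, of w "2 * w"] unfolding defect_def e2 by (simp add: s_def algebra_simps)
  \<comment> \<open>Vanishing of its derivative along this line, which is not the direction in which it is conserved.\<close>
  have "((\<lambda>w. defect c (0 + 1 * w) (0 + 2 * w)) has_field_derivative 0) (at w)" for w
    unfolding defect_zero[OF H] by simp
  from DERIV_unique[OF this has_field_derivative_defect]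
  have s12: "moment c (Suc 0) (Suc (Suc 0)) w (2 * w) = exp w ^ 2 * s10 w + exp w * s02 w" for w
    unfolding add_0 e2 by (simp add: s_def algebra_simps)
  have d00: "(s00 has_field_derivative s10 w + 2 * s01 w) (at w)" for w
    using der[of 0 0 w] by (simp add: s_def)
  have d01: "(s01 has_field_derivative 3 * s02 w + exp w * s01 w - exp w ^ 2 * s00 w) (at w)" for w
    using der[of 0 "Suc 0" w, unfolded s11] by (simp add: s_def algebra_simps)
  have d02: "(s02 has_field_derivative
        2 * exp w ^ 2 * s00 w + 2 * exp w ^ 2 * s01 w + exp w * s02 w + 3 * exp w ^ 2 * s10 w) (at w)" for w
    using der[of 0 "Suc (Suc 0)" w, unfolded s12 moment_reduce_right] unfolding e2 by (simp add: s_def algebra_simps)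
  have d10: "(s10 has_field_derivative
        (exp w - 2 * exp w ^ 2) * s00 w + 3 * exp w * s01 w + 2 * s02 w + exp w * s10 w) (at w)" for w
    using der[of "Suc 0" 0 w, unfolded s11 moment_reduce_left] unfolding e2 by (simp add: s_def algebra_simps)
  have G: "P_op (tensor_comb c) = (\<lambda>w. exp (- exp w) * s00 w)"
    by (simp add: fun_eq_iff P_op_tensor_comb s00_def)
  note F1 = F1_system[OF d00 d01 d02 d10]
  show "P_op (tensor_comb c) \<in> sol_F1" unfolding G by (rule F1(1))
  assume z: "P_op (tensor_comb c) = (\<lambda>_. 0)" and p: "p \<in> tensor_indices"
  have z': "exp (- exp w) * s00 w = 0" for w using fun_cong[OF z[unfolded G], of w] .
  have lim: "((\<lambda>x::real. exp (of_real x) :: complex) \<longlongrightarrow> 0) at_bot"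
    using tendsto_of_real[OF exp_at_bot] by (simp add: exp_of_real)
  have "\<forall>\<^sub>F x in at_bot. (exp (of_real x) :: complex) \<noteq> 24 / 283"
    using tendsto_imp_eventually_ne[OF lim, of "24 / 283"] by simp
  then have ev: "\<forall>\<^sub>F x in at_bot. s00 (of_real x) = 0 \<and> s01 (of_real x) = 0 \<and> s02 (of_real x) = 0 \<and> s10 (of_real x) = 0"
  proof eventually_elim
    case (elim x)
    then show ?case using F1(2)[OF z', of "of_real x"] by (simp add: field_simps)
  qed
  \<comment> \<open>A moment that vanishes near \<open>- \<infinity>\<close> has vanishing leading part, provided that the latter is constant.\<close>
  have lead: "v = 0" if "\<And>s t. leading_moment c k l s t = v"
    and "\<forall>\<^sub>F x in at_bot. moment c k l (of_real x) (2 * of_real x) = 0" for v k l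
  proof -
    have "((\<lambda>x. moment c k l (0 + of_real x) (0 + of_real (2 * x)) - v) \<longlongrightarrow> 0) at_bot"
      using moment_leading[of 2 c k l 0 0] unfolding that(1) by simp
    moreover have "\<forall>\<^sub>F x in at_bot. moment c k l (0 + of_real x) (0 + of_real (2 * x)) - v = - v"
      using that(2) by eventually_elim simp
    ultimately have "((\<lambda>x::real. - v) \<longlongrightarrow> 0) at_bot" by (rule Lim_transform_eventually)
    then have "- v = 0" using tendsto_unique[OF trivial_limit_at_bot_linorder tendsto_const] by blast
    then show ?thesis by simp
  qed
  note simps = leading_moment_def sum_tensor_indices scaled_deriv_leading pairing_zero pairing_const
  have c00: "c (0,0) = 0" using H by (simp add: H_coeffs_def)
  have "2 / 9 * c (Suc 0,0) = 0"
  proof (rule lead)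
    show "leading_moment c 0 (Suc (Suc 0)) s t = 2 / 9 * c (Suc 0,0)" for s t
      by (simp add: simps c00 del: funpow.simps) (simp add: P1_leading_def pairing_const)
    show "\<forall>\<^sub>F x in at_bot. moment c 0 (Suc (Suc 0)) (of_real x) (2 * of_real x) = 0"
      using ev by eventually_elim (simp add: s_def)
  qed
  then have c10: "c (Suc 0,0) = 0" by simp
  then have c01: "c (0,Suc 0) = 0" using H by (simp add: H_coeffs_def)
  have "1 / 2 * c (0,2) = 0"
  proof (rule lead)
    show "leading_moment c (Suc 0) 0 s t = 1 / 2 * c (0,2)" for s t
      by (simp add: simps c00 c01 c10 del: funpow.simps) (simp add: P2_leading_def pairing_const)
    show "\<forall>\<^sub>F x in at_bot. moment c (Suc 0) 0 (of_real x) (2 * of_real x) = 0"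
      using ev by eventually_elim (simp add: s_def)
  qed
  then have c02: "c (0,2) = 0" by simp
  have "1 / 3 * c (Suc 0,Suc 0) = 0"
  proof (rule lead)
    show "leading_moment c 0 (Suc 0) s t = 1 / 3 * c (Suc 0,Suc 0)" for s t
      by (simp add: simps c00 c01 c10 c02 del: funpow.simps) (simp add: P1_leading_def pairing_const)
    show "\<forall>\<^sub>F x in at_bot. moment c 0 (Suc 0) (of_real x) (2 * of_real x) = 0"
      using ev by eventually_elim (simp add: s_def)
  qed
  then have c11: "c (Suc 0,Suc 0) = 0" by simp
  have "c (Suc 0,2) = 0"
  proof (rule lead)
    show "leading_moment c 0 0 s t = c (Suc 0,2)" for s t
      by (simp add: simps c00 c01 c10 c02 c11 del: funpow.simps) (simp add: P1_leading_def P2_leading_def pairing_const)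
    show "\<forall>\<^sub>F x in at_bot. moment c 0 0 (of_real x) (2 * of_real x) = 0"
      using ev by eventually_elim (simp add: s_def)
  qed
  then show "c p = 0" using p c00 c01 c02 c10 c11 by (auto simp: tensor_indices_def)
qed

lemma tensor_comb_cong: "(\<And>p. p \<in> tensor_indices \<Longrightarrow> c p = d p) \<Longrightarrow> tensor_comb c = tensor_comb d"
  unfolding tensor_comb_def by (intro sum.cong) auto

lemma tensor_comb_zero: "tensor_comb (\<lambda>_. 0) = 0"
  by (simp add: tensor_comb_def del: zero_fun_apply)


section \<open>Dimension and bijectivity\<close>

text \<open>
  The factors \<open>4\<close> and \<open>3\<close> solve \<open>4 * A\<^sub>0\<^sub>1 B\<^sub>0\<^sub>0 = 3 * A\<^sub>0\<^sub>0 B\<^sub>0\<^sub>1\<close>.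
\<close>

definition H_param :: "(4 \<Rightarrow> complex) \<Rightarrow> nat \<times> nat \<Rightarrow> complex" where
  "H_param v p = (if p = (0,1) then 4 * v 1 else if p = (1,0) then 3 * v 1 else if p = (0,2) then v 2
     else if p = (1,1) then v 3 else if p = (1,2) then v 4 else 0)"

definition H_basis :: "4 \<Rightarrow> complex \<times> complex \<Rightarrow> complex" where
  "H_basis i = tensor_comb (H_param (\<lambda>j. if j = i then 1 else 0))"

lemma H_coeffs_param: "H_coeffs (H_param v)"
  by (simp add: H_coeffs_def H_param_def)

lemma H_space_eq: "H_space = range (\<lambda>v. tensor_comb (H_param v))"
proof (intro equalityI subsetI)
  fix t assume "t \<in> H_space"
  then obtain c where t: "t = tensor_comb c" and c: "c (0,0) = 0" "4 * c (1,0) = 3 * c (0,1)"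
    by (auto simp: H_space_iff)
  define v :: "4 \<Rightarrow> complex" where
    "v i = (if i = 1 then c (0,1) / 4 else if i = 2 then c (0,2) else if i = 3 then c (1,1) else c (1,2))" for i
  have "t = tensor_comb (H_param v)"
    unfolding t by (rule tensor_comb_cong) (use c in \<open>auto simp: tensor_indices_def H_param_def v_def field_simps\<close>)
  then show "t \<in> range (\<lambda>v. tensor_comb (H_param v))" by blast
next
  fix t assume "t \<in> range (\<lambda>v. tensor_comb (H_param v))"
  then show "t \<in> H_space" using H_coeffs_param by (auto simp: H_space_iff H_coeffs_def)
qed

lemma tensor_comb_H_param: "tensor_comb (H_param v) = (\<Sum>i\<in>UNIV. fscale (v i) (H_basis i))"
proof -
  have "(\<Sum>i\<in>UNIV. fscale (v i) (H_basis i)) = tensor_comb (\<lambda>p. v 1 * H_param (\<lambda>j. if j = 1 then 1 else 0) p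
     + v 2 * H_param (\<lambda>j. if j = 2 then 1 else 0) p + v 3 * H_param (\<lambda>j. if j = 3 then 1 else 0) p
     + v 4 * H_param (\<lambda>j. if j = 4 then 1 else 0) p)"
    by (simp add: sum_4 H_basis_def tensor_comb_scale tensor_comb_add del: plus_fun_apply)
  also have "\<dots> = tensor_comb (H_param v)"
    by (rule tensor_comb_cong) (auto simp: H_param_def)
  finally show ?thesis ..
qed

lemma P_op_H_param_zero:
  assumes "P_op (tensor_comb (H_param v)) = (\<lambda>_. 0)"
  shows "v i = 0"
proof -
  have "H_param v p = 0" if "p \<in> tensor_indices" for p
    using P_op_H(2)[OF H_coeffs_param assms that] .
  from this[of "(0,1)"] this[of "(0,2)"] this[of "(1,1)"] this[of "(1,2)"]
  show ?thesis using exhaust_4[of i] by (auto simp: H_param_def tensor_indices_def)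
qed

lemma P_op_H_param: "P_op (tensor_comb (H_param v)) w = (\<Sum>i\<in>UNIV. v i * P_op (H_basis i) w)"
proof -
  have "P_op (\<Sum>i\<in>UNIV. fscale (v i) (H_basis i)) = (\<Sum>i\<in>UNIV. fscale (v i) (P_op (H_basis i)))"
    by (rule linear_on_sum[OF linear_P_op subspace_sol_P1_P2 fvec.vector_space_axioms])
       (simp add: H_basis_def tensor_comb_in)
  then show ?thesis by (simp add: tensor_comb_H_param sum_fun_apply fscale_def)
qed

lemma subspace_H_space: "fvec.subspace H_space"
  unfolding fvec.subspace_def
proof (intro conjI ballI allI)
  show "0 \<in> H_space"
    unfolding H_space_iff by (intro exI[of _ "\<lambda>_. 0"]) (simp add: tensor_comb_zero del: zero_fun_apply)
  show "s + t \<in> H_space" if "s \<in> H_space" "t \<in> H_space" for s t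
    using that unfolding H_space_eq tensor_comb_H_param
    by (auto simp: sum.distrib[symmetric] fvec.scale_left_distrib[symmetric] simp del: plus_fun_apply)
  show "fscale a t \<in> H_space" if "t \<in> H_space" for a t
    using that unfolding H_space_eq tensor_comb_H_param by (auto simp: fvec.scale_sum_right)
qed

text \<open>
  Independence of the four basis tensors follows from injectivity of the operator.
\<close>

lemma dim_H_space: "fvec.dim H_space = 4"
proof -
  have zero: "v i = 0" if "(\<Sum>i\<in>UNIV. fscale (v i) (H_basis i)) = 0" for v i
  proof (rule P_op_H_param_zero)
    show "P_op (tensor_comb (H_param v)) = (\<lambda>_. 0)"
      unfolding tensor_comb_H_param that
      using linear_on_zero[OF linear_P_op subspace_sol_P1_P2 fvec.vector_space_axioms] by (simp add: zero_fun_def)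
  qed
  have inj: "inj H_basis"
  proof (rule injI, rule ccontr)
    fix i j assume e: "H_basis i = H_basis j" and ij: "i \<noteq> j"
    define v :: "4 \<Rightarrow> complex" where "v k = (if k = i then 1 else 0) - (if k = j then 1 else 0)" for k
    have "(\<Sum>k\<in>UNIV. fscale (v k) (H_basis k)) = 0"
    proof
      fix x
      show "(\<Sum>k\<in>UNIV. fscale (v k) (H_basis k)) x = 0 x"
        using e by (simp add: v_def sum_fun_apply fscale_def left_diff_distrib sum_subtractf if_distrib[of "\<lambda>a. a * _"] cong: if_cong)
    qed
    from zero[OF this, of i] ij show False by (simp add: v_def)
  qed
  have "fvec.independent (range H_basis)"
    unfolding fvec.dependent_finite[OF finite_imageI[OF finite_class.finite_UNIV]]
  proof (clarify, unfold sum.reindex[OF inj] o_def)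
    fix u i assume "(\<Sum>k\<in>UNIV. fscale (u (H_basis k)) (H_basis k)) = 0" "u (H_basis i) \<noteq> 0"
    then show False using zero[of "\<lambda>k. u (H_basis k)" i] by blast
  qed
  moreover have "fvec.span (range H_basis) = fvec.span H_space"
  proof (rule fvec.span_eq[THEN iffD2], intro conjI)
    show "range H_basis \<subseteq> fvec.span H_space"
      unfolding H_space_eq H_basis_def by (auto intro!: fvec.span_base)
    show "H_space \<subseteq> fvec.span (range H_basis)"
      unfolding H_space_eq tensor_comb_H_param
      by (clarify, intro fvec.span_sum fvec.span_scale, rule fvec.span_base) simp
  qed
  ultimately have "fvec.dim H_space = card (range H_basis)" by (rule fvec.dim_eq_card[rotated])
  also have "\<dots> = 4" using card_image[OF inj] by simp
  finally show ?thesis .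
qed

definition F1_coeff :: "nat \<Rightarrow> complex \<Rightarrow> complex" where
  "F1_coeff k w = (let z = exp w in
     [z^2 * (-3113*z^3 - 9924*z^2 + 1476*z + 192), - (4*z^2 * (2547*z^2 + 350*z - 104)),
      z * (-2264*z^2 + 192*z + 3), 283*z^2 - 590*z + 24, 283*z - 24] ! k)"

lemma sol_F1_ode: "sol_F1 = ode_space 4 F1_coeff"
proof -
  have "{..4} = {0, 1, 2, 3, 4::nat}" by auto
  then show ?thesis
    unfolding sol_F1_def ode_space_def holo_cover_def theta_eq_deriv F1_coeff_def Let_def
    by (auto simp: theta_def eval_nat_numeral algebra_simps)
qed

text \<open>
  The leading coefficient \<open>283 * z - 24\<close> is nonzero at \<open>w = 0\<close>, that is \<open>z = 1\<close>, so four independent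
  solutions span.
\<close>

lemma sol_F1_surj:
  assumes f: "f \<in> sol_F1"
  shows "\<exists>v. f = P_op (tensor_comb (H_param v))"
proof -
  have "\<exists>v. \<forall>w. f w = (\<Sum>i\<in>UNIV. v i * P_op (H_basis i) w)"
  proof (rule ode_solutions_span[where a = F1_coeff and \<xi> = 0])
    fix k assume "k \<le> CARD(4)"
    then have "k \<in> {0, 1, 2, 3, 4}" by auto
    then show "F1_coeff k holomorphic_on UNIV"
      by (auto simp: F1_coeff_def[abs_def] Let_def intro!: holomorphic_intros)
  next
    show "P_op (H_basis i) \<in> ode_space CARD(4) F1_coeff" for i
      using P_op_H(1)[OF H_coeffs_param] by (simp add: sol_F1_ode H_basis_def)
    show "f \<in> ode_space CARD(4) F1_coeff" using f by (simp add: sol_F1_ode)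
    show "F1_coeff CARD(4) 0 \<noteq> 0" by (simp add: F1_coeff_def)
    fix v i assume "\<And>w. (\<Sum>i\<in>UNIV. v i * P_op (H_basis i) w) = 0"
    then show "v i = 0" by (intro P_op_H_param_zero) (simp add: fun_eq_iff P_op_H_param)
  qed
  then show ?thesis by (auto simp: fun_eq_iff P_op_H_param)
qed

lemma inj_on_P_op: "inj_on P_op H_space"
proof (rule inj_onI)
  fix s t assume "s \<in> H_space" "t \<in> H_space" and e: "P_op s = P_op t"
  then obtain u v where s: "s = tensor_comb (H_param u)" and t: "t = tensor_comb (H_param v)" by (auto simp: H_space_eq)
  have "P_op (tensor_comb (H_param (\<lambda>i. u i - v i))) = (\<lambda>_. 0)"
    using e by (simp add: s t fun_eq_iff P_op_H_param left_diff_distrib sum_subtractf)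
  from P_op_H_param_zero[OF this] have "u = v" by (auto simp: fun_eq_iff)
  then show "s = t" by (simp add: s t)
qed

lemma bij_betw_P_op: "bij_betw P_op H_space sol_F1"
  unfolding bij_betw_def
proof (intro conjI inj_on_P_op equalityI subsetI)
  fix f assume "f \<in> P_op ` H_space"
  then show "f \<in> sol_F1" using P_op_H(1)[OF H_coeffs_param] by (auto simp: H_space_eq)
next
  fix f assume "f \<in> sol_F1"
  then show "f \<in> P_op ` H_space" using sol_F1_surj unfolding H_space_eq by blast
qed

lemma P_op_holomorphic: "P_op ` sol_P1_P2 \<subseteq> holo_cover"
proof
  fix f assume "f \<in> P_op ` sol_P1_P2"
  then obtain c where f: "f = P_op (tensor_comb c)" using sol_P1_P2_obtain by blast
  have "(\<lambda>w. moment c 0 0 w (2 * w)) holomorphic_on UNIV"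
    using has_field_derivative_moment[of c 0 0 0 1 0 2]
    by (auto simp: holomorphic_on_def field_differentiable_def)
  then show "f \<in> holo_cover"
    by (auto simp: f holo_cover_def P_op_tensor_comb[abs_def] intro!: holomorphic_intros)
qed

lemma P_integrand_integrable:
  "f \<in> sol_P1 \<Longrightarrow> g \<in> sol_P2 \<Longrightarrow> set_integrable lborel {0<..} (P_integrand f g w)"
  using set_integrable_pairing_integrand[OF tame_sol_P1 tame_sol_P2, of f g w "2 * w"]
  by (simp add: P_integrand_def[abs_def] pairing_integrand_def[abs_def])

theorem corollary11p7:
  shows "(\<forall>f\<in>sol_P1. \<forall>g\<in>sol_P2. \<forall>w. set_integrable lborel {0<..} (P_integrand f g w))
    \<and> linear_on fscale fscale sol_P1_P2 P_op
    \<and> P_op ` sol_P1_P2 \<subseteq> holo_cover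
    \<and> (\<forall>f\<in>sol_P1. \<forall>g\<in>sol_P2. P_op (tensor f g) = P_dec f g)
    \<and> fvec.subspace H_space
    \<and> fvec.dim H_space = 4
    \<and> bij_betw P_op H_space sol_F1"
  using P_integrand_integrable linear_P_op P_op_holomorphic P_op_tensor subspace_H_space dim_H_space bij_betw_P_op
  by blast

end
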